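(* Let $\mathcal{H}$ be a Hilbert space with $\dim\mathcal{H}>\aleph_0$ and let $A\in\mathcal{B}(\mathcal{H})$ be a positive contraction. The following are equivalent: (i) there is a contraction $T\in\mathcal{B}(\mathcal{H})$ with $A_T=A$; (ii) there is a contraction $T\in\mathcal{B}(\mathcal{H})$ with $\lim_{n\to\infty}\|T^{*n}T^n-A\|=0$; (iii) $A$ is a finite rank orthogonal projection, or $\kappa:=\dim\mathcal{H}(]0,1])\ge\aleph_0$ and $r_\kappa(A)=1$; (iv) $\dim\mathcal{H}(]0,1])=\dim\mathcal{H}(]\delta,1])$ for every $0\le\delta<1$. Moreover, if (i) holds and $\dim\ker(A-I)$ is either $0$ or infinite, then $T$ in (ii) can be chosen of class $C_{\cdot0}$.
   Context: For a contraction $T$, $A_T$ is the strong-operator limit of $T^{*n}T^n$. $\mathcal{H}(\omega)=E(\omega)\mathcal{H}$ for Borel $\omega\subseteq\mathbb{R}$, with $E$ the spectral measure of $A$. For an infinite cardinal $\kappa\le\dim\mathcal{H}$, let $\mathcal{C}_\kappa$ be the norm closure of $\{S\in\mathcal{B}(\mathcal{H}):\dim\overline{\operatorname{ran}S}<\kappa\}$ (a proper closed two-sided ideal), $\pi_\kappa:\mathcal{B}(\mathcal{H})\to\mathcal{B}(\mathcal{H})/\mathcal{C}_\kappa$ the quotient map, and $r_\kappa(A)$ the spectral radius of $\pi_\kappa(A)$ in the quotient Banach algebra. $T$ is of class $C_{\cdot0}$ if $T^{*n}x\to0$ for every $x$. *)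

theory Defs
  imports "HOL-Analysis.Analysis"
begin

class complex_inner = real_normed_vector +
  fixes scaleC :: "complex \<Rightarrow> 'a \<Rightarrow> 'a"
    and cinner :: "'a \<Rightarrow> 'a \<Rightarrow> complex"
  assumes scaleC_add_right: "scaleC a (x + y) = scaleC a x + scaleC a y"
    and scaleC_add_left: "scaleC (a + b) x = scaleC a x + scaleC b x"
    and scaleC_scaleC: "scaleC a (scaleC b x) = scaleC (a * b) x"
    and scaleC_one: "scaleC 1 x = x"
    and scaleR_scaleC: "scaleR r x = scaleC (complex_of_real r) x"
    and cinner_add_left: "cinner (x + y) z = cinner x z + cinner y z"
    and cinner_scaleC_left: "cinner (scaleC a x) y = cnj a * cinner x y"
    and cinner_commute: "cinner x y = cnj (cinner y x)"
    and cinner_self: "cinner x x = complex_of_real ((norm x)\<^sup>2)"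

class chilbert = complex_inner + complete_space

definition bounded_clin :: "('a::complex_inner \<Rightarrow> 'a) \<Rightarrow> bool" where
  "bounded_clin T \<longleftrightarrow> bounded_linear T \<and> (\<forall>c x. T (scaleC c x) = scaleC c (T x))"

definition adj :: "('a::complex_inner \<Rightarrow> 'a) \<Rightarrow> ('a \<Rightarrow> 'a)" where
  "adj T = (SOME S. \<forall>x y. cinner (T x) y = cinner x (S y))"

definition contraction :: "('a::complex_inner \<Rightarrow> 'a) \<Rightarrow> bool" where
  "contraction T \<longleftrightarrow> bounded_clin T \<and> onorm T \<le> 1"

definition positive_op :: "('a::complex_inner \<Rightarrow> 'a) \<Rightarrow> bool" where
  "positive_op A \<longleftrightarrow> bounded_clin A \<and>
     (\<forall>x. Im (cinner x (A x)) = 0 \<and> Re (cinner x (A x)) \<ge> 0)"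

definition orth_proj :: "('a::complex_inner \<Rightarrow> 'a) \<Rightarrow> bool" where
  "orth_proj P \<longleftrightarrow> bounded_clin P \<and> P \<circ> P = P \<and> adj P = P"

definition cspan :: "'a::complex_inner set \<Rightarrow> 'a set" where
  "cspan B = {x. \<exists>F c. finite F \<and> F \<subseteq> B \<and> x = (\<Sum>v\<in>F. scaleC (c v) v)}"

definition finite_rank :: "('a::complex_inner \<Rightarrow> 'a) \<Rightarrow> bool" where
  "finite_rank S \<longleftrightarrow> (\<exists>F. finite F \<and> range S \<subseteq> cspan F)"

definition powpow :: "('a::complex_inner \<Rightarrow> 'a) \<Rightarrow> nat \<Rightarrow> 'a \<Rightarrow> 'a" where
  "powpow T n = (adj T ^^ n) \<circ> (T ^^ n)"

definition AT :: "('a::complex_inner \<Rightarrow> 'a) \<Rightarrow> 'a \<Rightarrow> 'a" where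
  "AT T = (\<lambda>x. lim (\<lambda>n. powpow T n x))"

definition class_C_dot0 :: "('a::complex_inner \<Rightarrow> 'a) \<Rightarrow> bool" where
  "class_C_dot0 T \<longleftrightarrow> (\<forall>x. (\<lambda>n. (adj T ^^ n) x) \<longlonglongrightarrow> 0)"

definition is_onb :: "'a::complex_inner set \<Rightarrow> 'a set \<Rightarrow> bool" where
  "is_onb M B \<longleftrightarrow> B \<subseteq> M \<and> (\<forall>x\<in>B. norm x = 1) \<and>
     (\<forall>x\<in>B. \<forall>y\<in>B. x \<noteq> y \<longrightarrow> cinner x y = 0) \<and> closure (cspan B) = M"

definition hdim :: "'a::complex_inner set \<Rightarrow> 'a rel" where
  "hdim M = card_of (SOME B. is_onb M B)"

text \<open>\<open>E\<close> is the spectral measure of the self-adjoint operator \<open>A\<close>: a projection-valued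
measure on the Borel sets of the real line with \<open>E(\<real>) = I\<close>, multiplicative, countably
additive in the sense that each \<open>\<omega> \<mapsto> \<langle>E(\<omega>)x,x\<rangle> = \<parallel>E(\<omega>)x\<parallel>\<^sup>2\<close> is a measure, and
\<open>\<langle>x,Ax\<rangle> = \<integral> t d\<langle>E(t)x,x\<rangle>\<close>. (Normalized to be 0 off the Borel sets.)\<close>
definition spectral_measure_of ::
    "('a::complex_inner \<Rightarrow> 'a) \<Rightarrow> (real set \<Rightarrow> 'a \<Rightarrow> 'a) \<Rightarrow> bool" where
  "spectral_measure_of A E \<longleftrightarrow>
     (\<forall>\<omega>. \<omega> \<notin> sets borel \<longrightarrow> E \<omega> = (\<lambda>_. 0)) \<and>
     (\<forall>\<omega>\<in>sets borel. orth_proj (E \<omega>)) \<and>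
     E UNIV = id \<and>
     (\<forall>\<omega>1\<in>sets borel. \<forall>\<omega>2\<in>sets borel. E (\<omega>1 \<inter> \<omega>2) = E \<omega>1 \<circ> E \<omega>2) \<and>
     (\<forall>x. measure_space UNIV (sets borel) (\<lambda>\<omega>. ennreal ((norm (E \<omega> x))\<^sup>2)) \<and>
          (\<exists>r. has_bochner_integral
                 (measure_of UNIV (sets borel) (\<lambda>\<omega>. ennreal ((norm (E \<omega> x))\<^sup>2)))
                 (\<lambda>t. t) r \<and> cinner x (A x) = complex_of_real r))"

definition spec_subspace :: "('a::complex_inner \<Rightarrow> 'a) \<Rightarrow> real set \<Rightarrow> 'a set" where
  "spec_subspace A \<omega> = range ((THE E. spectral_measure_of A E) \<omega>)"

definition ideal_C :: "'a rel \<Rightarrow> ('a::complex_inner \<Rightarrow> 'a) set" where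
  "ideal_C \<kappa> = {S. bounded_clin S \<and>
     (\<forall>\<epsilon>>0. \<exists>K. bounded_clin K \<and> ordLess2 (hdim (closure (range K))) \<kappa> \<and>
                 onorm (\<lambda>x. S x - K x) < \<epsilon>)}"

text \<open>Spectrum of \<open>\<pi>\<^sub>\<kappa>(A)\<close> in the quotient algebra \<open>B(H)/C\<^sub>\<kappa>\<close>:
\<open>\<lambda>\<close> is in the resolvent iff \<open>A - \<lambda>I\<close> is invertible modulo \<open>C\<^sub>\<kappa>\<close>.\<close>
definition quot_spectrum :: "'a rel \<Rightarrow> ('a::complex_inner \<Rightarrow> 'a) \<Rightarrow> complex set" where
  "quot_spectrum \<kappa> A = {z. \<not> (\<exists>B. bounded_clin B \<and>
       (\<lambda>x. (A (B x) - scaleC z (B x)) - x) \<in> ideal_C \<kappa> \<and>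
       (\<lambda>x. B (A x - scaleC z x) - x) \<in> ideal_C \<kappa>)}"

definition r_kappa :: "'a rel \<Rightarrow> ('a::complex_inner \<Rightarrow> 'a) \<Rightarrow> real" where
  "r_kappa \<kappa> A = Sup (cmod ` quot_spectrum \<kappa> A)"

end

theory Submission
  imports Defs
begin

text \<open>
  The Borel sets on which a spectral measure of \<open>A\<close> can be defined form a Dynkin system, which
  contains the half-lines because the projection \<open>Q l\<close> belonging to \<open>]-\<infinity>, l]\<close> is the one onto the
  kernel of the positive part of \<open>A - l\<close>; it is the only projection commuting with \<open>A\<close> that
  separates \<open>A \<le> l\<close> from \<open>A > l\<close>, whence uniqueness.

  If \<open>A\<close> is the asymptotic limit of \<open>T\<close>, then \<open>\<langle>A T\<^sup>n x, T\<^sup>n x\<rangle> = \<langle>A x, x\<rangle> = lim \<parallel>T\<^sup>n x\<parallel>\<^sup>2\<close>. If the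
  spectral subspace of \<open>]l, 1]\<close> were smaller than that of \<open>]0, 1]\<close>, some \<open>x \<noteq> 0\<close> in the latter would
  have every \<open>T\<^sup>n x\<close> orthogonal to the former, so that \<open>\<langle>A x, x\<rangle> \<le> l \<langle>A x, x\<rangle>\<close>.

  Conversely take an orthonormal basis adapted to the flag of the subspaces of \<open>]m/(m+1), 1]\<close>. These
  all have the same infinite dimension, so a transfinite greedy choice gives an injection of the
  basis into itself which raises the level; let \<open>V\<close> be the induced isometry. Then
  \<open>T = A\<^sup>-\<^sup>1\<^sup>/\<^sup>2 V A\<^sup>1\<^sup>/\<^sup>2\<close> is a contraction by summation by parts along the flag, and
  \<open>(T\<^sup>n)* T\<^sup>n\<close> lies between \<open>A\<close> and \<open>A (n+1)/n\<close>.
\<close>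

section \<open>Complex inner product spaces\<close>

text \<open>The square root of \<open>A\<close> need not be bounded below, so it can be inverted
  only above a positive level. This is why \<open>V\<close> must carry every vector at once to level
  1/2 or higher. Dividing by the root at level \<open>m/(m+1)\<close> costs at most the factor
  \<open>1 + 1/m\<close> in squared norm; since this does not depend on the vector and tends to 1,
  the convergence is uniform and not merely strong. The basis vectors of ker(A - I) lie on every
  level, so a level-raising injection sends them to each other. Finitely many of them are permuted,
  and then the powers of the adjoint of \<open>V\<close> cannot tend to 0. If there are none or
  infinitely many, the injection can be chosen so that all its backward orbits end, and
  \<open>T\<close> inherits class C_.0 from \<open>V\<close>. The counting behind (i) ==> (iv)
  breaks down if the subspace of \<open>]l, 1]\<close> is finite-dimensional, because one condition
  for each power of \<open>T\<close> is then too many; compactness of a finite-dimensional unit ball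
  takes over. For (iii), \<open>r_kappa\<close> turns out to be the supremum of the levels
  \<open>s\<close> at which the dimension of \<open>]s, 1]\<close> is still at least
  \<open>\<kappa>\<close>.\<close>

lemma cinner_add_right: "cinner (x::'a::complex_inner) (y + z) = cinner x y + cinner x z"
  by (metis cinner_add_left cinner_commute complex_cnj_add)

lemma cinner_scaleC_right: "cinner (x::'a::complex_inner) (scaleC a y) = a * cinner x y"
  by (metis cinner_commute cinner_scaleC_left complex_cnj_cnj complex_cnj_mult)

lemma cinner_zero_left [simp]: "cinner 0 (x::'a::complex_inner) = 0"
  using cinner_add_left[of 0 0 x] by simp

lemma cinner_zero_right [simp]: "cinner (x::'a::complex_inner) 0 = 0"
  using cinner_add_right[of x 0 0] by simp

lemma cinner_minus_left: "cinner (- x) (y::'a::complex_inner) = - cinner x y"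
  using cinner_add_left[of x "- x" y] by (simp add: eq_neg_iff_add_eq_0 add.commute)

lemma cinner_minus_right: "cinner (y::'a::complex_inner) (- x) = - cinner y x"
  using cinner_add_right[of y x "- x"] by (simp add: eq_neg_iff_add_eq_0 add.commute)

lemma cinner_diff_left: "cinner (x - y) (z::'a::complex_inner) = cinner x z - cinner y z"
  using cinner_add_left[of x "- y" z] by (simp add: cinner_minus_left)

lemma cinner_diff_right: "cinner (z::'a::complex_inner) (x - y) = cinner z x - cinner z y"
  using cinner_add_right[of z x "- y"] by (simp add: cinner_minus_right)

lemmas cinner_algebra = cinner_add_left cinner_add_right cinner_diff_left cinner_diff_right
  cinner_minus_left cinner_minus_right cinner_scaleC_left cinner_scaleC_right

lemma cinner_sum_right: "cinner (x::'a::complex_inner) (\<Sum>i\<in>I. f i) = (\<Sum>i\<in>I. cinner x (f i))"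
  by (induction I rule: infinite_finite_induct) (auto simp: cinner_add_right)

lemma cinner_sum_left: "cinner (\<Sum>i\<in>I. f i) (x::'a::complex_inner) = (\<Sum>i\<in>I. cinner (f i) x)"
  by (induction I rule: infinite_finite_induct) (auto simp: cinner_add_left)

lemma scaleC_zero_right [simp]: "scaleC a (0::'a::complex_inner) = 0"
  using scaleC_add_right[of a 0 0] by simp

lemma scaleC_zero_left [simp]: "scaleC 0 (x::'a::complex_inner) = 0"
  using scaleC_add_left[of 0 0 x] by simp

lemma scaleC_minus_left: "scaleC (- a) (x::'a::complex_inner) = - scaleC a x"
  using scaleC_add_left[of a "- a" x] by (simp add: eq_neg_iff_add_eq_0 add.commute)

lemma scaleC_minus_right: "scaleC a (- (x::'a::complex_inner)) = - scaleC a x"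
  using scaleC_add_right[of a x "- x"] by (simp add: eq_neg_iff_add_eq_0 add.commute)

lemma scaleC_diff_right: "scaleC a (x - (y::'a::complex_inner)) = scaleC a x - scaleC a y"
  using scaleC_add_right[of a x "- y"] by (simp add: scaleC_minus_right)

lemma scaleC_diff_left: "scaleC (a - b) (x::'a::complex_inner) = scaleC a x - scaleC b x"
  using scaleC_add_left[of a "- b" x] by (simp add: scaleC_minus_left)

lemma scaleC_sum_right: "scaleC a (\<Sum>i\<in>I. f i) = (\<Sum>i\<in>I. scaleC a (f i :: 'a::complex_inner))"
  by (induction I rule: infinite_finite_induct) (auto simp: scaleC_add_right)

lemma cinner_self_Re: "Re (cinner (x::'a::complex_inner) x) = (norm x)\<^sup>2"
  by (simp add: cinner_self)

lemma cinner_eq_zero_iff [simp]: "cinner (x::'a::complex_inner) x = 0 \<longleftrightarrow> x = 0"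
  by (simp add: cinner_self)

lemma cinner_commute_zero: "cinner (x::'a::complex_inner) y = 0 \<longleftrightarrow> cinner y x = 0"
  by (metis cinner_commute complex_cnj_zero)

lemma Re_cinner_commute: "Re (cinner (x::'a::complex_inner) y) = Re (cinner y x)"
  by (metis cinner_commute cnj.simps(1))

lemma norm_scaleC: "norm (scaleC a (x::'a::complex_inner)) = cmod a * norm x"
proof -
  have "complex_of_real ((norm (scaleC a x))\<^sup>2) = complex_of_real ((cmod a * norm x)\<^sup>2)"
    unfolding cinner_self[symmetric] cinner_scaleC_left cinner_scaleC_right
    using complex_norm_square[of a] by (simp add: cinner_self power_mult_distrib mult.commute)
  then show ?thesis
    by (metis mult_nonneg_nonneg norm_ge_zero of_real_eq_iff power2_eq_imp_eq)
qed

lemma norm_add_sq: "(norm (x + y :: 'a::complex_inner))\<^sup>2 = (norm x)\<^sup>2 + (norm y)\<^sup>2 + 2 * Re (cinner x y)"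
  by (simp add: cinner_self_Re[symmetric] cinner_algebra Re_cinner_commute[of y x])

lemma norm_diff_sq: "(norm (x - y :: 'a::complex_inner))\<^sup>2 = (norm x)\<^sup>2 + (norm y)\<^sup>2 - 2 * Re (cinner x y)"
  by (simp add: cinner_self_Re[symmetric] cinner_algebra Re_cinner_commute[of y x])

lemma pythagoras: "cinner x y = 0 \<Longrightarrow> (norm (x + y :: 'a::complex_inner))\<^sup>2 = (norm x)\<^sup>2 + (norm y)\<^sup>2"
  by (simp add: norm_add_sq)

lemma parallelogram:
  "(norm (x + y))\<^sup>2 + (norm (x - y))\<^sup>2 = 2 * (norm x)\<^sup>2 + 2 * (norm (y::'a::complex_inner))\<^sup>2"
  by (simp add: norm_add_sq norm_diff_sq)

lemma eq_by_cinner: "(\<And>z. cinner z x = cinner z y) \<Longrightarrow> x = (y::'a::complex_inner)"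
  by (metis cinner_diff_right cinner_eq_zero_iff right_minus_eq)

section \<open>Bounded operators\<close>

lemma bounded_clin_bl: "bounded_clin T \<Longrightarrow> bounded_linear T"
  by (simp add: bounded_clin_def)

lemma
  assumes "bounded_clin T"
  shows clin_add: "T (x + y) = T x + T y"
    and clin_diff: "T (x - y) = T x - T y"
    and clin_zero: "T 0 = 0"
    and clin_scaleC: "T (scaleC c x) = scaleC c (T x)"
    and clin_norm: "norm (T x) \<le> onorm T * norm x"
  using assms bounded_linear.linear[OF bounded_clin_bl[OF assms]]
  by (auto simp: linear_add linear_diff linear_0 bounded_clin_def intro: onorm)

lemma bounded_clinI:
  assumes "\<And>x y. T (x + y) = T x + T y" "\<And>c x. T (scaleC c x) = scaleC c (T x)"
    "\<And>x. norm (T x) \<le> K * norm x"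
  shows "bounded_clin (T::'a::complex_inner \<Rightarrow> 'a)"
  unfolding bounded_clin_def
  by (metis assms bounded_linear_intro scaleR_scaleC mult.commute)

lemma clin_bound:
  assumes "bounded_clin T" obtains K where "K > 0" "\<And>x. norm (T x) \<le> K * norm x"
  using bounded_linear.pos_bounded[OF bounded_clin_bl[OF assms]] by (metis mult.commute)

lemma clin_tendsto: "bounded_clin T \<Longrightarrow> (f \<longlongrightarrow> l) F \<Longrightarrow> ((\<lambda>x. T (f x)) \<longlongrightarrow> T l) F"
  using bounded_linear.tendsto bounded_clin_bl by blast

lemma clin_cont: "bounded_clin T \<Longrightarrow> continuous_on S T"
  using bounded_clin_bl linear_continuous_on by blast

lemma bounded_clin_id [simp]: "bounded_clin (\<lambda>x. x)" "bounded_clin id"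
  by (auto intro!: bounded_clinI[where K = 1])

lemma bounded_clin_zero [simp]: "bounded_clin (\<lambda>x. 0)"
  by (auto intro!: bounded_clinI[where K = 1])

lemma bounded_clin_add:
  "bounded_clin S \<Longrightarrow> bounded_clin T \<Longrightarrow> bounded_clin (\<lambda>x. S x + T x)"
  unfolding bounded_clin_def by (auto simp: bounded_linear_add scaleC_add_right)

lemma bounded_clin_diff:
  "bounded_clin S \<Longrightarrow> bounded_clin T \<Longrightarrow> bounded_clin (\<lambda>x. S x - T x)"
  unfolding bounded_clin_def by (auto simp: bounded_linear_sub scaleC_diff_right)

lemma bounded_clin_scaleC:
  assumes "bounded_clin T" shows "bounded_clin (\<lambda>x. scaleC c (T x))"
proof -
  obtain K where K: "\<And>x. norm (T x) \<le> K * norm x" using clin_bound[OF assms] by blast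
  show ?thesis
  proof (rule bounded_clinI[where K = "cmod c * K"])
    show "norm (scaleC c (T x)) \<le> cmod c * K * norm x" for x
      using K[of x] by (simp add: norm_scaleC mult.assoc mult_left_mono)
  qed (simp_all add: clin_add[OF assms] clin_scaleC[OF assms] scaleC_add_right scaleC_scaleC mult.commute)
qed

lemma bounded_clin_scaleR:
  "bounded_clin T \<Longrightarrow> bounded_clin (\<lambda>x. c *\<^sub>R T x)"
  unfolding scaleR_scaleC by (rule bounded_clin_scaleC)

lemma bounded_clin_comp:
  "bounded_clin S \<Longrightarrow> bounded_clin T \<Longrightarrow> bounded_clin (\<lambda>x. S (T x))"
  unfolding bounded_clin_def by (auto intro: bounded_linear_compose)

lemma bounded_clin_o: "bounded_clin S \<Longrightarrow> bounded_clin T \<Longrightarrow> bounded_clin (S \<circ> T)"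
  using bounded_clin_comp by (simp add: comp_def)

lemma bounded_clin_pow: "bounded_clin T \<Longrightarrow> bounded_clin (T ^^ n)"
  by (induction n) (auto intro: bounded_clin_o)


lemma contraction_iff:
  "contraction T \<longleftrightarrow> bounded_clin T \<and> (\<forall>x. norm (T x) \<le> norm (x::'a::complex_inner))"
proof
  assume "contraction T"
  then have T: "bounded_clin T" "onorm T \<le> 1" by (auto simp: contraction_def)
  have "norm (T x) \<le> norm x" for x
    using clin_norm[OF T(1), of x] mult_right_mono[OF T(2), of "norm x"] by simp
  then show "bounded_clin T \<and> (\<forall>x. norm (T x) \<le> norm x)" using T by blast
next
  assume "bounded_clin T \<and> (\<forall>x. norm (T x) \<le> norm x)"
  then show "contraction T" by (auto simp: contraction_def intro!: onorm_bound)
qed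

lemma contraction_pow: "contraction T \<Longrightarrow> norm ((T ^^ n) x) \<le> norm (x::'a::complex_inner)"
  by (induction n) (auto simp: contraction_iff intro: order_trans)

section \<open>Self-adjoint and positive operators\<close>

definition selfadj :: "('a::complex_inner \<Rightarrow> 'a) \<Rightarrow> bool" where
  "selfadj T \<longleftrightarrow> bounded_clin T \<and> (\<forall>x y. cinner (T x) y = cinner x (T y))"

lemma selfadj_clin: "selfadj T \<Longrightarrow> bounded_clin T"
  by (simp add: selfadj_def)

lemma selfadj_swap: "selfadj T \<Longrightarrow> cinner (T x) y = cinner x (T y)"
  by (simp add: selfadj_def)

lemma selfadj_form_real: "selfadj T \<Longrightarrow> cinner x (T x) = complex_of_real (Re (cinner x (T x)))"
  by (metis Reals_cnj_iff cinner_commute of_real_Re selfadj_swap)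

text \<open>Polarization.\<close>
lemma selfadj_of_real_form:
  assumes T: "bounded_clin T" and re: "\<And>x. Im (cinner x (T x)) = 0"
  shows "selfadj T"
proof -
  have "cinner (T x) y = cinner x (T y)" for x y
  proof -
    have 1: "Im (cinner x (T y)) + Im (cinner y (T x)) = 0"
      using re[of "x + y"] re[of x] re[of y] by (simp add: clin_add[OF T] cinner_algebra)
    have "Im (cinner x (T (scaleC \<i> y))) + Im (cinner (scaleC \<i> y) (T x)) = 0"
      using re[of "x + scaleC \<i> y"] re[of x] re[of "scaleC \<i> y"] by (simp add: clin_add[OF T] cinner_algebra)
    then have 2: "Re (cinner x (T y)) - Re (cinner y (T x)) = 0"
      by (simp add: clin_scaleC[OF T] cinner_algebra)
    show ?thesis
      by (subst cinner_commute) (use 1 2 in \<open>simp add: complex_eq_iff\<close>)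
  qed
  with T show ?thesis by (simp add: selfadj_def)
qed

lemma positive_op_selfadj: "positive_op T \<Longrightarrow> selfadj T"
  by (auto simp: positive_op_def intro: selfadj_of_real_form)

lemma positive_op_iff: "positive_op T \<longleftrightarrow> selfadj T \<and> (\<forall>x. Re (cinner x (T x)) \<ge> 0)"
  by (metis positive_op_def positive_op_selfadj selfadj_def selfadj_form_real Im_complex_of_real)

lemma positive_op_nonneg: "positive_op T \<Longrightarrow> Re (cinner x (T x)) \<ge> 0"
  by (simp add: positive_op_def)

text \<open>Expanding the form at \<open>x + c y\<close> gives a real quadratic in \<open>t\<close>
  that is never negative. Allowing an arbitrary positive \<open>T\<close> is what turns bounds on
  forms into bounds on norms later; \<open>T = id\<close> is the classical inequality.\<close>

lemma positive_form_cs: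
  assumes "positive_op T"
  shows "(cmod (cinner x (T y)))\<^sup>2 \<le> Re (cinner x (T x)) * Re (cinner y (T y))"
proof -
  have sa: "selfadj T" and T: "bounded_clin T"
    using assms positive_op_selfadj selfadj_clin by blast+
  define z where "z = cinner x (T y)"
  have cz: "(cmod z)\<^sup>2 = Re z * Re z + Im z * Im z" by (simp add: cmod_power2 flip: power2_eq_square)
  define p where "p = Re (cinner x (T x))"
  define q where "q = Re (cinner y (T y))"
  have yx: "cinner y (T x) = cnj z"
    using selfadj_swap[OF sa] cinner_commute z_def by metis
  have main: "0 \<le> p - 2 * t * (cmod z)\<^sup>2 + t\<^sup>2 * (cmod z)\<^sup>2 * q" for t :: real
  proof -
    \<comment> \<open>This phase turns both cross terms into \<open>- t |z|^2\<close>.\<close>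
    define c where "c = - (of_real t * cnj z)"
    have "0 \<le> Re (cinner (x + scaleC c y) (T (x + scaleC c y)))"
      using positive_op_nonneg[OF assms] .
    also have "\<dots> = p + Re (c * z) + Re (cnj c * cnj z) + Re (cnj c * c * cinner y (T y))"
      by (simp add: clin_add[OF T] clin_scaleC[OF T] cinner_algebra p_def z_def[symmetric] yx algebra_simps)
    also have "cinner y (T y) = of_real q"
      unfolding q_def by (rule selfadj_form_real[OF sa])
    also have "Re (c * z) = - t * (cmod z)\<^sup>2"
      unfolding cz by (simp add: c_def algebra_simps)
    also have "Re (cnj c * cnj z) = - t * (cmod z)\<^sup>2"
      unfolding cz by (simp add: c_def algebra_simps)
    also have "Re (cnj c * c * of_real q) = t\<^sup>2 * (cmod z)\<^sup>2 * q"
      unfolding cz by (simp add: c_def algebra_simps power2_eq_square)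
    finally show ?thesis by simp
  qed
  have q0: "q \<ge> 0" and p0: "p \<ge> 0"
    using positive_op_nonneg[OF assms] by (auto simp: q_def p_def)
  have "(cmod z)\<^sup>2 \<le> p * q"
  proof (cases "q = 0")
    case True
    have "(cmod z)\<^sup>2 = 0"
    proof (rule ccontr)
      assume ne: "(cmod z)\<^sup>2 \<noteq> 0"
      \<comment> \<open>With \<open>q = 0\<close> the bound is affine in \<open>t\<close>; at this
        \<open>t\<close> it would be -1.\<close>
      have "0 \<le> p - 2 * ((p + 1) / (2 * (cmod z)\<^sup>2)) * (cmod z)\<^sup>2"
        using main[of "(p + 1) / (2 * (cmod z)\<^sup>2)"] True by simp
      also have "\<dots> = - 1" using ne by (simp add: field_simps)
      finally show False by simp
    qed
    then show ?thesis using p0 q0 by simp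
  next
    case False
    then have "q > 0" using q0 by simp
    \<comment> \<open>\<open>1 / q\<close> minimizes the quadratic.\<close>
    then show ?thesis using main[of "1 / q"] by (simp add: field_simps power2_eq_square)
  qed
  then show ?thesis by (simp add: z_def p_def q_def)
qed

lemma positive_op_id: "positive_op (\<lambda>x. x)"
  by (simp add: positive_op_def cinner_self)

lemma cauchy_schwarz: "cmod (cinner x y) \<le> norm x * norm (y::'a::complex_inner)"
proof (rule power2_le_imp_le)
  show "(cmod (cinner x y))\<^sup>2 \<le> (norm x * norm y)\<^sup>2"
    using positive_form_cs[OF positive_op_id, of x y] by (simp add: cinner_self power_mult_distrib)
qed simp

lemma bounded_linear_cinner_right: "bounded_linear (cinner (x::'a::complex_inner))"
proof (rule bounded_linear_intro[where K = "norm x"])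
  show "cinner x (r *\<^sub>R y) = r *\<^sub>R cinner x y" for r y
    by (simp add: scaleR_scaleC cinner_scaleC_right scaleR_conv_of_real)
  show "cmod (cinner x y) \<le> norm y * norm x" for y
    using cauchy_schwarz[of x y] by (simp add: mult.commute)
qed (simp add: cinner_add_right)

lemma bounded_bilinear_cinner: "bounded_bilinear (cinner :: 'a::complex_inner \<Rightarrow> _)"
  by (intro bounded_bilinear.intro exI[of _ 1])
     (auto simp: cinner_algebra scaleR_scaleC scaleR_conv_of_real cauchy_schwarz)

lemmas tendsto_cinner = bounded_bilinear.tendsto[OF bounded_bilinear_cinner]

text \<open>Cauchy--Schwarz for the form of \<open>T\<close>, applied to \<open>x\<close> and \<open>T x\<close>.\<close>
lemma positive_op_norm_sq:
  assumes "positive_op T" and "\<And>x. norm (T x) \<le> c * norm x"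
  shows "(norm (T x))\<^sup>2 \<le> c * Re (cinner x (T x))"
proof (cases "T x = 0")
  case True
  then show ?thesis by simp
next
  case False
  have "((norm (T x))\<^sup>2)\<^sup>2 = (cmod (cinner (T x) (T x)))\<^sup>2"
    by (simp add: cinner_self norm_power)
  also have "\<dots> = (cmod (cinner x (T (T x))))\<^sup>2"
    using selfadj_swap[OF positive_op_selfadj[OF assms(1)]] by simp
  also have "\<dots> \<le> Re (cinner x (T x)) * Re (cinner (T x) (T (T x)))"
    by (rule positive_form_cs[OF assms(1)])
  also have "\<dots> \<le> Re (cinner x (T x)) * (c * (norm (T x))\<^sup>2)"
  proof (rule mult_left_mono)
    have "Re (cinner (T x) (T (T x))) \<le> norm (T x) * norm (T (T x))"
      using cauchy_schwarz complex_Re_le_cmod order_trans by blast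
    also have "\<dots> \<le> norm (T x) * (c * norm (T x))"
      by (intro mult_left_mono assms(2)) simp
    finally show "Re (cinner (T x) (T (T x))) \<le> c * (norm (T x))\<^sup>2"
      by (simp add: power2_eq_square algebra_simps)
  qed (rule positive_op_nonneg[OF assms(1)])
  finally show ?thesis using False by (simp add: power2_eq_square algebra_simps)
qed

lemma positive_op_zero_form:
  assumes "positive_op T" "Re (cinner x (T x)) = 0" shows "T x = 0"
proof -
  have "bounded_clin T" using assms(1) by (simp add: positive_op_def)
  then obtain K where "\<And>x. norm (T x) \<le> K * norm x" using clin_bound by blast
  from positive_op_norm_sq[OF assms(1) this, of x] show ?thesis by (simp add: assms(2))
qed

text \<open>Cauchy--Schwarz for the form at the pair \<open>T x\<close>, \<open>x\<close> bounds
  \<open>||T x||^4\<close> by \<open>c^2 ||T x||^2 ||x||^2\<close>. All operator norm estimates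
  below, including the final uniform one, are obtained from quadratic forms in this way.\<close>

lemma positive_op_norm_le:
  assumes "positive_op T" and "\<And>x. Re (cinner x (T x)) \<le> c * (norm x)\<^sup>2" and c: "0 \<le> c"
  shows "norm (T x) \<le> c * norm x"
proof -
  have "((norm (T x))\<^sup>2)\<^sup>2 = (cmod (cinner (T x) (T x)))\<^sup>2"
    by (simp add: cinner_self norm_power)
  also have "\<dots> \<le> Re (cinner (T x) (T (T x))) * Re (cinner x (T x))"
    by (rule positive_form_cs[OF assms(1)])
  also have "\<dots> \<le> (c * (norm (T x))\<^sup>2) * (c * (norm x)\<^sup>2)"
    by (intro mult_mono assms(2) positive_op_nonneg[OF assms(1)]) (use c in auto)
  finally have "(norm (T x))\<^sup>2 * (norm (T x))\<^sup>2 \<le> (norm (T x))\<^sup>2 * (c * norm x)\<^sup>2"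
    by (simp add: power2_eq_square algebra_simps)
  then have "T x = 0 \<or> (norm (T x))\<^sup>2 \<le> (c * norm x)\<^sup>2"
    using mult_le_cancel_left_pos[of "(norm (T x))\<^sup>2"] by fastforce
  then show ?thesis
    using c by (auto intro: power2_le_imp_le)
qed

section \<open>Orthogonal projections and adjoints\<close>

definition csubspace :: "'a::complex_inner set \<Rightarrow> bool" where
  "csubspace M \<longleftrightarrow> 0 \<in> M \<and> (\<forall>x\<in>M. \<forall>y\<in>M. x + y \<in> M) \<and> (\<forall>c. \<forall>x\<in>M. scaleC c x \<in> M)"

lemma
  assumes "csubspace M"
  shows csubspace_0: "0 \<in> M"
    and csubspace_add: "x \<in> M \<Longrightarrow> y \<in> M \<Longrightarrow> x + y \<in> M"
    and csubspace_scaleC: "x \<in> M \<Longrightarrow> scaleC c x \<in> M"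
    and csubspace_diff: "x \<in> M \<Longrightarrow> y \<in> M \<Longrightarrow> x - y \<in> M"
proof -
  show "0 \<in> M" "x \<in> M \<Longrightarrow> y \<in> M \<Longrightarrow> x + y \<in> M" "x \<in> M \<Longrightarrow> scaleC c x \<in> M" for x y
    using assms by (auto simp: csubspace_def)
  show "x \<in> M \<Longrightarrow> y \<in> M \<Longrightarrow> x - y \<in> M"
    using assms unfolding csubspace_def
    by (metis add_uminus_conv_diff scaleC_minus_left scaleC_one)
qed

lemma projection_exists:
  fixes M :: "'a::chilbert set"
  assumes M: "csubspace M" "closed M"
  shows "\<exists>p\<in>M. \<forall>m\<in>M. cinner m (x - p) = 0"
proof -
  define d where "d = (INF m\<in>M. (norm (x - m))\<^sup>2)"
  have ne: "M \<noteq> {}" using csubspace_0[OF M(1)] by blast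
  have bb: "bdd_below ((\<lambda>m. (norm (x - m))\<^sup>2) ` M)" by (rule bdd_belowI[of _ 0]) auto
  have dle: "d \<le> (norm (x - m))\<^sup>2" if "m \<in> M" for m
    unfolding d_def using bb that by (rule cINF_lower)
  have "\<exists>m\<in>M. (norm (x - m))\<^sup>2 < d + 1 / (real n + 1)" for n
  proof (rule ccontr)
    assume "\<not> ?thesis"
    then have "d + 1 / (real n + 1) \<le> d"
      unfolding d_def using ne by (intro cINF_greatest) (auto simp: not_less d_def)
    then show False by (simp add: field_simps)
  qed
  then obtain y where y: "\<And>n. y n \<in> M" "\<And>n. (norm (x - y n))\<^sup>2 < d + 1 / (real n + 1)"
    by metis
  have ysq: "(norm (y m - y n))\<^sup>2 \<le> 2 / (real m + 1) + 2 / (real n + 1)" for m n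
  proof -
    \<comment> \<open>The midpoint stays in \<open>M\<close>, so its squared distance to
      \<open>x\<close> is at least \<open>d\<close>; the parallelogram law then forces
      almost-minimizers to be close to each other.\<close>
    let ?h = "(1/2) *\<^sub>R (y m + y n)"
    have hM: "?h \<in> M"
      unfolding scaleR_scaleC by (intro csubspace_scaleC csubspace_add M y)
    have "(x - y n) + (x - y m) = 2 *\<^sub>R (x - ?h)"
      by (simp add: algebra_simps scaleR_2)
    then have "(norm ((x - y n) + (x - y m)))\<^sup>2 = 4 * (norm (x - ?h))\<^sup>2"
      by (simp add: power_mult_distrib)
    then have "4 * d \<le> (norm ((x - y n) + (x - y m)))\<^sup>2" using dle[OF hM] by simp
    moreover have "(norm ((x - y n) + (x - y m)))\<^sup>2 + (norm ((x - y n) - (x - y m)))\<^sup>2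
        = 2 * (norm (x - y n))\<^sup>2 + 2 * (norm (x - y m))\<^sup>2"
      by (rule parallelogram)
    ultimately have "4 * d + (norm ((x - y n) - (x - y m)))\<^sup>2 
        \<le> 2 * (norm (x - y n))\<^sup>2 + 2 * (norm (x - y m))\<^sup>2" by linarith
    moreover have "(x - y n) - (x - y m) = y m - y n" by simp
    ultimately have "(norm (y m - y n))\<^sup>2 \<le> 2 * (1 / (real m + 1)) + 2 * (1 / (real n + 1))"
      using y(2)[of m] y(2)[of n] by simp
    then show ?thesis by simp
  qed
  have "Cauchy y"
  proof (rule metric_CauchyI)
    fix e :: real assume e: "e > 0"
    obtain N :: nat where N: "real N > 4 / e\<^sup>2" using reals_Archimedean2 by blast
    have N0: "real N + 1 > 0" by simp
    have "4 / e\<^sup>2 < real N + 1" using N by simp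
    then have N': "4 / (real N + 1) < e\<^sup>2" using e by (simp add: field_simps)
    show "\<exists>N. \<forall>m\<ge>N. \<forall>n\<ge>N. dist (y m) (y n) < e"
    proof (intro exI[of _ N] allI impI)
      fix m n assume "N \<le> m" "N \<le> n"
      then have "2 / (real m + 1) \<le> 2 / (real N + 1)" "2 / (real n + 1) \<le> 2 / (real N + 1)"
        by (auto simp: field_simps)
      then have "(norm (y m - y n))\<^sup>2 < e\<^sup>2" using ysq[of m n] N' by simp
      then show "dist (y m) (y n) < e"
        using e by (simp add: dist_norm power_less_imp_less_base)
    qed
  qed
  then obtain p where p: "y \<longlonglongrightarrow> p" using Cauchy_convergent convergent_def by blast
  have pM: "p \<in> M" using M(2) y(1) p closed_sequentially by blast
  have pd: "(norm (x - p))\<^sup>2 \<le> d"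
  proof (rule LIMSEQ_le)
    show "(\<lambda>n. (norm (x - y n))\<^sup>2) \<longlonglongrightarrow> (norm (x - p))\<^sup>2"
      by (intro tendsto_intros p)
    show "(\<lambda>n. d + 1 / (real n + 1)) \<longlonglongrightarrow> d"
      using LIMSEQ_inverse_real_of_nat_add[of d] by (simp add: inverse_eq_divide add.commute)
    show "\<exists>N. \<forall>n\<ge>N. (norm (x - y n))\<^sup>2 \<le> d + 1 / (real n + 1)"
      using y(2) less_imp_le by blast
  qed
  have "cinner m (x - p) = 0" if m: "m \<in> M" for m
  proof -
    \<comment> \<open>Moving \<open>p\<close> inside \<open>M\<close> along \<open>t c m\<close>
      cannot bring it closer to \<open>x\<close>. At \<open>t = 1 / ||m||^2\<close> this leaves
      \<open>0 \<le> - |c|^2 / ||m||^2\<close>.\<close>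
    define c where "c = cinner m (x - p)"
    have main: "0 \<le> - 2 * t * (cmod c)\<^sup>2 + t\<^sup>2 * (cmod c)\<^sup>2 * (norm m)\<^sup>2" for t :: real
    proof -
      have "p + scaleC (of_real t * c) m \<in> M"
        using M(1) pM m by (intro csubspace_add csubspace_scaleC)
      from dle[OF this] pd have "(norm (x - p))\<^sup>2 \<le> (norm ((x - p) - scaleC (of_real t * c) m))\<^sup>2"
        by (simp only: diff_diff_eq)
      also have "\<dots> = (norm (x - p))\<^sup>2 + t\<^sup>2 * (cmod c)\<^sup>2 * (norm m)\<^sup>2
          - 2 * Re (of_real t * c * cinner (x - p) m)"
        by (simp add: norm_diff_sq norm_scaleC cinner_scaleC_right power_mult_distrib norm_mult)
      also have "cinner (x - p) m = cnj c" unfolding c_def by (rule cinner_commute)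
      also have "Re (of_real t * c * cnj c) = t * (cmod c)\<^sup>2"
        unfolding cmod_power2 by (simp add: power2_eq_square algebra_simps)
      finally show ?thesis by simp
    qed
    show ?thesis
    proof (cases "m = 0")
      case False
      then have "norm m > 0" by simp
      then show ?thesis using main[of "1 / (norm m)\<^sup>2"]
        by (simp add: mult_le_0_iff field_simps power2_eq_square c_def[symmetric])
    qed simp
  qed
  then show ?thesis using pM by blast
qed

definition proj :: "'a::chilbert set \<Rightarrow> 'a \<Rightarrow> 'a" where
  "proj M x = (SOME p. p \<in> M \<and> (\<forall>m\<in>M. cinner m (x - p) = 0))"

lemma
  assumes "csubspace M" "closed M"
  shows proj_in: "proj M x \<in> M" and proj_orth: "m \<in> M \<Longrightarrow> cinner m (x - proj M x) = 0"
  using someI_ex[of "\<lambda>p. p \<in> M \<and> (\<forall>m\<in>M. cinner m (x - p) = 0)"] projection_exists[OF assms, of x]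
  unfolding proj_def by blast+

lemma proj_eqI:
  assumes M: "csubspace M" "closed M" and "p \<in> M" "\<And>m. m \<in> M \<Longrightarrow> cinner m (x - p) = 0"
  shows "proj M x = p"
proof -
  have d: "proj M x - p \<in> M" using assms proj_in csubspace_diff by blast
  have "cinner (proj M x - p) ((x - p) - (x - proj M x)) = 0"
    using assms(4)[OF d] proj_orth[OF M d] by (simp only: cinner_diff_right[of _ "x - p"]) simp
  then show ?thesis by simp
qed

lemma proj_fix: "csubspace M \<Longrightarrow> closed M \<Longrightarrow> x \<in> M \<Longrightarrow> proj M x = x"
  by (rule proj_eqI) auto

lemma proj_clin:
  assumes M: "csubspace M" "closed M" shows "bounded_clin (proj M)"
proof (rule bounded_clinI[where K = 1])
  fix x y :: 'a and c
  show "proj M (x + y) = proj M x + proj M y"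
  proof (rule proj_eqI[OF M])
    fix m assume "m \<in> M"
    then show "cinner m (x + y - (proj M x + proj M y)) = 0"
      using proj_orth[OF M, of m x] proj_orth[OF M, of m y] by (simp add: cinner_algebra)
  qed (intro csubspace_add proj_in M)
  show "proj M (scaleC c x) = scaleC c (proj M x)"
  proof (rule proj_eqI[OF M])
    fix m assume "m \<in> M"
    then show "cinner m (scaleC c x - scaleC c (proj M x)) = 0"
      using proj_orth[OF M, of m x] by (simp add: cinner_algebra)
  qed (intro csubspace_scaleC proj_in M)
  have "(norm (proj M x + (x - proj M x)))\<^sup>2 = (norm (proj M x))\<^sup>2 + (norm (x - proj M x))\<^sup>2"
    using M by (intro pythagoras proj_orth proj_in)
  then have "(norm (proj M x))\<^sup>2 \<le> (norm x)\<^sup>2" by simp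
  then show "norm (proj M x) \<le> 1 * norm x" by (simp add: power2_le_iff_abs_le)
qed

section \<open>Riesz representation and adjoints\<close>

lemma riesz:
  fixes \<phi> :: "'a::chilbert \<Rightarrow> complex"
  assumes "bounded_linear \<phi>" and sc: "\<And>c x. \<phi> (scaleC c x) = c * \<phi> x"
  shows "\<exists>w. \<forall>x. \<phi> x = cinner w x"
proof -
  interpret bounded_linear \<phi> by fact
  define M where "M = {x. \<phi> x = 0}"
  have "csubspace M" unfolding csubspace_def M_def by (auto simp: add zero sc)
  moreover have "closed M"
    unfolding M_def using continuous_closed_preimage_constant[of UNIV \<phi> 0]
    by (simp add: linear_continuous_on[OF assms(1)])
  ultimately have M: "csubspace M" "closed M" .
  show ?thesis
  proof (cases "\<forall>x. \<phi> x = 0")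
    case True
    then show ?thesis by (intro exI[of _ 0]) simp
  next
    case False
    then obtain z where z: "\<phi> z \<noteq> 0" by blast
    define u where "u = z - proj M z"
    have uz: "\<phi> u = \<phi> z" using proj_in[OF M, of z] by (simp add: u_def diff M_def)
    then have u0: "u \<noteq> 0" using z zero by auto
    have uM: "cinner u m = 0" if "m \<in> M" for m
      using proj_orth[OF M that, of z] cinner_commute_zero unfolding u_def by blast
    show ?thesis
    \<comment> \<open>Every \<open>x\<close> is a multiple of \<open>u\<close> up to a vector of the
      kernel, to which \<open>u\<close> is orthogonal; pairing with \<open>u\<close> fixes the
      factor.\<close>
    proof (intro exI[of _ "scaleC (cnj (\<phi> u) / cinner u u) u"] allI)
      fix x
      have "x - scaleC (\<phi> x / \<phi> u) u \<in> M"
        using z uz by (simp add: M_def diff sc)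
      from uM[OF this] have "cinner u x = \<phi> x / \<phi> u * cinner u u"
        by (simp add: cinner_algebra)
      then have "cinner u x * \<phi> u = \<phi> x * cinner u u"
        using z uz by (simp add: field_simps)
      moreover have "cnj (cinner u u) = cinner u u" by (metis cinner_commute)
      ultimately show "\<phi> x = cinner (scaleC (cnj (\<phi> u) / cinner u u) u) x"
        using u0 by (simp add: cinner_scaleC_left field_simps)
    qed
  qed
qed

lemma cinner_adj:
  fixes T :: "'a::chilbert \<Rightarrow> 'a"
  assumes T: "bounded_clin T"
  shows "cinner (T x) y = cinner x (adj T y)"
proof -
  have "\<exists>w. \<forall>x. cinner y (T x) = cinner w x" for y
  proof (rule riesz)
    show "bounded_linear (\<lambda>x. cinner y (T x))"
      using bounded_linear_compose[OF bounded_linear_cinner_right bounded_clin_bl[OF T]] .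
  qed (simp add: clin_scaleC[OF T] cinner_scaleC_right)
  then obtain S where "\<And>x y. cinner y (T x) = cinner (S y) x" by metis
  then have "\<forall>x y. cinner (T x) y = cinner x (S y)" by (metis cinner_commute)
  then have "\<forall>x y. cinner (T x) y = cinner x (adj T y)"
    unfolding adj_def by (rule someI[of "\<lambda>S. \<forall>x y. cinner (T x) y = cinner x (S y)"])
  then show ?thesis by blast
qed

lemma cinner_adj':
  "bounded_clin T \<Longrightarrow> cinner (adj T x) y = cinner (x::'a::chilbert) (T y)"
  by (metis cinner_adj cinner_commute)

text \<open>Exhibiting \<open>S\<close> shows that the choice behind \<open>adj\<close> is not
  vacuous, and nondegeneracy of the inner product leaves no other candidate.\<close>

lemma adj_eqI:
  assumes "\<And>x y. cinner (T x) y = cinner x (S y)"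
  shows "adj T = (S :: 'a::complex_inner \<Rightarrow> 'a)"
proof -
  have "\<forall>x y. cinner (T x) y = cinner x (adj T y)"
    unfolding adj_def
    by (rule someI[of "\<lambda>S. \<forall>x y. cinner (T x) y = cinner x (S y)" S]) (use assms in blast)
  then show ?thesis using assms by (metis ext eq_by_cinner)
qed

lemma norm_adj_le:
  fixes T :: "'a::chilbert \<Rightarrow> 'a"
  assumes T: "bounded_clin T" and K: "\<And>x. norm (T x) \<le> K * norm x"
  shows "norm (adj T x) \<le> K * norm x"
proof (cases "adj T x = 0")
  case True
  have "0 \<le> K * norm x" using K[of x] norm_ge_zero order_trans by blast
  then show ?thesis using True by simp
next
  case False
  have "(norm (adj T x))\<^sup>2 = Re (cinner (T (adj T x)) x)"
    by (simp add: cinner_adj[OF T] cinner_self)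
  also have "\<dots> \<le> norm (T (adj T x)) * norm x"
    using cauchy_schwarz complex_Re_le_cmod order_trans by blast
  also have "\<dots> \<le> (K * norm (adj T x)) * norm x"
    by (intro mult_right_mono K) simp
  finally show ?thesis using False by (simp add: power2_eq_square)
qed

lemma adj_clin:
  fixes T :: "'a::chilbert \<Rightarrow> 'a"
  assumes T: "bounded_clin T" shows "bounded_clin (adj T)"
proof -
  obtain K where K: "\<And>x. norm (T x) \<le> K * norm x" using clin_bound[OF T] by blast
  show ?thesis
  proof (rule bounded_clinI[where K = K])
    show "adj T (x + y) = adj T x + adj T y" for x y
      by (rule eq_by_cinner) (simp add: cinner_adj[OF T, symmetric] cinner_add_right)
    show "adj T (scaleC c x) = scaleC c (adj T x)" for c x
      by (rule eq_by_cinner) (simp add: cinner_adj[OF T, symmetric] cinner_scaleC_right)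
  qed (rule norm_adj_le[OF T K])
qed

lemma selfadj_adj: "selfadj T \<Longrightarrow> adj T = T"
  by (rule adj_eqI) (simp add: selfadj_swap)

lemma adj_pow:
  fixes T :: "'a::chilbert \<Rightarrow> 'a"
  assumes T: "bounded_clin T"
  shows "cinner ((T ^^ n) x) y = cinner x ((adj T ^^ n) y)"
proof (induction n arbitrary: x y)
  case (Suc n)
  have "cinner ((T ^^ Suc n) x) y = cinner ((T ^^ n) x) (adj T y)" by (simp add: cinner_adj[OF T])
  also have "\<dots> = cinner x ((adj T ^^ Suc n) y)" by (simp add: Suc funpow_swap1)
  finally show ?case .
qed simp

section \<open>Orthogonal projections as operators\<close>

lemma orth_proj_selfadj: "orth_proj (P :: 'a::chilbert \<Rightarrow> 'a) \<Longrightarrow> selfadj P"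
  unfolding orth_proj_def selfadj_def by (metis cinner_adj)

lemma orth_projI: "selfadj P \<Longrightarrow> (\<And>x. P (P x) = P x) \<Longrightarrow> orth_proj P"
  unfolding orth_proj_def by (auto simp: selfadj_clin selfadj_adj)

lemma orth_proj_clin: "orth_proj P \<Longrightarrow> bounded_clin P"
  by (simp add: orth_proj_def)

lemma orth_proj_idem: "orth_proj P \<Longrightarrow> P (P x) = P x"
  unfolding orth_proj_def by (metis comp_apply)

lemma orth_proj_range: "orth_proj P \<Longrightarrow> x \<in> range P \<longleftrightarrow> P x = x"
  using orth_proj_idem by (metis image_iff UNIV_I)

context
  fixes P :: "'a::chilbert \<Rightarrow> 'a" assumes P: "orth_proj P"
begin

lemma orth_proj_swap: "cinner (P x) y = cinner x (P y)"
  using orth_proj_selfadj[OF P] by (rule selfadj_swap)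

lemma orth_proj_orth: "cinner (P x) (x - P x) = 0"
  by (simp add: orth_proj_swap clin_diff[OF orth_proj_clin[OF P]] orth_proj_idem[OF P])

lemma orth_proj_pyth: "(norm x)\<^sup>2 = (norm (P x))\<^sup>2 + (norm (x - P x))\<^sup>2"
  using pythagoras[OF orth_proj_orth, of x] by simp

lemma orth_proj_form: "cinner x (P x) = of_real ((norm (P x))\<^sup>2)"
  by (metis cinner_self orth_proj_idem[OF P] orth_proj_swap)

lemma orth_proj_norm: "norm (P x) \<le> norm x"
  using orth_proj_pyth[of x] by (simp add: power2_le_imp_le)

lemma orth_proj_compl: "orth_proj (\<lambda>x. x - P x)"
proof (rule orth_projI)
  show "selfadj (\<lambda>x. x - P x)"
    unfolding selfadj_def
    by (auto intro!: bounded_clin_diff simp: orth_proj_clin[OF P] cinner_algebra orth_proj_swap)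
qed (simp add: clin_diff[OF orth_proj_clin[OF P]] orth_proj_idem[OF P])

lemma orth_proj_range_closed: "csubspace (range P)" "closed (range P)"
proof -
  note c = orth_proj_clin[OF P]
  have r: "range P = {x. P x = x}" using orth_proj_range[OF P] by blast
  show "csubspace (range P)"
    unfolding r csubspace_def by (auto simp: clin_add[OF c] clin_zero[OF c] clin_scaleC[OF c])
  show "closed (range P)"
    unfolding r by (intro closed_Collect_eq clin_cont c continuous_on_id)
qed

end

lemma proj_orth_proj:
  assumes M: "csubspace M" "closed M" shows "orth_proj (proj M)" "range (proj M) = M"
proof -
  have "cinner (proj M x) y = cinner x (proj M y)" for x y
  proof -
    have "cinner (proj M x) y = cinner (proj M x) (proj M y)"
      using proj_orth[OF M proj_in[OF M], of x y] by (simp add: cinner_diff_right)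
    also have "\<dots> = cinner x (proj M y)"
      using proj_orth[OF M proj_in[OF M], of y x] cinner_commute_zero[of "proj M y" "x - proj M x"]
      by (simp add: cinner_diff_left)
    finally show ?thesis .
  qed
  then show "orth_proj (proj M)"
    using proj_clin[OF M] proj_fix[OF M proj_in[OF M]] by (intro orth_projI) (auto simp: selfadj_def)
  show "range (proj M) = M"
    using proj_in[OF M] proj_fix[OF M] by (metis image_subsetI rangeI subsetI subset_antisym)
qed

section \<open>Monotone limits and square roots\<close>

text \<open>The forms are bounded monotone real sequences, hence Cauchy. Since
  \<open>D n - D m\<close> is positive and uniformly bounded, \<open>||D n x - D m x||^2\<close> is
  at most a constant times the increment of the form at \<open>x\<close>.\<close>

lemma monotone_operator_convergent:
  fixes D :: "nat \<Rightarrow> 'a::chilbert \<Rightarrow> 'a"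
  assumes mono: "\<And>m n. m \<le> n \<Longrightarrow> positive_op (\<lambda>x. D n x - D m x)"
    and bound: "\<And>n x. norm (D n x) \<le> c * norm x"
  shows "convergent (\<lambda>n. D n x)"
proof -
  define f where "f n = Re (cinner x (D n x))" for n
  have c0: "0 \<le> c * norm x" using bound[of 0 x] norm_ge_zero order_trans by blast
  have fle: "f m \<le> f n" if "m \<le> n" for m n
    using positive_op_nonneg[OF mono[OF that], of x] by (simp add: f_def cinner_diff_right)
  have fb: "f n \<le> norm x * (c * norm x)" for n
  proof -
    have "f n \<le> norm x * norm (D n x)"
      unfolding f_def using cauchy_schwarz complex_Re_le_cmod order_trans by blast
    also have "\<dots> \<le> norm x * (c * norm x)" by (intro mult_left_mono bound) simp
    finally show ?thesis .
  qed
  have "convergent f"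
  proof (intro Bseq_mono_convergent BseqI'[where K = "\<bar>f 0\<bar> + norm x * (c * norm x)"])
    show "norm (f n) \<le> \<bar>f 0\<bar> + norm x * (c * norm x)" for n
      using fle[of 0 n] fb[of n] mult_nonneg_nonneg[OF norm_ge_zero[of x] c0] by (simp add: abs_if)
  qed (use fle in auto)
  then have "Cauchy f" by (rule convergent_Cauchy)
  \<comment> \<open>A bound for the norm of every difference; the summand 1 only makes it safe to
    divide by.\<close>
  define C where "C = 2 * \<bar>c\<bar> + 1"
  have C: "C > 0" by (simp add: C_def)
  have sq: "(norm (D n x - D m x))\<^sup>2 \<le> C * (f n - f m)" if "m \<le> n" for m n
  proof -
    have "norm (D n y - D m y) \<le> C * norm y" for y
    proof -
      have "norm (D n y - D m y) \<le> c * norm y + c * norm y"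
        using norm_triangle_ineq4 bound by (meson add_mono order_trans)
      also have "\<dots> \<le> (2 * \<bar>c\<bar> + 1) * norm y"
        by (simp add: algebra_simps) (smt (verit) mult_right_mono norm_ge_zero abs_ge_self)
      finally show ?thesis by (simp add: C_def)
    qed
    from positive_op_norm_sq[OF mono[OF that] this, of x] show ?thesis
      by (simp add: f_def cinner_diff_right)
  qed
  have "Cauchy (\<lambda>n. D n x)"
  proof (rule metric_CauchyI)
    fix e :: real assume e: "e > 0"
    then have "e\<^sup>2 / C > 0" using C by simp
    from metric_CauchyD[OF \<open>Cauchy f\<close> this]
    obtain N where N: "\<And>m n. m \<ge> N \<Longrightarrow> n \<ge> N \<Longrightarrow> \<bar>f m - f n\<bar> < e\<^sup>2 / C"
      by (auto simp: dist_real_def)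
    have *: "norm (D n x - D m x) < e" if "N \<le> m" "m \<le> n" for m n
    proof -
      have "C * (f n - f m) < e\<^sup>2"
        using N[of n m] that C pos_less_divide_eq[OF C, of "f n - f m" "e\<^sup>2"]
        by (simp add: mult.commute abs_less_iff)
      then have "(norm (D n x - D m x))\<^sup>2 < e\<^sup>2" using sq[OF that(2)] by simp
      then show ?thesis using e by (simp add: power_less_imp_less_base)
    qed
    show "\<exists>N. \<forall>m\<ge>N. \<forall>n\<ge>N. dist (D m x) (D n x) < e"
      by (rule exI[of _ N]) (metis * dist_commute dist_norm le_cases)
  qed
  then show ?thesis by (rule Cauchy_convergent)
qed

lemma strong_limit_clin:
  fixes D :: "nat \<Rightarrow> 'a::complex_inner \<Rightarrow> 'a"
  assumes D: "\<And>n. bounded_clin (D n)" and bound: "\<And>n x. norm (D n x) \<le> c * norm x"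
    and lim: "\<And>x. (\<lambda>n. D n x) \<longlonglongrightarrow> L x"
  shows "bounded_clin L" "norm (L x) \<le> c * norm x"
proof -
  have nb: "norm (L x) \<le> c * norm x" for x
    using tendsto_norm[OF lim[of x]] bound by (intro LIMSEQ_le_const2) auto
  then show "norm (L x) \<le> c * norm x" .
  show "bounded_clin L"
  proof (rule bounded_clinI[where K = c])
    fix x y :: 'a and a
    have "(\<lambda>n. D n (x + y)) \<longlonglongrightarrow> L x + L y"
      using tendsto_add[OF lim[of x] lim[of y]] by (simp add: clin_add[OF D])
    then show "L (x + y) = L x + L y" using lim LIMSEQ_unique by blast
    have "(\<lambda>n. D n (scaleC a x)) \<longlonglongrightarrow> scaleC a (L x)"
      using clin_tendsto[OF bounded_clin_scaleC[OF bounded_clin_id(1)] lim[of x]]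
      by (simp add: clin_scaleC[OF D])
    then show "L (scaleC a x) = scaleC a (L x)" using lim LIMSEQ_unique by blast
  qed (rule nb)
qed

lemma strong_limit_selfadj:
  fixes D :: "nat \<Rightarrow> 'a::complex_inner \<Rightarrow> 'a"
  assumes D: "\<And>n. selfadj (D n)" and bound: "\<And>n x. norm (D n x) \<le> c * norm x"
    and lim: "\<And>x. (\<lambda>n. D n x) \<longlonglongrightarrow> L x"
  shows "selfadj L"
proof -
  have "cinner (L x) y = cinner x (L y)" for x y
  proof (rule LIMSEQ_unique)
    show "(\<lambda>n. cinner (D n x) y) \<longlonglongrightarrow> cinner (L x) y" by (intro tendsto_cinner lim tendsto_const)
    show "(\<lambda>n. cinner (D n x) y) \<longlonglongrightarrow> cinner x (L y)"
      unfolding selfadj_swap[OF D] by (intro tendsto_cinner lim tendsto_const)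
  qed
  then show ?thesis
    using strong_limit_clin(1)[OF selfadj_clin[OF D] bound lim] by (simp add: selfadj_def)
qed

text \<open>Polynomials in \<open>X\<close> with nonnegative coefficients, in Horner form.\<close>
inductive npoly :: "('a::complex_inner \<Rightarrow> 'a) \<Rightarrow> ('a \<Rightarrow> 'a) \<Rightarrow> bool" for X where
  npoly_zero: "npoly X (\<lambda>x. 0)"
| npoly_step: "npoly X T \<Longrightarrow> 0 \<le> a \<Longrightarrow> npoly X (\<lambda>x. a *\<^sub>R x + X (T x))"

lemma npoly_add:
  assumes X: "bounded_clin X"
  shows "npoly X S \<Longrightarrow> npoly X T \<Longrightarrow> npoly X (\<lambda>x. S x + T x)"
proof (induction arbitrary: T rule: npoly.induct)
  case npoly_zero
  then show ?case by simp
next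
  case (npoly_step S a)
  from npoly_step.prems show ?case
  proof cases
    case npoly_zero
    then show ?thesis using npoly.npoly_step[OF npoly_step.hyps] by simp
  next
    case (npoly_step T' b)
    have "npoly X (\<lambda>x. (a + b) *\<^sub>R x + X (S x + T' x))"
      using npoly_step \<open>0 \<le> a\<close> by (intro npoly.npoly_step npoly_step.IH) auto
    moreover have "(\<lambda>x. (a + b) *\<^sub>R x + X (S x + T' x)) = (\<lambda>x. (a *\<^sub>R x + X (S x)) + T x)"
      using npoly_step by (auto simp: clin_add[OF X] algebra_simps)
    ultimately show ?thesis by simp
  qed
qed

lemma npoly_scale:
  assumes X: "bounded_clin X"
  shows "npoly X S \<Longrightarrow> 0 \<le> c \<Longrightarrow> npoly X (\<lambda>x. c *\<^sub>R S x)"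
proof (induction rule: npoly.induct)
  case npoly_zero
  then show ?case by (simp add: npoly.npoly_zero)
next
  case (npoly_step S a)
  then have "npoly X (\<lambda>x. (c * a) *\<^sub>R x + X (c *\<^sub>R S x))" by (intro npoly.npoly_step) auto
  then show ?case by (simp add: scaleR_scaleC clin_scaleC[OF X] scaleC_add_right scaleC_scaleC)
qed

lemma npoly_comp:
  assumes X: "bounded_clin X"
  shows "npoly X S \<Longrightarrow> npoly X T \<Longrightarrow> npoly X (\<lambda>x. S (T x))"
proof (induction rule: npoly.induct)
  case npoly_zero
  then show ?case by (simp add: npoly.npoly_zero)
next
  case (npoly_step S a)
  have "npoly X (\<lambda>x. 0 *\<^sub>R x + X (S (T x)))"
    using npoly_step by (intro npoly.npoly_step) auto
  then show ?case
    using npoly_step by (intro npoly_add[OF X] npoly_scale[OF X]) auto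
qed

lemma npoly_id: "bounded_clin X \<Longrightarrow> npoly X (\<lambda>x. x)"
  using npoly_step[OF npoly_zero, of 1 X] by (simp add: clin_zero)

lemma npoly_X: "bounded_clin X \<Longrightarrow> npoly X X"
  using npoly_step[OF npoly_id, of X 0] by simp

lemma npoly_clin: "npoly X T \<Longrightarrow> bounded_clin X \<Longrightarrow> bounded_clin T"
  by (induction rule: npoly.induct)
     (auto intro!: bounded_clin_add bounded_clin_scaleR bounded_clin_comp[of X])

lemma npoly_commute:
  assumes "npoly X T" "bounded_clin Z" "\<And>x. Z (X x) = X (Z x)"
  shows "Z (T x) = T (Z x)"
  using assms(1)
  by (induction arbitrary: x rule: npoly.induct)
     (auto simp: clin_zero[OF assms(2)] clin_add[OF assms(2)] scaleR_scaleC
       clin_scaleC[OF assms(2)] assms(3))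

lemma npoly_commute2:
  assumes "npoly X S" "npoly X T" "bounded_clin X" shows "S (T x) = T (S x)"
proof (rule npoly_commute[OF assms(2) npoly_clin[OF assms(1,3)]])
  show "S (X x) = X (S x)" for x
    using npoly_commute[OF assms(1,3)] by metis
qed

text \<open>Induction on \<open>T\<close> alone does not close because each Horner step multiplies
  by \<open>X\<close>. Carrying the positivity of \<open>X T\<close> along does:
  \<open>X (X T)\<close> is \<open>T\<close> conjugated by the self-adjoint
  \<open>X\<close>.\<close>

lemma npoly_positive:
  assumes "npoly X T" and X: "positive_op X"
  shows "positive_op T"
proof -
  note saX = positive_op_selfadj[OF X]
  note cX = selfadj_clin[OF saX]
  have sa: "selfadj T"
    using assms(1)
  proof (induction rule: npoly.induct)
    case npoly_zero
    then show ?case by (simp add: selfadj_def)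
  next
    case (npoly_step T a)
    have "X (T x) = T (X x)" for x
      by (rule npoly_commute[OF npoly_step(1) cX]) simp
    then show ?case
      using npoly_clin[OF npoly.npoly_step[OF npoly_step(1,2)] cX] npoly_step(3)
      unfolding selfadj_def
      by (auto simp: cinner_algebra scaleR_scaleC selfadj_swap[OF saX])
  qed
  have "Re (cinner x (T x)) \<ge> 0 \<and> Re (cinner x (X (T x))) \<ge> 0" for x
    using assms(1)
  proof (induction arbitrary: x rule: npoly.induct)
    case npoly_zero
    then show ?case by (simp add: clin_zero[OF cX])
  next
    case (npoly_step T a)
    have "X (T y) = T (X y)" for y
      by (rule npoly_commute[OF npoly_step(1) cX]) simp
    then have "cinner x (X (X (T x))) = cinner (X x) (T (X x))"
      by (simp add: selfadj_swap[OF saX])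
    then show ?case
      using npoly_step.IH[of x] npoly_step.IH[of "X x"] npoly_step.hyps(2)
        positive_op_nonneg[OF X, of x]
      by (simp add: clin_add[OF cX] clin_scaleC[OF cX] scaleR_scaleC cinner_algebra cinner_self)
  qed
  then show ?thesis using sa by (simp add: positive_op_iff)
qed

text \<open>The iteration \<open>Y \<mapsto> (X + Y\<^sup>2) / 2\<close> with \<open>X = 1 - A\<close> increases to a fixed point \<open>Y\<close>,
  for which \<open>(1 - Y)\<^sup>2 = 1 - X = A\<close>.\<close>
primrec sqrt_iter :: "('a::complex_inner \<Rightarrow> 'a) \<Rightarrow> nat \<Rightarrow> 'a \<Rightarrow> 'a" where
  "sqrt_iter X 0 = (\<lambda>x. 0)"
| "sqrt_iter X (Suc n) = (\<lambda>x. (1/2) *\<^sub>R (X x + sqrt_iter X n (sqrt_iter X n x)))"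

lemma npoly_sqrt_iter: "bounded_clin X \<Longrightarrow> npoly X (sqrt_iter X n)"
proof (induction n)
  case (Suc n)
  show ?case
    using npoly_scale[OF Suc.prems npoly_add[OF Suc.prems npoly_X[OF Suc.prems]
          npoly_comp[OF Suc.prems Suc.IH Suc.IH]], of "1/2"] Suc.prems by simp
qed (simp add: npoly_zero)

text \<open>As polynomials in \<open>X\<close> commute, each increment of the iteration is half the
  product of the previous increment and the sum of the two previous iterates. Nonnegative
  coefficients therefore persist, which is why the iteration increases.\<close>

lemma npoly_sqrt_iter_diff:
  assumes X: "bounded_clin X"
  shows "npoly X (\<lambda>x. sqrt_iter X (Suc n) x - sqrt_iter X n x)"
proof (induction n)
  case 0
  show ?case using npoly_scale[OF X npoly_X[OF X], of "1/2"] by simp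
next
  case (Suc n)
  let ?Y = "sqrt_iter X n" and ?Z = "sqrt_iter X (Suc n)"
  have "npoly X (\<lambda>x. (1/2) *\<^sub>R ((\<lambda>x. ?Z x - ?Y x) ((\<lambda>x. ?Z x + ?Y x) x)))"
    by (intro npoly_scale[OF X] npoly_comp[OF X Suc] npoly_add[OF X] npoly_sqrt_iter[OF X]) simp
  moreover have "(1/2) *\<^sub>R (?Z (?Z x + ?Y x) - ?Y (?Z x + ?Y x))
      = sqrt_iter X (Suc (Suc n)) x - ?Z x" for x
  proof -
    have "?Z (?Y x) = ?Y (?Z x)"
      by (rule npoly_commute2[OF npoly_sqrt_iter npoly_sqrt_iter]) (rule X)+
    then have "?Z (?Z x + ?Y x) - ?Y (?Z x + ?Y x) = ?Z (?Z x) - ?Y (?Y x)"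
      using npoly_clin[OF npoly_sqrt_iter[OF X] X] by (simp add: clin_add del: sqrt_iter.simps)
    moreover have "sqrt_iter X (Suc (Suc n)) x - ?Z x
        = (1/2) *\<^sub>R (X x + ?Z (?Z x)) - (1/2) *\<^sub>R (X x + ?Y (?Y x))" by simp
    ultimately show ?thesis by (simp only: scaleR_diff_right[symmetric] add_diff_cancel_left)
  qed
  ultimately show ?case by simp
qed

text \<open>The commutation clause stands in for a functional calculus: the root is a strong limit
  of polynomials in \<open>1 - A\<close>, so it commutes with whatever commutes with
  \<open>A\<close>. The spectral projections get their commutation from here.\<close>

lemma positive_op_sqrt:
  fixes A :: "'a::chilbert \<Rightarrow> 'a"
  assumes A: "positive_op A" "contraction A"
  shows "\<exists>S. positive_op S \<and> (\<forall>x. S (S x) = A x) \<and>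
     (\<forall>Z. bounded_clin Z \<longrightarrow> (\<forall>x. Z (A x) = A (Z x)) \<longrightarrow> (\<forall>x. Z (S x) = S (Z x)))"
proof -
  define X where "X x = x - A x" for x
  have cA: "bounded_clin A" and nA: "\<And>x. norm (A x) \<le> norm x"
    using A(2) by (auto simp: contraction_iff)
  have cX: "bounded_clin X" unfolding X_def[abs_def] by (intro bounded_clin_diff cA) simp
  have Xform: "Re (cinner x (X x)) = (norm x)\<^sup>2 - Re (cinner x (A x))" for x
    by (simp add: X_def cinner_diff_right cinner_self)
  have "Re (cinner x (A x)) \<le> (norm x)\<^sup>2" for x
    using cauchy_schwarz[of x "A x"] nA[of x] complex_Re_le_cmod[of "cinner x (A x)"]
      mult_left_mono[OF nA[of x], of "norm x"] by (simp add: power2_eq_square)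
  then have X: "positive_op X"
    using cX positive_op_selfadj[OF A(1)] unfolding positive_op_iff Xform
    by (auto simp: selfadj_def X_def cinner_algebra)
  have nX: "norm (X x) \<le> norm x" for x
    using positive_op_norm_le[OF X, of 1] Xform positive_op_nonneg[OF A(1)] by simp
  let ?Y = "sqrt_iter X"
  have nY: "norm (?Y n x) \<le> 1 * norm x" for n x
  proof (induction n arbitrary: x)
    case (Suc n)
    have "norm (X x + ?Y n (?Y n x)) \<le> norm x + norm x"
      using Suc[of "?Y n x"] Suc[of x] nX[of x] norm_triangle_ineq[of "X x" "?Y n (?Y n x)"] by simp
    then show ?case by simp
  qed simp
  have cY: "bounded_clin (?Y n)" for n using npoly_clin[OF npoly_sqrt_iter] cX by blast
  have mono: "positive_op (\<lambda>x. ?Y n x - ?Y m x)" if "m \<le> n" for m n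
  proof (rule npoly_positive[OF _ X])
    show "npoly X (\<lambda>x. ?Y n x - ?Y m x)"
      using that
    proof (induction rule: dec_induct)
      case base
      then show ?case by (simp add: npoly_zero)
    next
      case (step n)
      have "npoly X (\<lambda>x. (?Y (Suc n) x - ?Y n x) + (?Y n x - ?Y m x))"
        by (rule npoly_add[OF cX npoly_sqrt_iter_diff[OF cX] step.IH])
      then show ?case by (simp del: sqrt_iter.simps)
    qed
  qed
  define Y where "Y x = lim (\<lambda>n. ?Y n x)" for x
  have Y: "(\<lambda>n. ?Y n x) \<longlonglongrightarrow> Y x" for x
    unfolding Y_def using monotone_operator_convergent[OF mono nY] by (simp add: convergent_LIMSEQ_iff)
  have cYl: "bounded_clin Y" and nYl: "norm (Y x) \<le> 1 * norm x" for x
    using strong_limit_clin[OF cY nY Y] by blast+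
  have saY: "selfadj Y"
    using positive_op_selfadj[OF npoly_positive[OF npoly_sqrt_iter[OF cX] X]] nY Y
    by (rule strong_limit_selfadj)
  have fix_pt: "Y x = (1/2) *\<^sub>R (X x + Y (Y x))" for x
  proof (rule LIMSEQ_unique)
    show "(\<lambda>n. ?Y (Suc n) x) \<longlonglongrightarrow> Y x" using Y by (rule LIMSEQ_Suc)
    \<comment> \<open>The iterates are contractions, so replacing the inner one by its limit costs
      no more than its distance from that limit.\<close>
    have "(\<lambda>n. ?Y n (?Y n x) - ?Y n (Y x)) \<longlonglongrightarrow> 0"
    proof (rule Lim_null_comparison)
      show "\<forall>\<^sub>F n in sequentially. norm (?Y n (?Y n x) - ?Y n (Y x)) \<le> norm (?Y n x - Y x)"
        using nY by (auto simp: clin_diff[OF cY, symmetric])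
      show "(\<lambda>n. norm (?Y n x - Y x)) \<longlonglongrightarrow> 0"
        using Y[of x] by (simp add: LIM_zero_iff tendsto_norm_zero_iff)
    qed
    from tendsto_add[OF this Y[of "Y x"]] have "(\<lambda>n. ?Y n (?Y n x)) \<longlonglongrightarrow> Y (Y x)" by simp
    then show "(\<lambda>n. ?Y (Suc n) x) \<longlonglongrightarrow> (1/2) *\<^sub>R (X x + Y (Y x))"
      by (auto intro!: tendsto_intros)
  qed
  define S where "S x = x - Y x" for x
  have "S (S x) = A x" for x
  proof -
    have "Y x + Y x = X x + Y (Y x)" using fix_pt[of x] by (metis scaleR_half_double scaleR_right.add)
    then have "x - Y x - (Y x - Y (Y x)) = x - X x" by (simp add: algebra_simps)
    then show ?thesis by (simp add: S_def clin_diff[OF cYl] X_def)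
  qed
  moreover have "positive_op S"
  proof -
    have "selfadj S"
      unfolding selfadj_def S_def[abs_def]
      by (auto intro!: bounded_clin_diff cYl simp: cinner_algebra selfadj_swap[OF saY])
    moreover have "Re (cinner x (Y x)) \<le> (norm x)\<^sup>2" for x
      using cauchy_schwarz[of x "Y x"] nYl[of x] complex_Re_le_cmod[of "cinner x (Y x)"]
        mult_left_mono[OF nYl[of x], of "norm x"] by (simp add: power2_eq_square)
    ultimately show ?thesis
      by (auto simp: positive_op_iff S_def cinner_algebra cinner_self)
  qed
  moreover have "Z (S x) = S (Z x)" if Z: "bounded_clin Z" "\<forall>x. Z (A x) = A (Z x)" for Z x
  proof -
    have ZX: "Z (X x) = X (Z x)" for x using Z by (simp add: X_def clin_diff)
    have "Z (Y x) = Y (Z x)"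
    proof (rule LIMSEQ_unique)
      show "(\<lambda>n. Z (?Y n x)) \<longlonglongrightarrow> Z (Y x)" by (rule clin_tendsto[OF Z(1) Y])
      show "(\<lambda>n. Z (?Y n x)) \<longlonglongrightarrow> Y (Z x)"
        using Y[of "Z x"] npoly_commute[OF npoly_sqrt_iter[OF cX] Z(1) ZX] by simp
    qed
    then show ?thesis by (simp add: S_def clin_diff[OF Z(1)])
  qed
  ultimately show ?thesis by blast
qed

section \<open>The spectral family\<close>

text \<open>A self-adjoint operator that leaves \<open>M\<close> invariant also leaves its
  complement invariant.\<close>

lemma proj_commute_selfadj:
  assumes M: "csubspace M" "closed (M::'a::chilbert set)" and Z: "selfadj Z"
    and inv: "\<And>x. x \<in> M \<Longrightarrow> Z x \<in> M"
  shows "Z (proj M x) = proj M (Z x)"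
proof (rule sym, rule proj_eqI[OF M])
  fix m assume "m \<in> M"
  have "cinner m (Z x - Z (proj M x)) = cinner (Z m) (x - proj M x)"
    by (simp add: selfadj_swap[OF Z] clin_diff[OF selfadj_clin[OF Z]])
  then show "cinner m (Z x - Z (proj M x)) = 0"
    using proj_orth[OF M inv[OF \<open>m \<in> M\<close>]] by simp
qed (intro inv proj_in M)

text \<open>\<open>P x - Q (P x)\<close> lies in the range of \<open>P\<close> and in the kernel of
  \<open>Q\<close>. This turns incompatible bounds on the form of \<open>A\<close> into an inclusion
  of spectral subspaces.\<close>

lemma orth_proj_absorb:
  assumes P: "orth_proj P" and Q: "orth_proj Q" and com: "\<And>x. P (Q x) = Q (P x)"
    and disj: "\<And>x. P x = x \<Longrightarrow> Q x = 0 \<Longrightarrow> x = 0"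
  shows "Q (P x) = P x"
proof -
  note cP = orth_proj_clin[OF P] and cQ = orth_proj_clin[OF Q]
  have "P (P x - Q (P x)) = P x - Q (P x)"
    by (simp add: clin_diff[OF cP] com orth_proj_idem[OF P])
  moreover have "Q (P x - Q (P x)) = 0"
    by (simp add: clin_diff[OF cQ] orth_proj_idem[OF Q])
  ultimately show ?thesis using disj[of "P x - Q (P x)"] by simp
qed

text \<open>\<open>Q\<close> is the projection onto the kernel of the positive part of \<open>A - l\<close>.\<close>
lemma spectral_projection_exists:
  fixes A :: "'a::chilbert \<Rightarrow> 'a"
  assumes A: "selfadj A"
  shows "\<exists>Q. orth_proj Q \<and>
    (\<forall>Z. selfadj Z \<longrightarrow> (\<forall>x. Z (A x) = A (Z x)) \<longrightarrow> (\<forall>x. Z (Q x) = Q (Z x))) \<and>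
    (\<forall>x. Q x = x \<longrightarrow> Re (cinner x (A x)) \<le> l * (norm x)\<^sup>2) \<and>
    (\<forall>x. Q x = 0 \<longrightarrow> x \<noteq> 0 \<longrightarrow> l * (norm x)\<^sup>2 < Re (cinner x (A x)))"
proof -
  note cA = selfadj_clin[OF A]
  have "bounded_clin (\<lambda>x. A x - l *\<^sub>R x)"
    by (intro bounded_clin_diff bounded_clin_scaleR cA) simp
  then obtain K where K: "K > 0" "\<And>x. norm (A x - l *\<^sub>R x) \<le> K * norm x"
    using clin_bound by blast
  \<comment> \<open>Scaling makes \<open>B\<close> a contraction, so that \<open>B^2\<close> has a
    square root.\<close>
  define B where "B x = (1 / K) *\<^sub>R (A x - l *\<^sub>R x)" for x
  have cB: "bounded_clin B"
    unfolding B_def[abs_def] by (intro bounded_clin_diff bounded_clin_scaleR cA) simp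
  have B: "selfadj B"
    using cB by (auto simp: selfadj_def B_def cinner_algebra scaleR_scaleC selfadj_swap[OF A])
  have nB: "norm (B x) \<le> norm x" for x
    using K by (simp add: B_def divide_le_eq mult.commute)
  have Bform: "Re (cinner x (B x)) = (Re (cinner x (A x)) - l * (norm x)\<^sup>2) / K" for x
    by (simp add: B_def scaleR_scaleC cinner_algebra cinner_self)
  have "positive_op (\<lambda>x. B (B x))"
    unfolding positive_op_iff selfadj_def
    by (auto intro!: bounded_clin_comp[OF cB cB] simp: selfadj_swap[OF B])
      (simp_all add: selfadj_swap[OF B, symmetric] cinner_self)
  moreover have "contraction (\<lambda>x. B (B x))"
    unfolding contraction_iff using nB order_trans by (blast intro: bounded_clin_comp[OF cB cB])
  ultimately obtain S where S: "positive_op S" "\<And>x. S (S x) = B (B x)"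
    and Scom: "\<And>Z x. bounded_clin Z \<Longrightarrow> (\<And>x. Z (B (B x)) = B (B (Z x))) \<Longrightarrow> Z (S x) = S (Z x)"
    using positive_op_sqrt[of "\<lambda>x. B (B x)"] by blast
  have saS: "selfadj S" using positive_op_selfadj[OF S(1)] .
  note cS = selfadj_clin[OF saS]
  have BS: "B (S x) = S (B x)" for x by (rule Scom[OF cB]) simp
  \<comment> \<open>\<open>S\<close> is the absolute value of \<open>B\<close>, so
    \<open>S + B\<close> is twice the positive part of \<open>B\<close>.\<close>
  define M where "M = {x. S x + B x = 0}"
  have M: "csubspace M" "closed M"
  proof -
    show "csubspace M"
      unfolding csubspace_def M_def
      by (auto simp: clin_zero[OF cS] clin_zero[OF cB] clin_add[OF cS] clin_add[OF cB]
          clin_scaleC[OF cS] clin_scaleC[OF cB] algebra_simps scaleC_add_right[symmetric])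
    show "closed M"
      unfolding M_def by (intro closed_Collect_eq continuous_on_add clin_cont cS cB continuous_on_const)
  qed
  let ?Q = "proj M"
  have Q: "orth_proj ?Q" "range ?Q = M" using proj_orth_proj[OF M] by blast+
  have QM: "?Q x = x \<longleftrightarrow> x \<in> M" for x using orth_proj_range[OF Q(1)] Q(2) by blast
  have le: "Re (cinner x (A x)) \<le> l * (norm x)\<^sup>2" if "?Q x = x" for x
  proof -
    have "B x = - S x" using that QM by (simp add: M_def eq_neg_iff_add_eq_0 add.commute)
    then have "Re (cinner x (B x)) \<le> 0" using positive_op_nonneg[OF S(1), of x] by (simp add: cinner_minus_right)
    then show ?thesis using K(1) by (simp add: Bform field_simps)
  qed
  have gt: "l * (norm x)\<^sup>2 < Re (cinner x (A x))" if Qx: "?Q x = 0" and x0: "x \<noteq> 0" for x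
  proof -
    have orth: "cinner m x = 0" if "m \<in> M" for m
      using proj_orth[OF M that, of x] Qx by simp
    have "S x - B x = 0"
    proof (rule eq_by_cinner)
      fix z
      \<comment> \<open>\<open>(S + B) (S - B) = S^2 - B^2 = 0\<close>, so the range of
        \<open>S - B\<close> lies in \<open>M\<close>, to which \<open>x\<close> is
        orthogonal.\<close>
      have "S z - B z \<in> M"
        unfolding M_def by (simp add: clin_diff[OF cS] clin_diff[OF cB] S(2) BS)
      from orth[OF this] show "cinner z (S x - B x) = cinner z 0"
        by (simp add: cinner_algebra selfadj_swap[OF saS] selfadj_swap[OF B])
    qed
    then have BS: "B x = S x" by simp
    \<comment> \<open>Were the form zero, \<open>B x = S x = 0\<close> would put \<open>x\<close>
      into \<open>M\<close>, to which it is orthogonal.\<close>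
    have "Re (cinner x (B x)) > 0"
    proof (rule ccontr)
      assume "\<not> ?thesis"
      then have "Re (cinner x (S x)) = 0" using BS positive_op_nonneg[OF S(1), of x] by simp
      then have "S x = 0" by (rule positive_op_zero_form[OF S(1)])
      then have "x \<in> M" using BS by (simp add: M_def)
      then show False using orth x0 by fastforce
    qed
    then show ?thesis using K(1) by (simp add: Bform field_simps)
  qed
  have com: "Z (?Q x) = ?Q (Z x)" if Z: "selfadj Z" "\<forall>x. Z (A x) = A (Z x)" for Z x
  proof (rule proj_commute_selfadj[OF M Z(1)])
    note cZ = selfadj_clin[OF Z(1)]
    have ZB: "Z (B x) = B (Z x)" for x
      by (simp add: B_def scaleR_scaleC clin_scaleC[OF cZ] clin_diff[OF cZ] Z(2))
    have ZS: "Z (S x) = S (Z x)" for x by (rule Scom[OF cZ]) (simp add: ZB)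
    fix x assume "x \<in> M"
    then have "Z (S x + B x) = 0" by (simp add: M_def clin_zero[OF cZ])
    then show "Z x \<in> M" by (simp add: M_def clin_add[OF cZ] ZB ZS)
  qed
  show ?thesis
    by (intro exI[of _ "proj M"] conjI allI impI Q(1)) (simp_all add: le gt com)
qed

locale positive_contraction =
  fixes A :: "'a::chilbert \<Rightarrow> 'a"
  assumes pos: "positive_op A" and contr: "contraction A"
begin

lemma sa: "selfadj A" using positive_op_selfadj[OF pos] .
lemma clin: "bounded_clin A" using selfadj_clin[OF sa] .
lemma norm_le: "norm (A x) \<le> norm x" using contr by (simp add: contraction_iff)

lemma form_le: "Re (cinner x (A x)) \<le> (norm x)\<^sup>2"
  using cauchy_schwarz[of x "A x"] complex_Re_le_cmod[of "cinner x (A x)"]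
    mult_left_mono[OF norm_le[of x], of "norm x"] by (simp add: power2_eq_square)

lemma form_ge: "0 \<le> Re (cinner x (A x))"
  using positive_op_nonneg[OF pos] .

definition Q :: "real \<Rightarrow> 'a \<Rightarrow> 'a" where
  "Q l = (SOME Q. orth_proj Q \<and>
    (\<forall>Z. selfadj Z \<longrightarrow> (\<forall>x. Z (A x) = A (Z x)) \<longrightarrow> (\<forall>x. Z (Q x) = Q (Z x))) \<and>
    (\<forall>x. Q x = x \<longrightarrow> Re (cinner x (A x)) \<le> l * (norm x)\<^sup>2) \<and>
    (\<forall>x. Q x = 0 \<longrightarrow> x \<noteq> 0 \<longrightarrow> l * (norm x)\<^sup>2 < Re (cinner x (A x))))"

lemma
  shows Q_proj: "orth_proj (Q l)"
    and Q_comm: "selfadj Z \<Longrightarrow> (\<And>x. Z (A x) = A (Z x)) \<Longrightarrow> Z (Q l x) = Q l (Z x)"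
    and Q_form_le: "Q l x = x \<Longrightarrow> Re (cinner x (A x)) \<le> l * (norm x)\<^sup>2"
    and Q_form_gt: "Q l x = 0 \<Longrightarrow> x \<noteq> 0 \<Longrightarrow> l * (norm x)\<^sup>2 < Re (cinner x (A x))"
proof -
  note q = someI_ex[OF spectral_projection_exists[OF sa, of l], folded Q_def]
  show "orth_proj (Q l)" using q by (rule conjunct1)
  show "Z (Q l x) = Q l (Z x)" if "selfadj Z" "\<And>x. Z (A x) = A (Z x)"
    using q[THEN conjunct2, THEN conjunct1, rule_format, OF that] .
  show "Re (cinner x (A x)) \<le> l * (norm x)\<^sup>2" if "Q l x = x"
    using q[THEN conjunct2, THEN conjunct2, THEN conjunct1, rule_format, OF that] .
  show "l * (norm x)\<^sup>2 < Re (cinner x (A x))" if "Q l x = 0" "x \<noteq> 0"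
    using q[THEN conjunct2, THEN conjunct2, THEN conjunct2, rule_format, OF that] .
qed

lemma Q_clin: "bounded_clin (Q l)" using orth_proj_clin[OF Q_proj] .
lemma Q_idem: "Q l (Q l x) = Q l x" using orth_proj_idem[OF Q_proj] .

lemma Q_A: "A (Q l x) = Q l (A x)"
  by (rule Q_comm[of A, OF sa]) simp

lemma Q_Q: "Q l (Q m x) = Q m (Q l x)"
  by (rule Q_comm[of "Q l", OF orth_proj_selfadj[OF Q_proj]]) (simp add: Q_A)

text \<open>A nonzero vector in the range of one projection and the kernel of the other would have a
  form both at most and above \<open>l ||x||^2\<close>. So each projection absorbs the
  other.\<close>

lemma Q_unique:
  assumes P: "orth_proj P" and PA: "\<And>x. P (A x) = A (P x)"
    and le: "\<And>x. P x = x \<Longrightarrow> Re (cinner x (A x)) \<le> l * (norm x)\<^sup>2"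
    and gt: "\<And>x. P x = 0 \<Longrightarrow> x \<noteq> 0 \<Longrightarrow> l * (norm x)\<^sup>2 < Re (cinner x (A x))"
  shows "P = Q l"
proof
  fix x
  have com: "P (Q l x) = Q l (P x)" for x
    by (rule Q_comm[of P, OF orth_proj_selfadj[OF P] PA])
  have "Q l (P x) = P x"
    by (rule orth_proj_absorb[of P "Q l", OF P Q_proj com]) (metis le Q_form_gt not_less)
  moreover have "P (Q l x) = Q l x"
    by (rule orth_proj_absorb[of "Q l" P, OF Q_proj P]) (simp add: com, metis gt Q_form_le not_less)
  ultimately show "P x = Q l x" by (simp add: com)
qed

lemma Q_mono:
  assumes "l \<le> m" shows "Q m (Q l x) = Q l x" "Q l (Q m x) = Q l x"
proof -
  show "Q m (Q l x) = Q l x"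
  proof (rule orth_proj_absorb[of "Q l" "Q m", OF Q_proj Q_proj])
    show "Q l (Q m x) = Q m (Q l x)" for x by (rule Q_Q)
    fix x assume x: "Q l x = x" "Q m x = 0"
    show "x = 0"
    proof (rule ccontr)
      assume "x \<noteq> 0"
      then show False
        using Q_form_le[OF x(1)] Q_form_gt[OF x(2)] mult_right_mono[OF assms zero_le_power2[of "norm x"]]
        by fastforce
    qed
  qed
  then show "Q l (Q m x) = Q l x" by (simp add: Q_Q)
qed

lemma Q_neg: assumes "l < 0" shows "Q l x = 0"
proof (rule ccontr)
  assume "Q l x \<noteq> 0"
  then have "l * (norm (Q l x))\<^sup>2 < 0" using assms by (intro mult_neg_pos) auto
  then show False using Q_form_le[OF Q_idem, of l x] form_ge[of "Q l x"] by linarith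
qed

lemma Q_one: assumes "l \<ge> 1" shows "Q l x = x"
proof -
  have "Q l (x - Q l x) = 0" by (simp add: clin_diff[OF Q_clin] Q_idem)
  from Q_form_gt[OF this] form_le[of "x - Q l x"] show ?thesis
    using mult_right_mono[OF assms, of "(norm (x - Q l x))\<^sup>2"] by fastforce
qed

lemma Q_norm_mono: "l \<le> m \<Longrightarrow> norm (Q l x) \<le> norm (Q m x)"
  using orth_proj_norm[OF Q_proj, of l "Q m x"] Q_mono(2) by simp

text \<open>The limit of the decreasing projections could exceed \<open>Q l x\<close> only by a
  vector \<open>y\<close> in the kernel of \<open>Q l\<close>. Its form is at most
  \<open>(l + 1/(n+1)) ||y||^2\<close> in the limit, hence at most \<open>l ||y||^2\<close>, so
  \<open>y = 0\<close>.\<close>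

lemma Q_right_cont: "(\<lambda>n. norm (Q (l + 1 / (real n + 1)) x)) \<longlonglongrightarrow> norm (Q l x)"
proof -
  define D where "D n = Q (l + 1 / (real n + 1))" for n :: nat
  have Dl: "D n (Q l x) = Q l x" "Q l (D n x) = Q l x" for n x
    unfolding D_def by (rule Q_mono(1); simp) (rule Q_mono(2); simp)
  have Dm: "D n (D m x) = D n x" "D m (D n x) = D n x" if "m \<le> n" for m n x
  proof -
    have "l + 1 / (real n + 1) \<le> l + 1 / (real m + 1)" using that by (simp add: field_simps)
    then show "D n (D m x) = D n x" "D m (D n x) = D n x"
      unfolding D_def by (rule Q_mono(2), rule Q_mono(1))
  qed
  have D: "orth_proj (D n)" for n unfolding D_def by (rule Q_proj)
  note cD = orth_proj_clin[OF D]
  \<comment> \<open>The sign turns the decreasing projections into an increasing sequence.\<close>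
  have mono: "positive_op (\<lambda>x. - D n x - - D m x)" if "m \<le> n" for m n
    unfolding positive_op_iff
  proof
    show "selfadj (\<lambda>x. - D n x - - D m x)"
      unfolding selfadj_def using bounded_clin_diff[OF cD cD, of m n]
      by (auto simp: algebra_simps cinner_algebra orth_proj_swap[OF D])
    show "\<forall>x. 0 \<le> Re (cinner x (- D n x - - D m x))"
    proof
      fix x
      have "norm (D n x) \<le> norm (D m x)"
        using orth_proj_norm[OF D, of n "D m x"] Dm(1)[OF that] by simp
      then show "0 \<le> Re (cinner x (- D n x - - D m x))"
        by (simp add: cinner_algebra orth_proj_form[OF D] power_mono)
    qed
  qed
  have "convergent (\<lambda>n. - D n x)"
    by (rule monotone_operator_convergent[OF mono, where c = 1]) (use orth_proj_norm[OF D] in auto)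
  then have "convergent (\<lambda>n. D n x)" by (rule convergent_minus_iff[THEN iffD2])
  then obtain z where z: "(\<lambda>n. D n x) \<longlonglongrightarrow> z" by (auto simp: convergent_def)
  define y where "y = z - Q l x"
  have yl: "(\<lambda>n. D n x - Q l x) \<longlonglongrightarrow> y" unfolding y_def by (intro tendsto_intros z)
  have "Q l y = 0"
  proof (rule LIMSEQ_unique)
    show "(\<lambda>n. Q l (D n x - Q l x)) \<longlonglongrightarrow> Q l y" by (rule clin_tendsto[OF Q_clin yl])
    show "(\<lambda>n. Q l (D n x - Q l x)) \<longlonglongrightarrow> 0" by (simp add: clin_diff[OF Q_clin] Dl Q_idem)
  qed
  moreover have "Re (cinner y (A y)) \<le> l * (norm y)\<^sup>2"
  proof (rule LIMSEQ_le)
    show "(\<lambda>n. Re (cinner (D n x - Q l x) (A (D n x - Q l x)))) \<longlonglongrightarrow> Re (cinner y (A y))"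
      by (intro tendsto_Re tendsto_cinner clin_tendsto[OF clin yl] yl)
    have "(\<lambda>n. l + 1 / (real n + 1)) \<longlonglongrightarrow> l"
      using LIMSEQ_inverse_real_of_nat_add[of l] by (simp add: inverse_eq_divide add.commute)
    then show "(\<lambda>n. (l + 1 / (real n + 1)) * (norm (D n x - Q l x))\<^sup>2) \<longlonglongrightarrow> l * (norm y)\<^sup>2"
      by (intro tendsto_intros yl)
    have "D n (D n x - Q l x) = D n x - Q l x" for n
      by (simp add: clin_diff[OF cD] Dl orth_proj_idem[OF D])
    then show "\<exists>N. \<forall>n\<ge>N. Re (cinner (D n x - Q l x) (A (D n x - Q l x)))
        \<le> (l + 1 / (real n + 1)) * (norm (D n x - Q l x))\<^sup>2"
      using Q_form_le unfolding D_def by blast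
  qed
  ultimately have "y = 0" using Q_form_gt[of l y] by (metis not_less)
  then have "(\<lambda>n. D n x) \<longlonglongrightarrow> Q l x" using z by (simp add: y_def)
  then show ?thesis unfolding D_def by (rule tendsto_norm)
qed

end

section \<open>The spectral measure\<close>

text \<open>Equal norms make \<open>R\<close> vanish on the kernel of \<open>P\<close> and act
  isometrically, hence identically, on its range. A spectral projection may thus be specified
  through its scalar measures alone.\<close>

lemma orth_proj_eq_by_norm:
  assumes P: "orth_proj P" and R: "orth_proj (R :: 'a::chilbert \<Rightarrow> 'a)"
    and eq: "\<And>x. norm (P x) = norm (R x)"
  shows "P = R"
proof
  fix x
  note cP = orth_proj_clin[OF P] and cR = orth_proj_clin[OF R]
  have "norm (R (x - P x)) = 0"
    unfolding eq[symmetric] by (simp add: clin_diff[OF cP] orth_proj_idem[OF P])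
  then have 1: "R x = R (P x)" by (simp add: clin_diff[OF cR])
  have "norm (R (P x)) = norm (P x)" unfolding eq[symmetric] by (simp add: orth_proj_idem[OF P])
  then have "(norm (P x - R (P x)))\<^sup>2 = 0" using orth_proj_pyth[OF R, of "P x"] by simp
  then show "P x = R x" using 1 by simp
qed

text \<open>At the vector \<open>R x\<close> the inequality leaves nothing for
  \<open>P\<close>.\<close>

lemma orth_proj_disjoint:
  assumes P: "orth_proj P" and R: "orth_proj (R :: 'a::chilbert \<Rightarrow> 'a)"
    and le: "\<And>x. (norm (P x))\<^sup>2 + (norm (R x))\<^sup>2 \<le> (norm x)\<^sup>2"
  shows "P (R x) = 0"
  using le[of "R x"] by (simp add: orth_proj_idem[OF R])

lemma orth_proj_add:
  assumes P: "orth_proj P" and R: "orth_proj (R :: 'a::chilbert \<Rightarrow> 'a)"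
    and disj: "\<And>x. P (R x) = 0"
  shows "orth_proj (\<lambda>x. P x + R x)" "(norm (P x + R x))\<^sup>2 = (norm (P x))\<^sup>2 + (norm (R x))\<^sup>2"
proof -
  note cP = orth_proj_clin[OF P] and cR = orth_proj_clin[OF R]
  have disj': "R (P x) = 0" for x
    by (rule eq_by_cinner) (metis disj orth_proj_swap[OF R] orth_proj_swap[OF P] cinner_zero_left cinner_zero_right)
  show "orth_proj (\<lambda>x. P x + R x)"
  proof (rule orth_projI)
    show "selfadj (\<lambda>x. P x + R x)"
      unfolding selfadj_def
      by (auto intro: bounded_clin_add cP cR simp: cinner_algebra orth_proj_swap[OF P] orth_proj_swap[OF R])
  qed (simp add: clin_add[OF cP] clin_add[OF cR] orth_proj_idem[OF P] orth_proj_idem[OF R] disj disj')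
  show "(norm (P x + R x))\<^sup>2 = (norm (P x))\<^sup>2 + (norm (R x))\<^sup>2"
    by (rule pythagoras) (simp add: orth_proj_swap[OF P] disj)
qed

lemma orth_proj_zero: "orth_proj (\<lambda>x. 0 :: 'a::chilbert)"
  by (rule orth_projI) (auto simp: selfadj_def)

lemma orth_proj_series:
  fixes P :: "nat \<Rightarrow> 'a::chilbert \<Rightarrow> 'a"
  assumes P: "\<And>i. orth_proj (P i)" and disj: "\<And>i j x. i \<noteq> j \<Longrightarrow> P i (P j x) = 0"
  shows "\<exists>L. orth_proj L \<and> (\<forall>x. (\<lambda>i. (norm (P i x))\<^sup>2) sums (norm (L x))\<^sup>2)"
proof -
  define S where "S n x = (\<Sum>i<n. P i x)" for n x
  note cP = orth_proj_clin[OF P]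
  \<comment> \<open>Orthogonality to all later projections is part of the invariant so that the next
    one can be added.\<close>
  have S: "orth_proj (S n) \<and> (\<forall>i\<ge>n. \<forall>x. P i (S n x) = 0 \<and> S n (P i x) = 0) \<and>
      (\<forall>x. (norm (S n x))\<^sup>2 = (\<Sum>i<n. (norm (P i x))\<^sup>2))" for n
  proof (induction n)
    case 0
    show ?case using orth_proj_zero by (simp add: S_def clin_zero[OF cP])
  next
    case (Suc n)
    then have dis: "S n (P n x) = 0" for x by simp
    have S': "S (Suc n) = (\<lambda>x. S n x + P n x)" by (auto simp: S_def)
    note add = orth_proj_add[OF Suc[THEN conjunct1] P dis]
    show ?case using Suc add disj by (auto simp: S' clin_add[OF cP])
  qed
  note oS = S[THEN conjunct1] and nS = S[THEN conjunct2, THEN conjunct2, rule_format]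
  note cS = orth_proj_clin[OF oS]
  have S_abs: "S n (S m x) = S n x" if "n \<le> m" for n m x
    using that
  proof (induction rule: dec_induct)
    case base
    then show ?case by (simp add: orth_proj_idem[OF oS])
  next
    case (step m)
    have "S n (P m x) = 0" using S[of n] step by simp
    moreover have "S (Suc m) x = S m x + P m x" by (simp add: S_def)
    ultimately show ?case using step by (simp add: clin_add[OF cS])
  qed
  have mono: "positive_op (\<lambda>x. S n x - S m x)" if "m \<le> n" for m n
    unfolding positive_op_iff
  proof
    show "selfadj (\<lambda>x. S n x - S m x)"
      unfolding selfadj_def using bounded_clin_diff[OF cS cS]
      by (auto simp: cinner_algebra orth_proj_swap[OF oS])
    show "\<forall>x. 0 \<le> Re (cinner x (S n x - S m x))"
    proof
      fix x
      have "(\<Sum>i<m. (norm (P i x))\<^sup>2) \<le> (\<Sum>i<n. (norm (P i x))\<^sup>2)"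
        using that by (intro sum_mono2) auto
      then show "0 \<le> Re (cinner x (S n x - S m x))"
        by (simp add: cinner_diff_right orth_proj_form[OF oS] nS)
    qed
  qed
  have b: "norm (S n x) \<le> 1 * norm x" for n x using orth_proj_norm[OF oS] by simp
  define L where "L x = lim (\<lambda>n. S n x)" for x
  have L: "(\<lambda>n. S n x) \<longlonglongrightarrow> L x" for x
    using monotone_operator_convergent[OF mono b] unfolding L_def convergent_LIMSEQ_iff .
  have "selfadj L" by (rule strong_limit_selfadj[OF orth_proj_selfadj[OF oS] b L])
  moreover have "L (L x) = L x" for x
  proof (rule LIMSEQ_unique)
    show "(\<lambda>n. S n (L x)) \<longlonglongrightarrow> L (L x)" by (rule L)
    \<comment> \<open>Later partial sums do not change what \<open>S n\<close> sees, so
      \<open>L (L x)\<close> and \<open>L x\<close> are limits of the same sequence.\<close>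
    have "S n (L x) = S n x" for n
    proof (rule LIMSEQ_unique)
      show "(\<lambda>m. S n (S m x)) \<longlonglongrightarrow> S n (L x)" by (rule clin_tendsto[OF cS L])
      show "(\<lambda>m. S n (S m x)) \<longlonglongrightarrow> S n x"
        by (rule tendsto_eventually) (use S_abs eventually_ge_at_top in \<open>blast intro: eventually_mono\<close>)
    qed
    then show "(\<lambda>n. S n (L x)) \<longlonglongrightarrow> L x" using L by simp
  qed
  ultimately have "orth_proj L" by (rule orth_projI)
  moreover have "(\<lambda>i. (norm (P i x))\<^sup>2) sums (norm (L x))\<^sup>2" for x
    unfolding sums_def nS[symmetric] by (intro tendsto_power tendsto_norm L)
  ultimately show ?thesis by blast
qed

lemma sets_borel_atMost: "sets (borel :: real measure) = sigma_sets UNIV (range atMost)"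
  by (subst borel_eq_atMost) (simp add: sets_measure_of)

lemma Int_stable_atMost: "Int_stable (range (atMost :: real \<Rightarrow> _))"
  unfolding Int_stable_def by (auto simp: Int_atMost)

section \<open>The scalar measures and the projections built from them\<close>

context positive_contraction
begin

text \<open>The spectral distribution function at the vector \<open>x\<close>; its Stieltjes measure
  provides the squared norms of \<open>E \<omega> x\<close>.\<close>

definition F :: "'a \<Rightarrow> real \<Rightarrow> real" where "F x l = (norm (Q l x))\<^sup>2"

lemma F_mono: "l \<le> m \<Longrightarrow> F x l \<le> F x m"
  unfolding F_def using Q_norm_mono by (simp add: power_mono)

lemma F_right_cont: "continuous (at_right a) (F x)"
proof (subst continuous_at_right_real_increasing)
  show "\<forall>\<epsilon>>0. \<exists>\<delta>>0. F x (a + \<delta>) - F x a < \<epsilon>"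
  proof (intro allI impI)
    fix e :: real assume "e > 0"
    have "(\<lambda>n. F x (a + 1 / (real n + 1))) \<longlonglongrightarrow> F x a"
      unfolding F_def by (intro tendsto_power Q_right_cont)
    from order_tendstoD(2)[OF this, of "F x a + e"] \<open>e > 0\<close>
    obtain n where "F x (a + 1 / (real n + 1)) < F x a + e"
      by (auto simp: eventually_sequentially)
    then show "\<exists>\<delta>>0. F x (a + \<delta>) - F x a < e"
      by (intro exI[of _ "1 / (real n + 1)"]) auto
  qed
qed (rule F_mono)

definition \<mu> :: "'a \<Rightarrow> real measure" where "\<mu> x = interval_measure (F x)"

lemma sets_\<mu> [simp, measurable_cong]: "sets (\<mu> x) = sets borel" by (simp add: \<mu>_def)
lemma space_\<mu> [simp]: "space (\<mu> x) = UNIV" by (simp add: \<mu>_def)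

lemma emeasure_\<mu>_Ioc: "a \<le> b \<Longrightarrow> emeasure (\<mu> x) {a<..b} = ennreal (F x b - F x a)"
  unfolding \<mu>_def by (rule emeasure_interval_measure_Ioc[OF _ F_mono F_right_cont])

lemma F_neg: "l < 0 \<Longrightarrow> F x l = 0" by (simp add: F_def Q_neg)
lemma F_one: "l \<ge> 1 \<Longrightarrow> F x l = (norm x)\<^sup>2" by (simp add: F_def Q_one)
lemma F_nonneg: "F x l \<ge> 0" by (simp add: F_def)

lemma emeasure_\<mu>_Iic: "emeasure (\<mu> x) {..l} = ennreal (F x l)"
proof (rule LIMSEQ_unique)
  show "(\<lambda>n. emeasure (\<mu> x) {- real n<..l}) \<longlonglongrightarrow> emeasure (\<mu> x) {..l}"
  proof -
    have "(\<Union>n. {- real n<..l}) = {..l}"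
    proof (safe; simp)
      fix y :: real
      obtain n :: nat where "- y < real n" using reals_Archimedean2 by blast
      then show "\<exists>n. - real n < y" by (intro exI[of _ n]) simp
    qed
    moreover have "(\<lambda>n. emeasure (\<mu> x) {- real n<..l}) \<longlonglongrightarrow> emeasure (\<mu> x) (\<Union>n. {- real n<..l})"
      by (rule Lim_emeasure_incseq) (auto simp: incseq_def)
    ultimately show ?thesis by simp
  qed
  obtain N :: nat where N: "real N > \<bar>l\<bar> + 1" using reals_Archimedean2 by blast
  show "(\<lambda>n. emeasure (\<mu> x) {- real n<..l}) \<longlonglongrightarrow> ennreal (F x l)"
  proof (rule tendsto_eventually, rule eventually_sequentiallyI[of N])
    fix n assume "n \<ge> N"
    then have "real n > \<bar>l\<bar> + 1" using N by simp
    then show "emeasure (\<mu> x) {- real n<..l} = ennreal (F x l)"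
      by (subst emeasure_\<mu>_Ioc) (auto simp: F_neg)
  qed
qed

lemma emeasure_\<mu>_UNIV: "emeasure (\<mu> x) UNIV = ennreal ((norm x)\<^sup>2)"
proof (rule LIMSEQ_unique)
  show "(\<lambda>n. emeasure (\<mu> x) {..real n}) \<longlonglongrightarrow> emeasure (\<mu> x) UNIV"
  proof -
    have "(\<Union>n. {..real n}) = UNIV" by (auto simp: real_arch_simple)
    moreover have "(\<lambda>n. emeasure (\<mu> x) {..real n}) \<longlonglongrightarrow> emeasure (\<mu> x) (\<Union>n. {..real n})"
      by (rule Lim_emeasure_incseq) (auto simp: incseq_def)
    ultimately show ?thesis by simp
  qed
  show "(\<lambda>n. emeasure (\<mu> x) {..real n}) \<longlonglongrightarrow> ennreal ((norm x)\<^sup>2)"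
    by (rule tendsto_eventually, rule eventually_sequentiallyI[of 1])
       (simp add: emeasure_\<mu>_Iic F_one)
qed

lemma finite_\<mu>: "finite_measure (\<mu> x)"
  by (rule finite_measureI) (simp add: emeasure_\<mu>_UNIV)

lemma measure_\<mu>_UNIV: "measure (\<mu> x) UNIV = (norm x)\<^sup>2"
  by (simp add: measure_def emeasure_\<mu>_UNIV)

lemma measure_\<mu>_Iic: "measure (\<mu> x) {..l} = F x l"
  by (simp add: measure_def emeasure_\<mu>_Iic F_nonneg)

lemma spectral_projection_borel:
  assumes "\<omega> \<in> sets (borel :: real measure)"
  shows "\<exists>P. orth_proj P \<and> (\<forall>x. (norm (P x))\<^sup>2 = measure (\<mu> x) \<omega>)"
proof -
  have sub: "range atMost \<subseteq> Pow (UNIV :: real set)" by simp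
  have \<omega>: "\<omega> \<in> sigma_sets UNIV (range atMost)" using assms by (simp add: sets_borel_atMost)
  from Int_stable_atMost sub \<omega> show ?thesis
  proof (induction rule: sigma_sets_induct_disjoint)
    case (basic \<omega>)
    then obtain l where "\<omega> = {..l}" by auto
    then show ?case by (intro exI[of _ "Q l"]) (simp add: Q_proj measure_\<mu>_Iic F_def)
  next
    case empty
    then show ?case using orth_proj_zero by fastforce
  next
    case (compl \<omega>)
    then obtain P where P: "orth_proj P" "\<And>x. (norm (P x))\<^sup>2 = measure (\<mu> x) \<omega>" by blast
    have "(norm (x - P x))\<^sup>2 = measure (\<mu> x) (UNIV - \<omega>)" for x
      using finite_measure.finite_measure_compl[OF finite_\<mu>, of \<omega> x] compl(1)
        orth_proj_pyth[OF P(1), of x] by (simp add: P(2) measure_\<mu>_UNIV sets_borel_atMost)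
    then show ?case using orth_proj_compl[OF P(1)] by blast
  next
    case (union B)
    then obtain P where P: "\<And>i. orth_proj (P i)" "\<And>i x. (norm (P i x))\<^sup>2 = measure (\<mu> x) (B i)" by metis
    have Bs: "range B \<subseteq> sets (\<mu> x)" for x using union(2) by (simp add: sets_borel_atMost)
    \<comment> \<open>Additivity of the scalar measures bounds the sum of the two squared norms by
      \<open>||x||^2\<close>, which forces the projections to be orthogonal.\<close>
    have disj: "P i (P j x) = 0" if "i \<noteq> j" for i j x
    proof (rule orth_proj_disjoint[OF P(1) P(1)])
      fix x
      interpret finite_measure "\<mu> x" by (rule finite_\<mu>)
      have "measure (\<mu> x) (B i) + measure (\<mu> x) (B j) = measure (\<mu> x) (B i \<union> B j)"
        using Bs that union(1) by (intro finite_measure_Union[symmetric]) (auto simp: disjoint_family_on_def)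
      also have "\<dots> \<le> measure (\<mu> x) UNIV" by (intro finite_measure_mono) simp_all
      finally show "(norm (P i x))\<^sup>2 + (norm (P j x))\<^sup>2 \<le> (norm x)\<^sup>2" by (simp add: P(2) measure_\<mu>_UNIV)
    qed
    from orth_proj_series[of P, OF P(1) disj] obtain L where
      L: "orth_proj L" "\<And>x. (\<lambda>i. (norm (P i x))\<^sup>2) sums (norm (L x))\<^sup>2" by blast
    have "(norm (L x))\<^sup>2 = measure (\<mu> x) (\<Union>i. B i)" for x
      using finite_measure.finite_measure_UNION[OF finite_\<mu> Bs union(1), of x] L(2)[of x]
      by (auto simp: P(2) intro: sums_unique2)
    then show ?case using L(1) by blast
  qed
qed

definition E :: "real set \<Rightarrow> 'a \<Rightarrow> 'a" where
  "E \<omega> = (if \<omega> \<in> sets borel then SOME P. orth_proj P \<and> (\<forall>x. (norm (P x))\<^sup>2 = measure (\<mu> x) \<omega>)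
     else (\<lambda>_. 0))"

lemma
  assumes "\<omega> \<in> sets borel"
  shows E_proj: "orth_proj (E \<omega>)" and E_norm: "(norm (E \<omega> x))\<^sup>2 = measure (\<mu> x) \<omega>"
  using someI_ex[OF spectral_projection_borel[OF assms]] assms by (simp_all add: E_def)

lemma E_nonborel: "\<omega> \<notin> sets borel \<Longrightarrow> E \<omega> = (\<lambda>_. 0)"
  by (simp add: E_def)

lemma E_eqI:
  assumes "\<omega> \<in> sets borel" "orth_proj P" "\<And>x. (norm (P x))\<^sup>2 = measure (\<mu> x) \<omega>"
  shows "E \<omega> = P"
proof (rule orth_proj_eq_by_norm)
  show "norm (E \<omega> x) = norm (P x)" for x
    using E_norm[OF assms(1), of x] assms(3)[of x] by (metis norm_ge_zero power2_eq_iff_nonneg)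
qed (use assms E_proj in auto)

lemma E_atMost: "E {..l} = Q l"
  by (rule E_eqI) (simp_all add: Q_proj measure_\<mu>_Iic F_def)

lemma E_disjoint:
  assumes B: "\<omega>1 \<in> sets borel" "\<omega>2 \<in> sets borel" "\<omega>1 \<inter> \<omega>2 = {}"
  shows "E \<omega>1 (E \<omega>2 x) = 0" "E (\<omega>1 \<union> \<omega>2) x = E \<omega>1 x + E \<omega>2 x"
proof -
  have m: "measure (\<mu> x) \<omega>1 + measure (\<mu> x) \<omega>2 = measure (\<mu> x) (\<omega>1 \<union> \<omega>2)" for x
    using B by (intro finite_measure.finite_measure_Union[OF finite_\<mu>, symmetric]) auto
  show disj: "E \<omega>1 (E \<omega>2 x) = 0" for x
  proof (rule orth_proj_disjoint[OF E_proj[OF B(1)] E_proj[OF B(2)]])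
    fix x
    have "measure (\<mu> x) (\<omega>1 \<union> \<omega>2) \<le> measure (\<mu> x) UNIV"
      by (intro finite_measure.finite_measure_mono[OF finite_\<mu>]) simp_all
    then show "(norm (E \<omega>1 x))\<^sup>2 + (norm (E \<omega>2 x))\<^sup>2 \<le> (norm x)\<^sup>2"
      using B m[of x] by (simp add: E_norm measure_\<mu>_UNIV)
  qed
  note add = orth_proj_add[OF E_proj[OF B(1)] E_proj[OF B(2)] disj]
  have "E (\<omega>1 \<union> \<omega>2) = (\<lambda>x. E \<omega>1 x + E \<omega>2 x)"
    by (rule E_eqI) (use B add m in \<open>auto simp: E_norm\<close>)
  then show "E (\<omega>1 \<union> \<omega>2) x = E \<omega>1 x + E \<omega>2 x" by simp
qed

text \<open>Multiplicativity follows from additivity: both sets split into the intersection and a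
  difference, and the three mixed products vanish.\<close>

lemma E_Int:
  assumes B: "\<omega>1 \<in> sets borel" "\<omega>2 \<in> sets borel"
  shows "E (\<omega>1 \<inter> \<omega>2) x = E \<omega>1 (E \<omega>2 x)"
proof -
  let ?I = "\<omega>1 \<inter> \<omega>2" and ?A = "\<omega>1 - \<omega>2" and ?B = "\<omega>2 - \<omega>1"
  have "E \<omega>1 y = E ?I y + E ?A y" for y
  proof -
    have "?I \<union> ?A = \<omega>1" "?I \<inter> ?A = {}" by blast+
    then show ?thesis using E_disjoint(2)[of ?I ?A y] B by simp
  qed
  moreover have "E \<omega>2 y = E ?I y + E ?B y" for y
  proof -
    have "?I \<union> ?B = \<omega>2" "?I \<inter> ?B = {}" by blast+
    then show ?thesis using E_disjoint(2)[of ?I ?B y] B by simp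
  qed
  moreover have "E ?I (E ?B x) = 0" "E ?A (E ?I x) = 0" "E ?A (E ?B x) = 0"
    using B by (auto intro!: E_disjoint(1))
  moreover have "bounded_clin (E ?I)" "bounded_clin (E ?A)" "E ?I (E ?I x) = E ?I x"
    using B by (auto intro: orth_proj_clin E_proj orth_proj_idem)
  ultimately show ?thesis by (simp add: clin_add)
qed

lemma E_UNIV: "E UNIV = id"
  by (rule E_eqI) (auto simp: measure_\<mu>_UNIV id_def intro: orth_projI simp: selfadj_def)

lemma E_Ioc: "a \<le> b \<Longrightarrow> E {a<..b} x = Q b x - Q a x"
  using E_disjoint(2)[of "{..a}" "{a<..b}" x] ivl_disj_int_one(3)[of a b]
  by (simp add: E_atMost ivl_disj_un algebra_simps)

lemma emeasure_\<mu>_eq: "(\<lambda>\<omega>. ennreal ((norm (E \<omega> x))\<^sup>2)) = emeasure (\<mu> x)"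
proof
  fix \<omega>
  show "ennreal ((norm (E \<omega> x))\<^sup>2) = emeasure (\<mu> x) \<omega>"
  proof (cases "\<omega> \<in> sets borel")
    case True
    then show ?thesis by (simp add: E_norm finite_measure.emeasure_eq_measure[OF finite_\<mu>])
  next
    case False
    then show ?thesis by (simp add: E_def emeasure_notin_sets)
  qed
qed

text \<open>The left end is negative because the kernel of \<open>A\<close> may put an atom at 0,
  which a half-open interval starting at 0 would miss.\<close>

lemma AE_\<mu>: "AE t in \<mu> x. t \<in> {-1<..1}"
proof (rule AE_I)
  show "UNIV - {-1<..1::real} \<in> sets (\<mu> x)" by simp
  show "emeasure (\<mu> x) (UNIV - {-1<..1}) = 0"
    using finite_measure.finite_measure_compl[OF finite_\<mu>, of "{-1<..1}" x]
    by (simp add: finite_measure.emeasure_eq_measure[OF finite_\<mu>] measure_\<mu>_UNIV E_norm[symmetric]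
        E_Ioc Q_neg Q_one)
qed auto

lemma integrable_\<mu>: "integrable (\<mu> x) (\<lambda>t. t)"
proof (rule finite_measure.integrable_const_bound[OF finite_\<mu>, where B = 1])
  show "AE t in \<mu> x. norm t \<le> 1" using AE_\<mu> by eventually_elim auto
qed simp

text \<open>On a short interval the integral and the form differ by at most its length times the mass;
  bisecting the interval shows that they agree.\<close>
lemma integral_Ioc_\<mu>:
  assumes "a \<le> b"
  shows "(\<integral>t. indicator {a<..b} t * t \<partial>\<mu> x) = Re (cinner x (A (Q b x - Q a x)))"
proof -
  define D where "D a b = (\<integral>t. indicator {a<..b} t * t \<partial>\<mu> x) - Re (cinner x (A (Q b x - Q a x)))" for a b
  have int: "integrable (\<mu> x) (\<lambda>t. indicator {a<..b} t * t)" for a b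
    using integrable_real_mult_indicator[OF _ integrable_\<mu>, of "{a<..b}" x] by (simp add: mult.commute)
  have D_add: "D a b = D a c + D c b" if "a \<le> c" "c \<le> b" for a b c
  proof -
    have "(\<integral>t. indicator {a<..b} t * t \<partial>\<mu> x) = (\<integral>t. indicator {a<..c} t * t + indicator {c<..b} t * t \<partial>\<mu> x)"
      using that by (intro Bochner_Integration.integral_cong) (auto simp: indicator_def)
    also have "\<dots> = (\<integral>t. indicator {a<..c} t * t \<partial>\<mu> x) + (\<integral>t. indicator {c<..b} t * t \<partial>\<mu> x)"
      by (intro Bochner_Integration.integral_add int)
    finally show ?thesis by (simp add: D_def clin_diff[OF clin] cinner_algebra)
  qed
  have D_base: "\<bar>D a b\<bar> \<le> (b - a) * (F x b - F x a)" if ab: "a \<le> b" for a b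
  proof -
    interpret finite_measure "\<mu> x" by (rule finite_\<mu>)
    define m where "m = F x b - F x a"
    have m: "m = measure (\<mu> x) {a<..b}"
      using emeasure_\<mu>_Ioc[OF ab, of x] F_mono[OF ab, of x] by (simp add: measure_def m_def)
    have mint: "(\<integral>t. indicator {a<..b} t * c \<partial>\<mu> x) = c * m" for c
      by (simp add: m)
    have ii: "integrable (\<mu> x) (\<lambda>t. indicator {a<..b} t * c)" for c :: real
      by (simp add: emeasure_\<mu>_Ioc[OF ab])
    have I1: "a * m \<le> (\<integral>t. indicator {a<..b} t * t \<partial>\<mu> x)"
      unfolding mint[symmetric] by (intro integral_mono int ii) (auto simp: indicator_def)
    have I2: "(\<integral>t. indicator {a<..b} t * t \<partial>\<mu> x) \<le> b * m"
      unfolding mint[symmetric] by (intro integral_mono int ii) (auto simp: indicator_def)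
    define y where "y = Q b x - Q a x"
    have Ey: "E {a<..b} x = y" by (simp add: y_def E_Ioc[OF ab])
    have ym: "(norm y)\<^sup>2 = m" unfolding m Ey[symmetric] by (rule E_norm) simp
    have Qb: "Q b y = y" and Qa: "Q a y = 0"
      using Q_mono[OF ab] by (simp_all add: y_def clin_diff[OF Q_clin] Q_idem)
    have "cinner x (A y) = cinner x (A (E {a<..b} y))"
      using Ey orth_proj_idem[OF E_proj, of "{a<..b}" x] by simp
    also have "\<dots> = cinner x (E {a<..b} (A y))"
      by (simp add: E_Ioc[OF ab] clin_diff[OF clin] Q_A)
    also have "\<dots> = cinner y (A y)"
      by (subst orth_proj_swap[OF E_proj, symmetric]) (simp_all add: Ey)
    finally have c: "cinner x (A y) = cinner y (A y)" .
    have f1: "Re (cinner y (A y)) \<le> b * m" using Q_form_le[OF Qb] by (simp add: ym)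
    have f2: "a * m \<le> Re (cinner y (A y))"
      using Q_form_gt[OF Qa] ym clin_zero[OF clin] by (cases "y = 0") auto
    have "\<bar>D a b\<bar> \<le> b * m - a * m"
      unfolding D_def y_def[symmetric] c using I1 I2 f1 f2 by linarith
    then show ?thesis by (simp add: m_def algebra_simps)
  qed
  have "\<bar>D a b\<bar> \<le> (b - a) / 2 ^ n * (F x b - F x a)" if "a \<le> b" for n a b
    using that
  proof (induction n arbitrary: a b)
    case 0
    then show ?case using D_base by simp
  next
    case (Suc n)
    define c where "c = (a + b) / 2"
    have c: "a \<le> c" "c \<le> b" "c - a = (b - a) / 2" "b - c = (b - a) / 2"
      using Suc.prems by (auto simp: c_def field_simps)
    have "\<bar>D a b\<bar> \<le> \<bar>D a c\<bar> + \<bar>D c b\<bar>" using D_add[OF c(1,2)] by simp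
    \<comment> \<open>The halves have half the length while their masses add up, so one bisection
      halves the bound.\<close>
    also have "\<dots> \<le> (b - a) / 2 / 2 ^ n * (F x c - F x a) + (b - a) / 2 / 2 ^ n * (F x b - F x c)"
      using Suc.IH[OF c(1)] Suc.IH[OF c(2)] unfolding c(3,4) by (rule add_mono)
    also have "\<dots> = (b - a) / 2 ^ Suc n * (F x b - F x a)"
      by (simp only: distrib_left[symmetric]) simp
    finally show ?case .
  qed
  from this[OF assms] have "\<bar>D a b\<bar> \<le> (b - a) * (F x b - F x a) * (1 / 2) ^ n" for n
    by (simp add: power_one_over field_simps)
  moreover have "(\<lambda>n. (b - a) * (F x b - F x a) * (1 / 2) ^ n) \<longlonglongrightarrow> (b - a) * (F x b - F x a) * 0"
    by (intro tendsto_mult_left LIMSEQ_realpow_zero) auto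
  ultimately have "\<bar>D a b\<bar> \<le> 0" by (intro LIMSEQ_le_const) auto
  then show ?thesis by (simp add: D_def)
qed

lemma has_bochner_integral_\<mu>: "has_bochner_integral (\<mu> x) (\<lambda>t. t) (Re (cinner x (A x)))"
proof -
  have "(\<integral>t. t \<partial>\<mu> x) = (\<integral>t. indicator {-1<..1} t * t \<partial>\<mu> x)"
  proof (rule integral_cong_AE)
    show "AE t in \<mu> x. t = indicator {-1<..1} t * t" using AE_\<mu> by eventually_elim auto
  qed simp_all
  also have "\<dots> = Re (cinner x (A x))" by (simp add: integral_Ioc_\<mu> Q_neg Q_one)
  finally show ?thesis using integrable_\<mu> by (simp add: has_bochner_integral_iff)
qed

lemma spectral_measure_E: "spectral_measure_of A E"
proof -
  have "measure_space UNIV (sets borel) (emeasure (\<mu> x))" for x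
    using measure_space[of "\<mu> x"] by simp
  moreover have "measure_of UNIV (sets borel) (emeasure (\<mu> x)) = \<mu> x" for x
    using measure_of_of_measure[of "\<mu> x"] by simp
  moreover have "cinner x (A x) = complex_of_real (Re (cinner x (A x)))" for x
    by (rule selfadj_form_real[OF sa])
  moreover have "E (\<omega>1 \<inter> \<omega>2) = E \<omega>1 \<circ> E \<omega>2" if "\<omega>1 \<in> sets borel" "\<omega>2 \<in> sets borel" for \<omega>1 \<omega>2
    using E_Int[OF that] by auto
  ultimately show ?thesis
    unfolding spectral_measure_of_def emeasure_\<mu>_eq
  proof (intro conjI allI impI ballI)
    fix x
    assume eq: "\<And>x. measure_of UNIV (sets borel) (emeasure (\<mu> x)) = \<mu> x"
      and r: "\<And>x. cinner x (A x) = complex_of_real (Re (cinner x (A x)))"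
    show "\<exists>r. has_bochner_integral (measure_of UNIV (sets borel) (emeasure (\<mu> x))) (\<lambda>t. t) r \<and>
        cinner x (A x) = complex_of_real r"
      by (intro exI[of _ "Re (cinner x (A x))"] conjI r) (simp only: eq has_bochner_integral_\<mu>)
  qed (simp_all add: E_proj E_UNIV E_nonborel)
qed

text \<open>A competing \<open>G\<close> is tied to \<open>A\<close> only through integrals along
  the diagonal, so commutation must be earned first: cutting the integral at \<open>\<omega>\<close>
  splits the form of \<open>A\<close> along \<open>G \<omega>\<close>, and polarization removes the
  off-diagonal part. Then \<open>G\<close> agrees with \<open>Q\<close> on half-lines, which
  generate the Borel sets and are closed under intersection.\<close>

lemma spectral_measure_unique:
  assumes G: "spectral_measure_of A G" shows "G = E"
proof -
  have Gp: "orth_proj (G \<omega>)" if "\<omega> \<in> sets borel" for \<omega>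
    using G that by (simp add: spectral_measure_of_def)
  have GU: "G UNIV x = x" for x using G by (simp add: spectral_measure_of_def)
  have GI: "G (\<omega>1 \<inter> \<omega>2) x = G \<omega>1 (G \<omega>2 x)" if "\<omega>1 \<in> sets borel" "\<omega>2 \<in> sets borel" for \<omega>1 \<omega>2 x
    using G that by (simp add: spectral_measure_of_def)
  define \<nu> where "\<nu> x = measure_of UNIV (sets borel) (\<lambda>\<omega>. ennreal ((norm (G \<omega> x))\<^sup>2))" for x
  have [simp, measurable_cong]: "sets (\<nu> x) = sets borel" for x
    using sets.sigma_sets_eq[of borel] by (simp add: \<nu>_def sets_measure_of)
  have [simp]: "space (\<nu> x) = UNIV" for x by (simp add: \<nu>_def space_measure_of)
  have em: "emeasure (\<nu> x) \<omega> = ennreal ((norm (G \<omega> x))\<^sup>2)" if "\<omega> \<in> sets borel" for \<omega> x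
    unfolding \<nu>_def
    using G that by (intro emeasure_measure_of_sigma) (auto simp: spectral_measure_of_def measure_space_def)
  have fin: "finite_measure (\<nu> x)" for x by (rule finite_measureI) (simp add: em)
  have m: "measure (\<nu> x) \<omega> = (norm (G \<omega> x))\<^sup>2" if "\<omega> \<in> sets borel" for \<omega> x
    using em[OF that] by (simp add: measure_def)
  have int: "integrable (\<nu> x) (\<lambda>t. t)" "cinner x (A x) = complex_of_real (\<integral>t. t \<partial>\<nu> x)" for x
    using G unfolding spectral_measure_of_def \<nu>_def by (metis has_bochner_integral_iff)+
  have Gc: "G (UNIV - \<omega>) x = x - G \<omega> x" if B: "\<omega> \<in> sets borel" for \<omega> x
  proof -
    have "G (UNIV - \<omega>) = (\<lambda>x. x - G \<omega> x)"
    proof (rule orth_proj_eq_by_norm)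
      fix x
      have "(norm (G (UNIV - \<omega>) x))\<^sup>2 = (norm (x - G \<omega> x))\<^sup>2"
        using finite_measure.finite_measure_compl[OF fin, of \<omega> x] B orth_proj_pyth[OF Gp[OF B], of x]
        by (simp add: m GU)
      then show "norm (G (UNIV - \<omega>) x) = norm (x - G \<omega> x)"
        by (metis norm_ge_zero power2_eq_iff_nonneg)
    qed (use B in \<open>auto intro: Gp orth_proj_compl\<close>)
    then show ?thesis by simp
  qed
  \<comment> \<open>By multiplicativity the scalar measure of \<open>G \<omega> x\<close> is that of
    \<open>x\<close> restricted to \<open>\<omega>\<close>.\<close>
  have split: "(\<integral>t. t \<partial>\<nu> (G \<omega> x)) = (\<integral>t. indicator \<omega> t * t \<partial>\<nu> x)" if B: "\<omega> \<in> sets borel" for \<omega> x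
  proof -
    have "\<nu> (G \<omega> x) = density (\<nu> x) (indicator \<omega>)"
    proof (rule measure_eqI)
      fix \<omega>' assume "\<omega>' \<in> sets (\<nu> (G \<omega> x))"
      then have B': "\<omega>' \<in> sets borel" by simp
      have "emeasure (density (\<nu> x) (indicator \<omega>)) \<omega>' = emeasure (\<nu> x) (\<omega> \<inter> \<omega>')"
        using B B' by (subst emeasure_density) (auto simp: nn_integral_indicator indicator_inter_arith[symmetric])
      then show "emeasure (\<nu> (G \<omega> x)) \<omega>' = emeasure (density (\<nu> x) (indicator \<omega>)) \<omega>'"
        using B B' by (simp add: em GI[symmetric] Int_commute)
    qed simp
    moreover have "density (\<nu> x) (indicator \<omega>) = density (\<nu> x) (\<lambda>t. ennreal (indicator \<omega> t))"
      by (simp add: ennreal_indicator)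
    ultimately show ?thesis using B by (subst (asm) (2) density_cong) (auto simp: integral_density)
  qed
  have GA: "G \<omega> (A x) = A (G \<omega> x)" if B: "\<omega> \<in> sets borel" for \<omega> x
  proof -
    note cG = orth_proj_clin[OF Gp[OF B]]
    have form: "cinner x (A x) = cinner (G \<omega> x) (A (G \<omega> x)) + cinner (x - G \<omega> x) (A (x - G \<omega> x))" for x
    proof -
      have ind: "integrable (\<nu> x) (\<lambda>t. indicator w t * t)" if "w \<in> sets borel" for w
        using integrable_real_mult_indicator[OF _ int(1), of w x] that by (simp add: mult.commute)
      have "(\<integral>t. t \<partial>\<nu> x) = (\<integral>t. indicator \<omega> t * t + indicator (UNIV - \<omega>) t * t \<partial>\<nu> x)"
        by (intro Bochner_Integration.integral_cong) (auto simp: indicator_def)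
      also have "\<dots> = (\<integral>t. indicator \<omega> t * t \<partial>\<nu> x) + (\<integral>t. indicator (UNIV - \<omega>) t * t \<partial>\<nu> x)"
        using B by (intro Bochner_Integration.integral_add ind) auto
      finally show ?thesis
        using B split[OF B, of x] split[of "UNIV - \<omega>" x] by (simp add: int(2) Gc)
    qed
    \<comment> \<open>The split form at \<open>y + w\<close> makes the sum of the two cross terms
      zero; inserting \<open>\<i> z\<close> does the same for their difference.\<close>
    have cross: "cinner y (A z) = 0" if y: "G \<omega> y = y" and z: "G \<omega> z = 0" for y z
    proof -
      have c: "cinner y (A w) + cinner w (A y) = 0" if "G \<omega> w = 0" for w
        using form[of "y + w"] y that
        by (simp add: clin_add[OF cG] clin_add[OF clin] cinner_algebra add.commute)
      have "cinner y (A (scaleC \<i> z)) + cinner (scaleC \<i> z) (A y) = 0"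
        using z by (intro c) (simp add: clin_scaleC[OF cG])
      then have "\<i> * (cinner y (A z) - cinner z (A y)) = 0"
        by (simp add: clin_scaleC[OF clin] cinner_algebra algebra_simps)
      then show ?thesis using c[OF z] by simp
    qed
    have z0: "G \<omega> (x - G \<omega> x) = 0" for x by (simp add: clin_diff[OF cG] orth_proj_idem[OF Gp[OF B]])
    have 1: "G \<omega> (A w) = 0" if "G \<omega> w = 0" for w
    proof (rule eq_by_cinner)
      fix u
      have "cinner u (G \<omega> (A w)) = cinner (G \<omega> u) (A w)" by (simp add: orth_proj_swap[OF Gp[OF B]])
      then show "cinner u (G \<omega> (A w)) = cinner u 0"
        using cross[OF orth_proj_idem[OF Gp[OF B]] that] by simp
    qed
    have 2: "G \<omega> (A y) = A y" if y: "G \<omega> y = y" for y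
    proof (rule eq_by_cinner)
      fix u
      have "cinner (u - G \<omega> u) (A y) = cinner (A (u - G \<omega> u)) y" by (simp add: selfadj_swap[OF sa])
      also have "\<dots> = 0" using cross[OF y z0] cinner_commute_zero by blast
      finally show "cinner u (G \<omega> (A y)) = cinner u (A y)"
        by (simp add: cinner_diff_left orth_proj_swap[OF Gp[OF B]])
    qed
    have "G \<omega> (A x) = G \<omega> (A (G \<omega> x)) + G \<omega> (A (x - G \<omega> x))"
      by (simp add: clin_add[OF cG, symmetric] clin_add[OF clin, symmetric])
    then show ?thesis using 1[OF z0] 2[OF orth_proj_idem[OF Gp[OF B]]] by simp
  qed
  have Giic: "G {..l} = Q l" for l
  proof (rule Q_unique)
    fix x
    assume x: "G {..l} x = x"
    have "AE t in \<nu> x. t \<le> l"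
    proof (rule AE_I)
      show "emeasure (\<nu> x) (UNIV - {..l}) = 0" using Gc[of "{..l}" x] x by (simp add: em)
    qed auto
    then have "(\<integral>t. t \<partial>\<nu> x) \<le> (\<integral>t. l \<partial>\<nu> x)"
      by (intro integral_mono_AE int(1) finite_measure.integrable_const[OF fin])
    then show "Re (cinner x (A x)) \<le> l * (norm x)\<^sup>2" by (simp add: int(2) m GU mult.commute)
  next
    fix x assume x: "G {..l} x = 0" "x \<noteq> 0"
    have AE: "AE t in \<nu> x. l < t"
    proof (rule AE_I)
      show "emeasure (\<nu> x) {..l} = 0" using x by (simp add: em)
    qed auto
    have i: "integrable (\<nu> x) (\<lambda>t. t - l)"
      by (intro Bochner_Integration.integrable_diff int(1) finite_measure.integrable_const[OF fin])
    have I: "(\<integral>t. t - l \<partial>\<nu> x) = Re (cinner x (A x)) - l * (norm x)\<^sup>2"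
      by (subst Bochner_Integration.integral_diff)
         (use int(1) finite_measure.integrable_const[OF fin] in \<open>auto simp: int(2) m GU\<close>)
    have nn: "AE t in \<nu> x. 0 \<le> t - l" using AE by eventually_elim auto
    then have "0 \<le> (\<integral>t. t - l \<partial>\<nu> x)" by (rule integral_nonneg_AE)
    \<comment> \<open>A strictly positive integrand with integral zero would leave the measure no
      mass, although its total mass is \<open>||x||^2\<close>.\<close>
    moreover have "(\<integral>t. t - l \<partial>\<nu> x) \<noteq> 0"
    proof
      assume "(\<integral>t. t - l \<partial>\<nu> x) = 0"
      then have "AE t in \<nu> x. t - l = 0" using integral_nonneg_eq_0_iff_AE[OF i nn] by simp
      with AE have "AE t in \<nu> x. False" by eventually_elim auto
      then obtain N where "UNIV \<subseteq> N" "emeasure (\<nu> x) N = 0" by (elim AE_E) auto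
      then have "emeasure (\<nu> x) UNIV = 0" by (simp add: top.extremum_unique)
      then show False using x by (simp add: em GU)
    qed
    ultimately show "l * (norm x)\<^sup>2 < Re (cinner x (A x))" using I by simp
  qed (auto intro: Gp GA)
  have eq: "\<nu> x = \<mu> x" for x
  proof (rule measure_eqI_generator_eq[OF Int_stable_atMost, where \<Omega> = UNIV and A = "\<lambda>n. {..real n}"])
    fix X :: "real set" assume "X \<in> range atMost"
    then show "emeasure (\<nu> x) X = emeasure (\<mu> x) X"
      by (auto simp: em emeasure_\<mu>_Iic Giic F_def)
  qed (auto simp: sets_borel_atMost em real_arch_simple)
  show ?thesis
  proof
    fix \<omega>
    show "G \<omega> = E \<omega>"
    proof (cases "\<omega> \<in> sets borel")
      case True
      then show ?thesis
        by (intro E_eqI[symmetric] Gp) (auto simp: eq[symmetric] m)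
    next
      case False
      then show ?thesis using G by (simp add: E_def spectral_measure_of_def)
    qed
  qed
qed

text \<open>The spectral projection of \<open>]l, \<infinity>[\<close>, which for
  \<open>l \<le> 1\<close> is that of \<open>]l, 1]\<close> because \<open>A\<close> is a
  contraction.\<close>

definition P :: "real \<Rightarrow> 'a \<Rightarrow> 'a" where "P l x = x - Q l x"

lemma spec_subspace_eq: assumes "l \<le> 1" shows "spec_subspace A {l<..1} = range (P l)"
proof -
  have "(THE E. spectral_measure_of A E) = E"
    using spectral_measure_E spectral_measure_unique by (rule the_equality)
  then have "spec_subspace A {l<..1} = range (E {l<..1})" by (simp add: spec_subspace_def)
  also have "E {l<..1} = P l" using assms by (auto simp: E_Ioc P_def Q_one)
  finally show ?thesis .
qed

end

section \<open>Orthonormal bases and Hilbert space dimension\<close>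

lemma csubspace_sum:
  "csubspace M \<Longrightarrow> (\<And>i. i \<in> I \<Longrightarrow> f i \<in> M) \<Longrightarrow> (\<Sum>i\<in>I. f i) \<in> M"
  by (induction I rule: infinite_finite_induct) (auto simp: csubspace_0 csubspace_add)

lemma csubspace_cspan: "csubspace (cspan B)"
proof -
  have "x + y \<in> cspan B" if x: "x \<in> cspan B" and y: "y \<in> cspan B" for x y
  proof -
    obtain F c where F: "finite F" "F \<subseteq> B" "x = (\<Sum>v\<in>F. scaleC (c v) v)"
      using x by (auto simp: cspan_def)
    obtain G d where G: "finite G" "G \<subseteq> B" "y = (\<Sum>v\<in>G. scaleC (d v) v)"
      using y by (auto simp: cspan_def)
    have "x = (\<Sum>v\<in>F \<union> G. scaleC (if v \<in> F then c v else 0) v)"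
      unfolding F(3) using F G by (intro sum.mono_neutral_cong_left) auto
    moreover have "y = (\<Sum>v\<in>F \<union> G. scaleC (if v \<in> G then d v else 0) v)"
      unfolding G(3) using F G by (intro sum.mono_neutral_cong_left) auto
    ultimately have "x + y = (\<Sum>v\<in>F \<union> G. scaleC ((if v \<in> F then c v else 0) + (if v \<in> G then d v else 0)) v)"
      by (simp only: scaleC_add_left sum.distrib)
    then show ?thesis
      unfolding cspan_def using F G
      by (intro CollectI exI[of _ "F \<union> G"] exI[of _ "\<lambda>v. (if v \<in> F then c v else 0) + (if v \<in> G then d v else 0)"]) simp
  qed
  moreover have "scaleC a x \<in> cspan B" if x: "x \<in> cspan B" for a x
  proof -
    obtain F c where F: "finite F" "F \<subseteq> B" "x = (\<Sum>v\<in>F. scaleC (c v) v)"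
      using x by (auto simp: cspan_def)
    then have "scaleC a x = (\<Sum>v\<in>F. scaleC (a * c v) v)" by (simp add: scaleC_sum_right scaleC_scaleC)
    then show ?thesis using F unfolding cspan_def
      by (intro CollectI exI[of _ F] exI[of _ "\<lambda>v. a * c v"]) simp
  qed
  moreover have "0 \<in> cspan B"
    unfolding cspan_def by (intro CollectI exI[of _ "{}"]) simp
  ultimately show ?thesis by (auto simp: csubspace_def)
qed

lemma cspan_base: "b \<in> B \<Longrightarrow> b \<in> cspan B"
  unfolding cspan_def by (intro CollectI exI[of _ "{b}"] exI[of _ "\<lambda>_. 1"]) (simp add: scaleC_one)

lemma cspan_sumI: "finite F \<Longrightarrow> F \<subseteq> B \<Longrightarrow> (\<Sum>v\<in>F. scaleC (c v) v) \<in> cspan B"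
  unfolding cspan_def by blast

lemma cspan_subset: "csubspace M \<Longrightarrow> B \<subseteq> M \<Longrightarrow> cspan B \<subseteq> M"
  unfolding cspan_def by (auto intro!: csubspace_sum csubspace_scaleC)

lemma cspan_orth: "x \<in> cspan B \<Longrightarrow> (\<And>b. b \<in> B \<Longrightarrow> cinner b y = 0) \<Longrightarrow> cinner x y = 0"
  unfolding cspan_def by (auto simp: cinner_sum_left cinner_scaleC_left subset_iff intro!: sum.neutral)

lemma csubspace_closure:
  assumes "csubspace M" shows "csubspace (closure M)"
  unfolding csubspace_def
proof (intro conjI ballI allI)
  show "0 \<in> closure M" using csubspace_0[OF assms] closure_subset by blast
next
  fix x y assume "x \<in> closure M" "y \<in> closure M"
  then obtain f g where f: "\<And>n. f n \<in> M" "f \<longlonglongrightarrow> x" and g: "\<And>n. g n \<in> M" "g \<longlonglongrightarrow> y"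
    by (auto simp: closure_sequential)
  have "(\<lambda>n. f n + g n) \<longlonglongrightarrow> x + y" by (intro tendsto_add f g)
  moreover have "f n + g n \<in> M" for n using csubspace_add[OF assms f(1) g(1)] .
  ultimately show "x + y \<in> closure M" unfolding closure_sequential by (intro exI[of _ "\<lambda>n. f n + g n"]) blast
next
  fix x c assume "x \<in> closure M"
  then obtain f where f: "\<And>n. f n \<in> M" "f \<longlonglongrightarrow> x" by (auto simp: closure_sequential)
  have "(\<lambda>n. scaleC c (f n)) \<longlonglongrightarrow> scaleC c x"
    by (rule clin_tendsto[OF bounded_clin_scaleC[OF bounded_clin_id(1)] f(2)])
  moreover have "scaleC c (f n) \<in> M" for n using csubspace_scaleC[OF assms f(1)] .
  ultimately show "scaleC c x \<in> closure M" unfolding closure_sequential by (intro exI[of _ "\<lambda>n. scaleC c (f n)"]) blast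
qed

lemma closed_orth: "closed {x. cinner x (y::'a::complex_inner) = 0}"
proof -
  have "{x. cinner x y = 0} = {x. cinner y x = 0}" using cinner_commute_zero by blast
  then show ?thesis
    using continuous_closed_preimage_constant[of UNIV "cinner y" 0]
    by (simp add: linear_continuous_on[OF bounded_linear_cinner_right])
qed

definition orthonormal :: "'a::complex_inner set \<Rightarrow> bool" where
  "orthonormal B \<longleftrightarrow> (\<forall>x\<in>B. norm x = 1) \<and> (\<forall>x\<in>B. \<forall>y\<in>B. x \<noteq> y \<longrightarrow> cinner x y = 0)"

lemma orthonormal_subset: "orthonormal B \<Longrightarrow> C \<subseteq> B \<Longrightarrow> orthonormal C"
  by (simp add: orthonormal_def subset_iff)

lemma orthonormal_cinner: "orthonormal B \<Longrightarrow> b \<in> B \<Longrightarrow> c \<in> B \<Longrightarrow> cinner b c = (if b = c then 1 else 0)"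
  unfolding orthonormal_def by (auto simp: cinner_self)

lemma orthonormal_nonzero: "orthonormal B \<Longrightarrow> b \<in> B \<Longrightarrow> b \<noteq> 0"
  unfolding orthonormal_def by force

lemma is_onb_iff: "is_onb M B \<longleftrightarrow> B \<subseteq> M \<and> orthonormal B \<and> closure (cspan B) = M"
  by (simp only: is_onb_def orthonormal_def conj_assoc)

lemma is_onb_orthonormal: "is_onb M B \<Longrightarrow> orthonormal B"
  by (simp add: is_onb_iff)

lemma is_onb_closed: "is_onb M B \<Longrightarrow> csubspace M" "is_onb M B \<Longrightarrow> closed M"
  unfolding is_onb_def using csubspace_closure[OF csubspace_cspan] closed_closure by metis+

lemma onb_orth_closure:
  assumes "is_onb M B" "m \<in> M" "\<And>b. b \<in> B \<Longrightarrow> cinner b y = 0" shows "cinner m y = 0"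
proof -
  have "closure (cspan B) \<subseteq> {x. cinner x y = 0}"
    using cspan_orth[of _ B y] assms(3) by (intro closure_minimal closed_orth) blast
  then show ?thesis using assms(1,2) by (auto simp: is_onb_def)
qed

lemma onb_orth_zero:
  assumes "is_onb M B" "x \<in> M" "\<And>b. b \<in> B \<Longrightarrow> cinner b x = 0" shows "x = 0"
  using onb_orth_closure[OF assms] by (simp only: cinner_eq_zero_iff)

text \<open>Projecting \<open>x\<close> onto the closed span of \<open>B\<close> leaves a remainder
  in \<open>M\<close> that is orthogonal to \<open>B\<close>.\<close>

lemma is_onbI:
  assumes M: "csubspace M" "closed (M::'a::chilbert set)" and B: "B \<subseteq> M" "orthonormal B"
    and tot: "\<And>x. x \<in> M \<Longrightarrow> (\<And>b. b \<in> B \<Longrightarrow> cinner b x = 0) \<Longrightarrow> x = 0"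
  shows "is_onb M B"
proof -
  let ?N = "closure (cspan B)"
  have N: "csubspace ?N" "closed ?N" by (auto intro: csubspace_closure csubspace_cspan)
  have NM: "?N \<subseteq> M" using cspan_subset[OF M(1) B(1)] M(2) by (rule closure_minimal)
  moreover have "x \<in> ?N" if x: "x \<in> M" for x
  proof -
    have "x - proj ?N x = 0"
    proof (rule tot)
      show "x - proj ?N x \<in> M" using x NM proj_in[OF N] by (intro csubspace_diff M) auto
      fix b assume "b \<in> B"
      then have "b \<in> ?N" using cspan_base closure_subset by blast
      then show "cinner b (x - proj ?N x) = 0" by (rule proj_orth[OF N])
    qed
    then show ?thesis using proj_in[OF N, of x] by simp
  qed
  ultimately show ?thesis using B by (auto simp: is_onb_iff)
qed

lemma onb_extend:
  assumes M: "csubspace M" "closed (M::'a::chilbert set)" and C: "C \<subseteq> M" "orthonormal C"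
  shows "\<exists>B. is_onb M B \<and> C \<subseteq> B"
proof -
  let ?A = "{B. C \<subseteq> B \<and> B \<subseteq> M \<and> orthonormal B}"
  have "\<exists>B\<in>?A. \<forall>X\<in>?A. B \<subseteq> X \<longrightarrow> X = B"
  proof (rule subset_Zorn_nonempty)
    show "?A \<noteq> {}" using C by blast
    fix Ch assume Ch: "Ch \<noteq> {}" "subset.chain ?A Ch"
    have "orthonormal (\<Union>Ch)"
      unfolding orthonormal_def
    proof (intro conjI ballI impI)
      fix x assume "x \<in> \<Union>Ch"
      then show "norm x = 1" using Ch(2) by (auto simp: subset.chain_def orthonormal_def)
    next
      fix x y assume "x \<in> \<Union>Ch" "y \<in> \<Union>Ch" and xy: "x \<noteq> y"
      then obtain X Y where XY: "x \<in> X" "X \<in> Ch" "y \<in> Y" "Y \<in> Ch" by blast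
      then have "X \<subseteq> Y \<or> Y \<subseteq> X" using Ch(2) by (auto simp: subset_chain_def)
      then obtain Z where "x \<in> Z" "y \<in> Z" "Z \<in> Ch" using XY by blast
      then show "cinner x y = 0" using Ch(2) xy by (auto simp: subset_chain_def orthonormal_def)
    qed
    then show "\<Union>Ch \<in> ?A" using Ch by (auto simp: subset_chain_def)
  qed
  then obtain B where B': "B \<in> ?A" and max': "\<forall>X\<in>?A. B \<subseteq> X \<longrightarrow> X = B" ..
  from B' have B: "C \<subseteq> B" "B \<subseteq> M" "orthonormal B" by simp_all
  have max: "X = B" if "C \<subseteq> X" "X \<subseteq> M" "orthonormal X" "B \<subseteq> X" for X
    using max' that by simp
  have "is_onb M B"
  proof (rule is_onbI[OF M B(2,3)], rule ccontr)
    fix x assume x: "x \<in> M" "\<And>b. b \<in> B \<Longrightarrow> cinner b x = 0" "x \<noteq> 0"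
    let ?u = "scaleC (of_real (1 / norm x)) x"
    have u: "norm ?u = 1" using x(3) by (simp add: norm_scaleC norm_divide)
    have bu: "cinner b ?u = 0" "cinner ?u b = 0" if "b \<in> B" for b
      using x(2)[OF that] cinner_commute_zero[of b x] by (simp_all add: cinner_algebra)
    have "insert ?u B = B"
    proof (rule max)
      show "orthonormal (insert ?u B)" using B(3) u bu unfolding orthonormal_def by auto
    qed (use B x M csubspace_scaleC in auto)
    then have "cinner ?u ?u = 0" using bu by blast
    then show False using u by simp
  qed
  then show ?thesis using B by blast
qed

lemma onb_exists:
  assumes "csubspace M" "closed (M::'a::chilbert set)" shows "\<exists>B. is_onb M B"
proof -
  have "orthonormal ({} :: 'a set)" by (simp add: orthonormal_def)
  from onb_extend[OF assms empty_subsetI this] show ?thesis by blast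
qed

lemma norm_sum_orthonormal:
  assumes "finite F" "orthonormal (f ` F)" "inj_on f F"
  shows "(norm (\<Sum>v\<in>F. scaleC (c v) (f v)))\<^sup>2 = (\<Sum>v\<in>F. (cmod (c v))\<^sup>2)"
proof -
  have "cinner (\<Sum>v\<in>F. scaleC (c v) (f v)) (\<Sum>v\<in>F. scaleC (c v) (f v))
      = (\<Sum>v\<in>F. \<Sum>w\<in>F. cnj (c v) * (c w * cinner (f v) (f w)))"
    unfolding cinner_sum_left cinner_scaleC_left
    unfolding cinner_sum_right cinner_scaleC_right sum_distrib_left ..
  also have "\<dots> = (\<Sum>v\<in>F. \<Sum>w\<in>F. if v = w then cnj (c v) * c w else 0)"
    by (intro sum.cong refl) (use assms in \<open>auto simp: orthonormal_cinner inj_on_eq_iff\<close>)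
  also have "\<dots> = (\<Sum>v\<in>F. cnj (c v) * c v)" using assms(1) by simp
  also have "\<dots> = complex_of_real (\<Sum>v\<in>F. (cmod (c v))\<^sup>2)"
    by (simp only: of_real_sum complex_norm_square mult.commute)
  finally show ?thesis unfolding cinner_self of_real_eq_iff .
qed

lemma cinner_sum_orthonormal:
  assumes "finite F" "orthonormal F" "b \<in> F"
  shows "cinner b (\<Sum>v\<in>F. scaleC (c v) v) = c b"
proof -
  have "cinner b (\<Sum>v\<in>F. scaleC (c v) v) = (\<Sum>v\<in>F. if b = v then c v else 0)"
    unfolding cinner_sum_right cinner_scaleC_right
    by (intro sum.cong refl) (use assms in \<open>auto simp: orthonormal_cinner\<close>)
  then show ?thesis using assms by simp
qed

lemma bessel:
  assumes "finite F" "orthonormal F"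
  shows "(\<Sum>b\<in>F. (cmod (cinner b g))\<^sup>2) \<le> (norm g)\<^sup>2"
proof -
  define s where "s = (\<Sum>b\<in>F. (cmod (cinner b g))\<^sup>2)"
  define y where "y = (\<Sum>b\<in>F. scaleC (cinner b g) b)"
  have "(norm y)\<^sup>2 = s"
    unfolding y_def s_def using norm_sum_orthonormal[of F "\<lambda>x. x"] assms by simp
  moreover have "cinner y g = complex_of_real s"
    unfolding y_def s_def cinner_sum_left cinner_scaleC_left of_real_sum
    by (intro sum.cong refl) (simp only: complex_norm_square mult.commute)
  moreover have "0 \<le> (norm (g - y))\<^sup>2" by simp
  ultimately show ?thesis
    by (simp add: norm_diff_sq Re_cinner_commute[of g y] s_def)
qed

text \<open>By Bessel only finitely many coefficients exceed a given size. This is why infinitely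
  many orthogonality conditions can be met at the cost of only as many basis vectors.\<close>

lemma countable_support:
  assumes "orthonormal B" shows "countable {b \<in> B. cinner b g \<noteq> 0}"
proof -
  define S where "S n = {b \<in> B. (cmod (cinner b g))\<^sup>2 > 1 / (real n + 1)}" for n
  have fin: "finite (S n)" for n
  proof (rule ccontr)
    assume "infinite (S n)"
    obtain k :: nat where k: "(norm g)\<^sup>2 * (real n + 1) < real k" using reals_Archimedean2 by blast
    obtain F where F: "F \<subseteq> S n" "finite F" "card F = k"
      using infinite_arbitrarily_large[OF \<open>infinite (S n)\<close>] by blast
    have "real k * (1 / (real n + 1)) = (\<Sum>b\<in>F. 1 / (real n + 1))" using F by simp
    also have "\<dots> \<le> (\<Sum>b\<in>F. (cmod (cinner b g))\<^sup>2)"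
      using F by (intro sum_mono) (auto simp: S_def intro: less_imp_le)
    also have "\<dots> \<le> (norm g)\<^sup>2"
      using F assms by (intro bessel orthonormal_subset[OF assms]) (auto simp: S_def)
    finally show False using k by (simp add: field_simps)
  qed
  have "b \<in> (\<Union>n. S n)" if "b \<in> B" "cinner b g \<noteq> 0" for b
  proof -
    have "(cmod (cinner b g))\<^sup>2 > 0" using that by simp
    then obtain n where "inverse (real (Suc n)) < (cmod (cinner b g))\<^sup>2" using reals_Archimedean by blast
    then show ?thesis using that by (auto simp: S_def inverse_eq_divide add.commute)
  qed
  then have "{b \<in> B. cinner b g \<noteq> 0} \<subseteq> (\<Union>n. S n)" by blast
  moreover have "countable (\<Union>n. S n)" using fin by (auto intro: countable_finite)
  ultimately show ?thesis by (rule countable_subset)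
qed

section \<open>Comparing the sizes of orthonormal systems\<close>

lemma homogeneous_system:
  fixes m :: "'g \<Rightarrow> 'b \<Rightarrow> complex"
  assumes "finite G" "finite B" "card G < card B"
  shows "\<exists>c. (\<exists>b\<in>B. c b \<noteq> 0) \<and> (\<forall>g\<in>G. (\<Sum>b\<in>B. c b * m g b) = 0)"
  using assms
proof (induction G arbitrary: B m rule: finite_induct)
  case empty
  then obtain b where "b \<in> B" by fastforce
  then show ?case by (intro exI[of _ "\<lambda>_. 1"]) auto
next
  case (insert g G)
  show ?case
  proof (cases "\<forall>b\<in>B. m g b = 0")
    case True
    then show ?thesis using insert.IH[of B m] insert.prems insert.hyps by auto
  next
    case False
    then obtain b0 where b0: "b0 \<in> B" "m g b0 \<noteq> 0" by blast
    let ?B = "B - {b0}"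
    \<comment> \<open>Gaussian elimination: the equation of \<open>g\<close> is solved for the
      unknown at \<open>b0\<close>, and \<open>m'\<close> is the system left for the others.\<close>
    define m' where "m' h b = m h b - m h b0 * m g b / m g b0" for h b
    have "card G < card ?B" using insert b0 by simp
    then obtain c where c: "\<exists>b\<in>?B. c b \<noteq> 0" "\<forall>h\<in>G. (\<Sum>b\<in>?B. c b * m' h b) = 0"
      using insert.IH[of ?B m'] insert.prems by auto
    define c' where "c' = c(b0 := - (\<Sum>b\<in>?B. c b * m g b) / m g b0)"
    have split: "(\<Sum>b\<in>B. c' b * m h b) = - (\<Sum>b\<in>?B. c b * m g b) / m g b0 * m h b0 + (\<Sum>b\<in>?B. c b * m h b)" for h
      using insert.prems(1) b0 by (subst sum.remove[of _ b0]) (auto simp: c'_def)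
    have "(\<Sum>b\<in>B. c' b * m h b) = 0" if "h \<in> insert g G" for h
    proof (cases "h = g")
      case True
      then show ?thesis using b0 by (simp add: split)
    next
      case False
      then have "(\<Sum>b\<in>?B. c b * m' h b) = 0" using that c by auto
      moreover have "(\<Sum>b\<in>?B. c b * m' h b) = (\<Sum>b\<in>?B. c b * m h b) - (\<Sum>b\<in>?B. c b * m g b) * (m h b0 / m g b0)"
        unfolding sum_distrib_right sum_subtractf[symmetric] by (intro sum.cong) (auto simp: m'_def algebra_simps)
      ultimately show ?thesis by (simp add: split)
    qed
    moreover have "\<exists>b\<in>B. c' b \<noteq> 0" using c(1) by (auto simp: c'_def)
    ultimately show ?thesis by blast
  qed
qed

lemma card_le_if_ordLeq: assumes "ordLeq2 (card_of A) (card_of B)" "finite B" shows "card A \<le> card B"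
proof -
  obtain f where "inj_on f A" "f ` A \<subseteq> B" using assms(1) unfolding card_of_ordLeq[symmetric] by blast
  then show ?thesis using card_inj_on_le assms(2) by blast
qed
lemma card_less_if_ordLess:
  assumes "ordLess2 (card_of A) (card_of B)" "finite A" "finite B" shows "card A < card B"
proof (rule ccontr)
  assume "\<not> ?thesis"
  then obtain f where "inj_on f B" "f ` B \<subseteq> A" using inj_on_iff_card_le[OF assms(3,2)] by auto
  then have "ordLeq2 (card_of B) (card_of A)" unfolding card_of_ordLeq[symmetric] by blast
  then show False using assms(1) not_ordLess_ordLeq by blast
qed

text \<open>Fewer conditions than orthonormal vectors: for finitely many conditions this is linear
  algebra, for infinitely many each one involves only countably many basis vectors.\<close>
lemma orthogonal_vector_exists:
  assumes B: "orthonormal B" and less: "ordLess2 (card_of (G :: 'a set)) (card_of (B :: 'a::complex_inner set))"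
  shows "\<exists>x\<in>cspan B. x \<noteq> 0 \<and> (\<forall>g\<in>G. cinner g x = 0)"
proof (cases "finite G")
  case False
  let ?S = "\<lambda>g. {b \<in> B. cinner b g \<noteq> 0}"
  have "ordLeq2 (card_of (?S g)) (card_of G)" for g
  proof -
    have "ordLeq2 (card_of (?S g)) (card_of (UNIV :: nat set))"
      using countable_support[OF B, of g] by (auto simp: countable_def card_of_ordLeq[symmetric])
    then show ?thesis
      using False infinite_iff_card_of_nat ordLeq_transitive by blast
  qed
  then have "ordLeq2 (card_of (\<Union>g\<in>G. ?S g)) (card_of G)"
    using False by (intro card_of_UNION_ordLeq_infinite card_of_mono1 order_refl) auto
  then have "ordLess2 (card_of (\<Union>g\<in>G. ?S g)) (card_of B)" using less ordLeq_ordLess_trans by blast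
  then have "\<not> B \<subseteq> (\<Union>g\<in>G. ?S g)"
    using card_of_mono1 not_ordLess_ordLeq by blast
  then obtain b where b: "b \<in> B" "\<forall>g\<in>G. cinner b g = 0" by blast
  then show ?thesis using cspan_base[OF b(1)] orthonormal_nonzero[OF B b(1)] cinner_commute_zero by blast
next
  case True
  \<comment> \<open>One vector more than there are conditions suffices, also if \<open>B\<close> is
    infinite.\<close>
  have "\<exists>F\<subseteq>B. finite F \<and> card F = Suc (card G)"
  proof (cases "finite B")
    case True
    then have "card G < card B"
      using less \<open>finite G\<close> by (intro card_less_if_ordLess)
    then show ?thesis by (metis Suc_leI obtain_subset_with_card_n)
  next
    case False
    then show ?thesis using infinite_arbitrarily_large[of B] by blast
  qed
  then obtain F where F: "F \<subseteq> B" "finite F" "card F = Suc (card G)" by blast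
  obtain c where c: "\<exists>b\<in>F. c b \<noteq> 0" "\<forall>g\<in>G. (\<Sum>b\<in>F. c b * cinner g b) = 0"
    using homogeneous_system[of G F "\<lambda>g b. cinner g b"] True F by auto
  define x where "x = (\<Sum>b\<in>F. scaleC (c b) b)"
  have "x \<noteq> 0"
    using c(1) cinner_sum_orthonormal[OF F(2) orthonormal_subset[OF B F(1)], of _ c]
    unfolding x_def by (metis cinner_zero_right)
  moreover have "\<forall>g\<in>G. cinner g x = 0"
    using c(2) by (simp add: x_def cinner_sum_right cinner_scaleC_right)
  ultimately show ?thesis using cspan_sumI[OF F(2,1)] x_def by blast
qed

text \<open>If \<open>C\<close> were smaller than \<open>B\<close>, some nonzero vector of the span
  of \<open>B\<close> would be orthogonal to all of \<open>C\<close>, although it lies in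
  \<open>N\<close>. Applied both ways with \<open>M = N\<close>, this makes the choice of the basis
  in \<open>hdim\<close> immaterial.\<close>

lemma onb_card_mono:
  assumes M: "is_onb M B" and N: "is_onb N C" and MN: "M \<subseteq> N"
  shows "ordLeq2 (card_of B) (card_of (C :: 'a::complex_inner set))"
proof (rule ccontr)
  assume "\<not> ?thesis"
  then have "ordLess2 (card_of C) (card_of B)"
    using not_ordLeq_iff_ordLess[OF card_of_Well_order card_of_Well_order] by blast
  from orthogonal_vector_exists[OF is_onb_orthonormal[OF M] this]
  obtain x where x: "x \<in> cspan B" "x \<noteq> 0" "\<forall>g\<in>C. cinner g x = 0" by blast
  have "x \<in> N" using x(1) cspan_subset[OF is_onb_closed(1)[OF M]] M MN by (auto simp: is_onb_def)
  then show False using onb_orth_zero[OF N] x by blast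
qed

lemma hdim_onb:
  assumes "is_onb M B" shows "ordIso2 (hdim M) (card_of B)"
proof -
  have "is_onb M (SOME B. is_onb M B)" using assms by (rule someI)
  then show ?thesis
    unfolding hdim_def ordIso_iff_ordLeq using onb_card_mono assms by blast
qed

lemma hdim_Well_order: "Well_order (hdim M)" and hdim_Card_order: "Card_order (hdim M)"
  unfolding hdim_def by (rule card_of_Well_order, rule card_of_Card_order)

lemma hdim_mono:
  assumes M: "csubspace M" "closed (M::'a::chilbert set)" and N: "csubspace N" "closed N" and "M \<subseteq> N"
  shows "ordLeq2 (hdim M) (hdim N)"
proof -
  obtain B C where "is_onb M B" "is_onb N C" using onb_exists M N by metis
  then show ?thesis
    using onb_card_mono[of M B N C] hdim_onb[of M B] hdim_onb[of N C] assms(5)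
    by (meson ordIso_ordLeq_trans ordIso_symmetric ordLeq_ordIso_trans)
qed

text \<open>Extending \<open>B\<close> to a basis of \<open>N\<close> cannot add a vector, since
  that basis has at most as many elements as \<open>C\<close>, hence as \<open>B\<close>.\<close>

lemma onb_finite_eq:
  assumes M: "is_onb M B" and N: "is_onb N (C::'a::chilbert set)" and MN: "M \<subseteq> N"
    and fin: "finite C" and leq: "ordLeq2 (card_of C) (card_of B)"
  shows "M = N"
proof -
  have "B \<subseteq> M" using M unfolding is_onb_iff by (rule conjunct1)
  then have "B \<subseteq> N" using MN by (rule order_trans)
  then obtain D where D: "is_onb N D" "B \<subseteq> D"
    using onb_extend[OF is_onb_closed[OF N] _ is_onb_orthonormal[OF M]] by blast
  have "ordLeq2 (card_of D) (card_of C)" by (rule onb_card_mono[OF D(1) N order_refl])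
  then have "finite D" "ordLeq2 (card_of D) (card_of B)"
    using fin leq card_of_ordLeq_finite ordLeq_transitive by blast+
  then have "B = D" using D(2) 
    using \<open>finite D\<close> card_le_if_ordLeq[of D B] finite_subset[of B D] card_seteq[of D B] by blast
  then show ?thesis using M D(1) by (simp add: is_onb_def)
qed

section \<open>Spans of finite orthonormal sets\<close>

lemma cspan_finite_expand:
  assumes "finite B" "orthonormal B" "x \<in> cspan B"
  shows "x = (\<Sum>b\<in>B. scaleC (cinner b x) b)"
proof -
  obtain F c where F: "finite F" "F \<subseteq> B" "x = (\<Sum>v\<in>F. scaleC (c v) v)"
    using assms(3) by (auto simp: cspan_def)
  have x: "x = (\<Sum>v\<in>B. scaleC (if v \<in> F then c v else 0) v)"
    unfolding F(3) using F assms by (intro sum.mono_neutral_cong_left) auto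
  have "cinner b x = (if b \<in> F then c b else 0)" if "b \<in> B" for b
    by (subst x) (rule cinner_sum_orthonormal[OF assms(1,2) that])
  then have "(\<Sum>b\<in>B. scaleC (cinner b x) b) = (\<Sum>v\<in>B. scaleC (if v \<in> F then c v else 0) v)"
    by (intro sum.cong) auto
  then show ?thesis using x by simp
qed

text \<open>The span consists of the fixed points of the finite Fourier expansion; this map is
  continuous, so the closure adds nothing.\<close>

lemma onb_finite_cspan:
  assumes "is_onb M B" "finite B" shows "M = cspan B"
proof -
  have B: "orthonormal B" using assms by (simp add: is_onb_iff)
  have "closed {x. (\<Sum>b\<in>B. scaleC (cinner b x) b) = x}"
  proof (rule closed_Collect_eq)
    show "continuous_on UNIV (\<lambda>x. \<Sum>b\<in>B. scaleC (cinner b x) b)"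
    proof (intro continuous_on_sum)
      fix b
      have "bounded_linear (\<lambda>x. scaleC (cinner b x) b)"
      proof (rule bounded_linear_intro[where K = "norm b * norm b"])
        show "norm (scaleC (cinner b x) b) \<le> norm x * (norm b * norm b)" for x
          using mult_right_mono[OF cauchy_schwarz[of b x] norm_ge_zero[of b]]
          by (simp add: norm_scaleC algebra_simps)
      qed (simp_all add: cinner_add_right scaleC_add_left scaleR_scaleC cinner_scaleC_right scaleC_scaleC)
      then show "continuous_on UNIV (\<lambda>x. scaleC (cinner b x) b)" by (rule linear_continuous_on)
    qed
  qed (rule continuous_on_id)
  then have "closure (cspan B) \<subseteq> {x. (\<Sum>b\<in>B. scaleC (cinner b x) b) = x}"
    using cspan_finite_expand[OF assms(2) B] by (intro closure_minimal) auto
  moreover have "x \<in> cspan B" if "(\<Sum>b\<in>B. scaleC (cinner b x) b) = x" for x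
    using cspan_sumI[OF assms(2) order_refl, of "\<lambda>b. cinner b x"] that by simp
  ultimately have "closure (cspan B) = cspan B" using closure_subset by blast
  then show ?thesis using assms(1) by (simp add: is_onb_def)
qed

lemma bounded_coefficients_convergent:
  fixes x :: "nat \<Rightarrow> 'a::complex_inner"
  assumes "finite B" and bd: "\<And>n. norm (x n) \<le> 1"
  shows "\<exists>r. strict_mono r \<and> (\<forall>b\<in>B. convergent (\<lambda>n. cinner b (x (r n))))"
  using assms(1)
proof (induction B rule: finite_induct)
  case empty
  then show ?case by (intro exI[of _ id]) (auto simp: strict_mono_def)
next
  case (insert b B)
  then obtain r where r: "strict_mono (r :: nat \<Rightarrow> nat)" "\<forall>b\<in>B. convergent (\<lambda>n. cinner b (x (r n)))" by blast
  have "bounded (range (\<lambda>n. cinner b (x (r n))))"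
  proof (rule boundedI)
    fix z assume "z \<in> range (\<lambda>n. cinner b (x (r n)))"
    then obtain n where "z = cinner b (x (r n))" by blast
    then have "norm z \<le> norm b * norm (x (r n))" using cauchy_schwarz by blast
    also have "\<dots> \<le> norm b * 1" by (intro mult_left_mono bd) simp
    finally show "norm z \<le> norm b" by simp
  qed
  then obtain l s where s: "strict_mono (s :: nat \<Rightarrow> nat)" "((\<lambda>n. cinner b (x (r n))) \<circ> s) \<longlonglongrightarrow> l"
    using bounded_imp_convergent_subsequence by blast
  have "convergent (\<lambda>n. cinner c (x ((r \<circ> s) n)))" if c: "c \<in> insert b B" for c
  proof (cases "c = b")
    case True
    then show ?thesis using s(2) by (auto simp: convergent_def comp_def)
  next
    case False
    then have "convergent (\<lambda>n. cinner c (x (r n)))" using c r by blast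
    from convergent_subseq_convergent[OF this s(1)] show ?thesis by (simp add: comp_def)
  qed
  then show ?case using strict_mono_o[OF r(1) s(1)] by blast
qed

text \<open>Once the finitely many coefficients converge along a subsequence, so do the vectors in
  norm. Needed where counting conditions fails because a spectral subspace is
  finite-dimensional.\<close>

lemma cspan_finite_compact:
  fixes x :: "nat \<Rightarrow> 'a::complex_inner"
  assumes B: "finite B" "orthonormal B" and x: "\<And>n. x n \<in> cspan B" "\<And>n. norm (x n) \<le> 1"
  shows "\<exists>r y. strict_mono r \<and> y \<in> cspan B \<and> (\<lambda>n. x (r n)) \<longlonglongrightarrow> y"
proof -
  obtain r where r: "strict_mono (r :: nat \<Rightarrow> nat)" "\<forall>b\<in>B. convergent (\<lambda>n. cinner b (x (r n)))"
    using bounded_coefficients_convergent[of B x, OF B(1) x(2)] by blast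
  define c where "c b = lim (\<lambda>n. cinner b (x (r n)))" for b
  have "(\<lambda>n. scaleC (cinner b (x (r n))) b) \<longlonglongrightarrow> scaleC (c b) b" if "b \<in> B" for b
  proof -
    have "(\<lambda>n. cinner b (x (r n))) \<longlonglongrightarrow> c b" using r(2) that by (simp add: c_def convergent_LIMSEQ_iff)
    then have "(\<lambda>n. cmod (cinner b (x (r n)) - c b) * norm b) \<longlonglongrightarrow> 0"
      by (intro tendsto_mult_left_zero tendsto_norm_zero) (simp add: LIM_zero_iff)
    then have "(\<lambda>n. norm (scaleC (cinner b (x (r n))) b - scaleC (c b) b)) \<longlonglongrightarrow> 0"
      by (simp add: scaleC_diff_left[symmetric] norm_scaleC)
    then show ?thesis by (rule LIM_zero_cancel[OF tendsto_norm_zero_cancel])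
  qed
  then have "(\<lambda>n. \<Sum>b\<in>B. scaleC (cinner b (x (r n))) b) \<longlonglongrightarrow> (\<Sum>b\<in>B. scaleC (c b) b)"
    by (rule tendsto_sum)
  moreover have "(\<lambda>n. \<Sum>b\<in>B. scaleC (cinner b (x (r n))) b) = (\<lambda>n. x (r n))"
    by (rule ext) (rule cspan_finite_expand[OF B x(1), symmetric])
  moreover define y where "y = (\<Sum>b\<in>B. scaleC (c b) b)"
  ultimately have "(\<lambda>n. x (r n)) \<longlonglongrightarrow> y" by metis
  moreover have "y \<in> cspan B" unfolding y_def by (rule cspan_sumI[OF B(1) order_refl])
  ultimately show ?thesis using r(1) by blast
qed

section \<open>Isometries from injections of bases\<close>

text \<open>Summing over nonzero coefficients only makes the sum finite for \<open>x\<close> in the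
  span of an infinite \<open>B\<close>. If infinitely many coefficients are nonzero the value is the
  default 0, so the map is meaningful on the span and must be extended by continuity.\<close>

definition fourier_map :: "'a set \<Rightarrow> ('a \<Rightarrow> 'a) \<Rightarrow> 'a \<Rightarrow> 'a::complex_inner" where
  "fourier_map B f x = (\<Sum>b\<in>{b \<in> B. cinner b x \<noteq> 0}. scaleC (cinner b x) (f b))"

lemma cspan_support:
  assumes B: "orthonormal B" and x: "x \<in> cspan B"
  shows "finite {b \<in> B. cinner b x \<noteq> 0}"
proof -
  obtain F c where F: "finite F" "F \<subseteq> B" "x = (\<Sum>v\<in>F. scaleC (c v) v)"
    using x by (auto simp: cspan_def)
  have "cinner b x = 0" if "b \<in> B" "b \<notin> F" for b
    unfolding F(3) cinner_sum_right cinner_scaleC_right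
    using that F(2) by (intro sum.neutral) (auto simp: orthonormal_cinner[OF B _ subsetD[OF F(2)]])
  then have "{b \<in> B. cinner b x \<noteq> 0} \<subseteq> F" by blast
  then show ?thesis using F(1) finite_subset by blast
qed

lemma fourier_map_superset:
  assumes "finite F" "{b \<in> B. cinner b x \<noteq> 0} \<subseteq> F" "F \<subseteq> B"
  shows "fourier_map B f x = (\<Sum>b\<in>F. scaleC (cinner b x) (f b))"
  unfolding fourier_map_def using assms by (intro sum.mono_neutral_left) auto

lemma fourier_map_id:
  assumes B: "orthonormal B" and x: "x \<in> cspan B"
  shows "fourier_map B (\<lambda>b. b) x = x"
proof -
  obtain F c where F: "finite F" "F \<subseteq> B" "x = (\<Sum>v\<in>F. scaleC (c v) v)"
    using x by (auto simp: cspan_def)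
  have "x \<in> cspan F" using F cspan_sumI[OF F(1) order_refl] by simp
  have F': "orthonormal F" using B F(2) by (rule orthonormal_subset)
  have "cinner b x = 0" if "b \<in> B" "b \<notin> F" for b
    unfolding F(3) cinner_sum_right cinner_scaleC_right
    using that F(2) by (intro sum.neutral) (auto simp: orthonormal_cinner[OF B _ subsetD[OF F(2)]])
  then have "{b \<in> B. cinner b x \<noteq> 0} \<subseteq> F" by blast
  from fourier_map_superset[OF F(1) this F(2)] show ?thesis
    using cspan_finite_expand[OF F(1) F' \<open>x \<in> cspan F\<close>] by simp
qed

lemma fourier_map_linear:
  assumes B: "orthonormal B" and x: "x \<in> cspan B" and y: "y \<in> cspan B"
  shows "fourier_map B f (x + y) = fourier_map B f x + fourier_map B f y"
    and "fourier_map B f (scaleC a x) = scaleC a (fourier_map B f x)"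
proof -
  let ?F = "{b \<in> B. cinner b x \<noteq> 0} \<union> {b \<in> B. cinner b y \<noteq> 0}"
  have F: "finite ?F" by (simp only: finite_Un cspan_support[OF B x] cspan_support[OF B y] simp_thms)
  have "fourier_map B f (x + y) = (\<Sum>b\<in>?F. scaleC (cinner b (x + y)) (f b))"
    "fourier_map B f x = (\<Sum>b\<in>?F. scaleC (cinner b x) (f b))"
    "fourier_map B f y = (\<Sum>b\<in>?F. scaleC (cinner b y) (f b))"
    by (intro fourier_map_superset[OF F]; auto simp: cinner_add_right)+
  then show "fourier_map B f (x + y) = fourier_map B f x + fourier_map B f y"
    by (simp add: cinner_add_right scaleC_add_left sum.distrib)
  have "fourier_map B f (scaleC a x) = (\<Sum>b\<in>?F. scaleC (cinner b (scaleC a x)) (f b))"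
    "fourier_map B f x = (\<Sum>b\<in>?F. scaleC (cinner b x) (f b))"
    by (intro fourier_map_superset[OF F]; auto simp: cinner_scaleC_right)+
  then show "fourier_map B f (scaleC a x) = scaleC a (fourier_map B f x)"
    by (simp add: cinner_scaleC_right scaleC_sum_right scaleC_scaleC)
qed

lemma fourier_map_norm:
  assumes B: "orthonormal B" and f: "orthonormal (f ` B)" "inj_on f B" and x: "x \<in> cspan B"
  shows "norm (fourier_map B f x) = norm x"
proof -
  let ?F = "{b \<in> B. cinner b x \<noteq> 0}"
  have F: "finite ?F" using cspan_support[OF B x] .
  have "(norm (fourier_map B f x))\<^sup>2 = (\<Sum>b\<in>?F. (cmod (cinner b x))\<^sup>2)"
    unfolding fourier_map_def
    using F f by (intro norm_sum_orthonormal) (auto intro: orthonormal_subset inj_on_subset)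
  also have "\<dots> = (norm (fourier_map B (\<lambda>b. b) x))\<^sup>2"
    unfolding fourier_map_def
    using F B by (intro norm_sum_orthonormal[symmetric]) (auto intro: orthonormal_subset)
  finally show ?thesis using fourier_map_id[OF B x] by simp
qed

text \<open>The isometry on the span extends to \<open>M\<close> by uniform continuity; composing it
  with the projection onto \<open>M\<close> gives a partial isometry on the whole space that
  vanishes on the complement.\<close>

lemma isometry_of_injection:
  fixes M :: "'a::chilbert set"
  assumes M: "is_onb M B" and f: "orthonormal (f ` B)" "inj_on f B"
  shows "\<exists>V. bounded_clin V \<and> (\<forall>b\<in>B. V b = f b) \<and>
     (\<forall>x. V (proj M x) = V x \<and> norm (V x) = norm (proj M x))"
proof -
  have B: "orthonormal B" using M by (rule is_onb_orthonormal)
  have cl: "closure (cspan B) = M" using M by (simp add: is_onb_def)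
  note Mc = is_onb_closed[OF M]
  let ?W = "fourier_map B f"
  have diff: "?W (x - y) = ?W x - ?W y" if "x \<in> cspan B" "y \<in> cspan B" for x y
  proof -
    have "x - y = x + scaleC (-1) y" by (simp add: scaleC_minus_left scaleC_one)
    then show ?thesis
      using fourier_map_linear[OF B that(1) csubspace_scaleC[OF csubspace_cspan that(2)], of f "-1"]
        fourier_map_linear(2)[OF B that(2) that(2), of f "-1"]
      by (simp add: scaleC_minus_left scaleC_one)
  qed
  have "uniformly_continuous_on (cspan B) ?W"
    unfolding uniformly_continuous_on_def
  proof (intro allI impI)
    fix e :: real assume "e > 0"
    have "dist (?W x') (?W x) = dist x' x" if "x \<in> cspan B" "x' \<in> cspan B" for x x'
      unfolding dist_norm diff[OF that(2,1), symmetric]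
      by (rule fourier_map_norm[OF B f csubspace_diff[OF csubspace_cspan that(2,1)]])
    then show "\<exists>d>0. \<forall>x\<in>cspan B. \<forall>x'\<in>cspan B. dist x' x < d \<longrightarrow> dist (?W x') (?W x) < e"
      using \<open>e > 0\<close> by (intro exI[of _ e]) simp
  qed
  from uniformly_continuous_on_extension_on_closure[OF this]
  obtain g where g: "uniformly_continuous_on M g" "\<And>x. x \<in> cspan B \<Longrightarrow> ?W x = g x"
    unfolding cl by metis
  have gc: "(\<lambda>n. g (u n)) \<longlonglongrightarrow> g x" if "u \<longlonglongrightarrow> x" "x \<in> M" "\<And>n. u n \<in> M" for u x
    using uniformly_continuous_imp_continuous[OF g(1)] that by (simp add: continuous_on_sequentially comp_def)
  have approx: "\<exists>u. (\<forall>n. u n \<in> cspan B) \<and> u \<longlonglongrightarrow> x" if "x \<in> M" for x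
    using that unfolding cl[symmetric] closure_sequential .
  have sM: "x \<in> M" if "x \<in> cspan B" for x using that closure_subset cl by blast
  have g_add: "g (x + y) = g x + g y" if xM: "x \<in> M" and yM: "y \<in> M" for x y
  proof -
    obtain u v where u: "\<And>n. u n \<in> cspan B" "u \<longlonglongrightarrow> x" and v: "\<And>n. v n \<in> cspan B" "v \<longlonglongrightarrow> y"
      using approx xM yM by meson
    have "(\<lambda>n. g (u n + v n)) \<longlonglongrightarrow> g (x + y)"
      by (intro gc tendsto_add u(2) v(2) csubspace_add[OF Mc(1)] xM yM sM[OF u(1)] sM[OF v(1)])
    moreover have "(\<lambda>n. g (u n) + g (v n)) \<longlonglongrightarrow> g x + g y"
      by (intro tendsto_add gc u(2) v(2) xM yM sM[OF u(1)] sM[OF v(1)])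
    moreover have "g (u n + v n) = g (u n) + g (v n)" for n
      using fourier_map_linear(1)[OF B u(1) v(1)] g(2)[OF u(1)] g(2)[OF v(1)]
        g(2)[OF csubspace_add[OF csubspace_cspan u(1) v(1)]] by metis
    ultimately show ?thesis using LIMSEQ_unique by simp
  qed
  have g_scale: "g (scaleC a x) = scaleC a (g x)" if xM: "x \<in> M" for a x
  proof -
    obtain u where u: "\<And>n. u n \<in> cspan B" "u \<longlonglongrightarrow> x" using approx xM by meson
    note sc = bounded_clin_scaleC[OF bounded_clin_id(1), of a]
    have "(\<lambda>n. g (scaleC a (u n))) \<longlonglongrightarrow> g (scaleC a x)"
      by (intro gc clin_tendsto[OF sc] u(2) csubspace_scaleC[OF Mc(1)] xM sM[OF u(1)])
    moreover have "(\<lambda>n. scaleC a (g (u n))) \<longlonglongrightarrow> scaleC a (g x)"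
      by (intro clin_tendsto[OF sc] gc u(2) xM sM[OF u(1)])
    moreover have "g (scaleC a (u n)) = scaleC a (g (u n))" for n
      using fourier_map_linear(2)[OF B u(1) u(1)] g(2)[OF u(1)]
        g(2)[OF csubspace_scaleC[OF csubspace_cspan u(1)]] by metis
    ultimately show ?thesis using LIMSEQ_unique by simp
  qed
  have g_norm: "norm (g x) = norm x" if xM: "x \<in> M" for x
  proof -
    obtain u where u: "\<And>n. u n \<in> cspan B" "u \<longlonglongrightarrow> x" using approx xM by meson
    have "(\<lambda>n. norm (g (u n))) \<longlonglongrightarrow> norm (g x)" by (intro tendsto_norm gc u(2) xM sM[OF u(1)])
    moreover have "norm (g (u n)) = norm (u n)" for n
      using fourier_map_norm[OF B f u(1)] g(2)[OF u(1)] by metis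
    moreover have "(\<lambda>n. norm (u n)) \<longlonglongrightarrow> norm x" using u by (intro tendsto_norm)
    ultimately show ?thesis using LIMSEQ_unique by simp
  qed
  define V where "V x = g (proj M x)" for x
  note cP = proj_clin[OF Mc] and oP = proj_orth_proj(1)[OF Mc]
  have "bounded_clin V"
  proof (rule bounded_clinI[where K = 1])
    show "norm (V x) \<le> 1 * norm x" for x
      using g_norm[OF proj_in[OF Mc]] orth_proj_norm[OF oP] by (simp add: V_def)
  qed (simp_all add: V_def clin_add[OF cP] clin_scaleC[OF cP] g_add g_scale proj_in[OF Mc])
  moreover have "V b = f b" if b: "b \<in> B" for b
  proof -
    have "b \<in> M" using b M by (auto simp: is_onb_def)
    then have "V b = ?W b" using g(2)[OF cspan_base[OF b]] by (simp add: V_def proj_fix[OF Mc])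
    moreover have "{c \<in> B. cinner c b \<noteq> 0} = {b}"
      using b orthonormal_cinner[OF B] by (auto split: if_splits)
    ultimately show ?thesis using orthonormal_cinner[OF B b b] by (simp add: fourier_map_def scaleC_one)
  qed
  moreover have "V (proj M x) = V x \<and> norm (V x) = norm (proj M x)" for x
    using g_norm[OF proj_in[OF Mc]] by (simp add: V_def orth_proj_idem[OF oP])
  ultimately show ?thesis by blast
qed

section \<open>Bounded below operators\<close>

lemma csubspace_range:
  assumes T: "bounded_clin T" shows "csubspace (range T)"
  unfolding csubspace_def
proof (intro conjI ballI allI)
  show "0 \<in> range T" by (rule image_eqI[of _ _ 0]) (simp_all add: clin_zero[OF T])
  fix x assume "x \<in> range T"
  then obtain u where u: "x = T u" by (elim imageE)
  show "scaleC c x \<in> range T" for c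
    by (rule image_eqI[of _ _ "scaleC c u"]) (simp_all add: u clin_scaleC[OF T])
  fix y assume "y \<in> range T"
  then obtain v where v: "y = T v" by (elim imageE)
  show "x + y \<in> range T"
    by (rule image_eqI[of _ _ "u + v"]) (simp_all add: u v clin_add[OF T])
qed

text \<open>The bound for \<open>T\<close> gives injectivity and a closed range; the bound for its
  adjoint leaves no vector orthogonal to that range.\<close>

lemma inverse_of_bounded_below:
  fixes T :: "'a::chilbert \<Rightarrow> 'a"
  assumes T: "bounded_clin T" and c: "0 < c"
    and below: "\<And>x. c * norm x \<le> norm (T x)" and adj_below: "\<And>x. c * norm x \<le> norm (adj T x)"
  shows "\<exists>R. bounded_clin R \<and> (\<forall>x. T (R x) = x) \<and> (\<forall>x. R (T x) = x)"
proof -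
  have inj: "x = y" if "T x = T y" for x y
  proof -
    have "c * norm (x - y) \<le> norm (T (x - y))" by (rule below)
    also have "T (x - y) = 0" using that by (simp add: clin_diff[OF T])
    finally have "norm (x - y) \<le> 0" using c by (simp add: mult_le_0_iff)
    then show ?thesis by simp
  qed
  have "complete (T ` UNIV)"
    by (rule complete_isometric_image[OF c subspace_UNIV bounded_clin_bl[OF T] _ complete_UNIV])
       (use below in simp)
  then have cl: "closed (range T)" by (rule complete_imp_closed)
  have "csubspace (range T)" by (rule csubspace_range[OF T])
  note M = this cl
  have surj: "\<exists>y. T y = x" for x
  proof -
    have "adj T (x - proj (range T) x) = 0"
    proof (rule eq_by_cinner)
      fix z
      have "cinner z (adj T (x - proj (range T) x)) = cinner (T z) (x - proj (range T) x)"
        by (simp add: cinner_adj[OF T])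
      also have "\<dots> = 0" by (rule proj_orth[OF M rangeI])
      finally show "cinner z (adj T (x - proj (range T) x)) = cinner z 0" by simp
    qed
    then have "norm (x - proj (range T) x) \<le> 0"
      using adj_below[of "x - proj (range T) x"] c by (simp add: mult_le_0_iff)
    then have "x = proj (range T) x" by simp
    then show ?thesis using proj_in[OF M, of x] by (metis imageE)
  qed
  then obtain R where R: "\<And>x. T (R x) = x" by metis
  have RT: "R (T x) = x" for x by (rule inj) (rule R)
  have "bounded_clin R"
  proof (rule bounded_clinI[where K = "1 / c"])
    show "R (x + y) = R x + R y" for x y by (rule inj) (simp add: R clin_add[OF T])
    show "R (scaleC a x) = scaleC a (R x)" for a x by (rule inj) (simp add: R clin_scaleC[OF T])
    show "norm (R x) \<le> 1 / c * norm x" for x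
      using below[of "R x"] c by (simp add: R field_simps)
  qed
  then show ?thesis using R RT by blast
qed

lemma hdim_obtain:
  assumes "csubspace M" "closed (M::'a::chilbert set)"
  obtains B where "is_onb M B" "hdim M = card_of B"
proof -
  have "is_onb M (SOME B. is_onb M B)" by (rule someI_ex[OF onb_exists[OF assms]])
  then show ?thesis by (rule that) (simp only: hdim_def)
qed

lemma hdim_infinite_iff:
  assumes "is_onb M B" shows "ordLeq2 natLeq (hdim M) \<longleftrightarrow> infinite B"
proof -
  have "ordLeq2 natLeq (card_of B)" if "ordLeq2 natLeq (hdim M)"
    by (rule ordLeq_ordIso_trans[OF that hdim_onb[OF assms]])
  moreover have "ordLeq2 natLeq (hdim M)" if "ordLeq2 natLeq (card_of B)"
    by (rule ordLeq_ordIso_trans[OF that ordIso_symmetric[OF hdim_onb[OF assms]]])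
  ultimately show ?thesis using infinite_iff_natLeq_ordLeq[of B] by auto
qed

section \<open>Dimensions of the spectral subspaces\<close>

context positive_contraction
begin

lemma P_proj: "orth_proj (P l)"
  using orth_proj_compl[OF Q_proj[of l]] by (simp add: P_def[abs_def])

lemma P_clin: "bounded_clin (P l)" by (rule orth_proj_clin[OF P_proj])
lemma P_idem: "P l (P l x) = P l x" by (rule orth_proj_idem[OF P_proj])
lemma P_swap: "cinner (P l x) y = cinner x (P l y)" by (rule orth_proj_swap[OF P_proj])

lemma P_A: "A (P l x) = P l (A x)"
  by (simp add: P_def clin_diff[OF clin] Q_A)

lemma P_comm: "selfadj Z \<Longrightarrow> (\<And>x. Z (A x) = A (Z x)) \<Longrightarrow> Z (P l x) = P l (Z x)"
  using Q_comm[of Z l x] by (simp add: P_def clin_diff[OF selfadj_clin])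

lemma P_P: "P l (P m x) = P m (P l x)"
  by (rule P_comm[of "P l", OF orth_proj_selfadj[OF P_proj]]) (simp add: P_A)

lemma P_mono:
  assumes "l \<le> m" shows "P l (P m x) = P m x" "P m (P l x) = P m x"
proof -
  show "P l (P m x) = P m x"
    using Q_mono(2)[OF assms] by (simp add: P_def clin_diff[OF Q_clin])
  then show "P m (P l x) = P m x" by (simp add: P_P)
qed

lemma P_form_le: "P l x = 0 \<Longrightarrow> Re (cinner x (A x)) \<le> l * (norm x)\<^sup>2"
  by (rule Q_form_le) (simp add: P_def)

lemma P_form_gt: "P l x = x \<Longrightarrow> x \<noteq> 0 \<Longrightarrow> l * (norm x)\<^sup>2 < Re (cinner x (A x))"
  by (rule Q_form_gt) (simp_all add: P_def)

lemma P_one: "l \<ge> 1 \<Longrightarrow> P l x = 0" by (simp add: P_def Q_one)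

lemma P_range: "x \<in> range (P l) \<longleftrightarrow> P l x = x"
  by (rule orth_proj_range[OF P_proj])

lemma P_closed: "csubspace (range (P l))" "closed (range (P l))"
  using orth_proj_range_closed[OF P_proj] .

lemma onb_P: "is_onb (range (P l)) C \<Longrightarrow> c \<in> C \<Longrightarrow> P l c = c"
  unfolding is_onb_iff P_range[symmetric] by (elim conjE) (rule subsetD)

lemma onb_P_cspan:
  assumes "is_onb (range (P l)) C" "x \<in> cspan C" shows "P l x = x"
proof -
  have "C \<subseteq> range (P l)" using assms(1) unfolding is_onb_iff by (rule conjunct1)
  from subsetD[OF cspan_subset[OF P_closed(1) this] assms(2)] show ?thesis by (simp only: P_range)
qed

lemma P_range_mono: "l \<le> m \<Longrightarrow> range (P m) \<subseteq> range (P l)"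
proof
  fix x assume lm: "l \<le> m" and "x \<in> range (P m)"
  then have "P m x = x" by (simp only: P_range)
  then show "x \<in> range (P l)" using P_mono(1)[OF lm, of x] by (simp only: P_range)
qed

lemma P_hdim_mono: "l \<le> m \<Longrightarrow> ordLeq2 (hdim (range (P m))) (hdim (range (P l)))"
  by (intro hdim_mono P_closed P_range_mono)

lemma A_P0: "A (P 0 x) = A x"
proof -
  have "Re (cinner (Q 0 x) (A (Q 0 x))) = 0"
    using Q_form_le[OF Q_idem, of 0 x] form_ge[of "Q 0 x"] by simp
  then have "A (Q 0 x) = 0" by (rule positive_op_zero_form[OF pos])
  then show ?thesis by (simp add: P_def clin_diff[OF clin])
qed

text \<open>Letting \<open>l\<close> tend to 1 in the lower bounds yields a form of at least
  \<open>||x||^2\<close>. The positive operator \<open>1 - A\<close> then has zero form at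
  \<open>x\<close>, hence vanishes there.\<close>

lemma eigenvector_one_iff: "A x = x \<longleftrightarrow> (\<forall>l<1. P l x = x)"
proof
  assume Ax: "A x = x"
  show "\<forall>l<1. P l x = x"
  proof (intro allI impI, rule ccontr)
    fix l :: real assume l: "l < 1" "P l x \<noteq> x"
    define y where "y = Q l x"
    have "y \<noteq> 0" using l by (simp add: y_def P_def)
    moreover have "A y = y" using Ax by (simp add: y_def Q_A)
    then have "(norm y)\<^sup>2 \<le> l * (norm y)\<^sup>2"
      using Q_form_le[OF Q_idem, of l x] by (simp add: y_def cinner_self)
    ultimately show False using l(1) by simp
  qed
next
  assume *: "\<forall>l<1. P l x = x"
  have pos1: "positive_op (\<lambda>x. x - A x)"
    unfolding positive_op_iff selfadj_def using form_le
    by (auto intro!: bounded_clin_diff clin simp: cinner_algebra cinner_self selfadj_swap[OF sa])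
  have "l * (norm x)\<^sup>2 \<le> Re (cinner x (A x))" if "l < 1" for l
    using P_form_gt[of l x] * that clin_zero[OF clin] by (cases "x = 0") auto
  then have "(1 - inverse (real (Suc n))) * (norm x)\<^sup>2 \<le> Re (cinner x (A x))" for n by simp
  moreover have "(\<lambda>n. (1 - inverse (real (Suc n))) * (norm x)\<^sup>2) \<longlonglongrightarrow> (1 - 0) * (norm x)\<^sup>2"
    by (intro tendsto_mult_right tendsto_diff tendsto_const LIMSEQ_inverse_real_of_nat)
  ultimately have "(1 - 0) * (norm x)\<^sup>2 \<le> Re (cinner x (A x))" by (intro LIMSEQ_le_const2) auto
  then have "Re (cinner x (x - A x)) = 0"
    using form_le[of x] by (simp add: cinner_diff_right cinner_self)
  then have "x - A x = 0" by (rule positive_op_zero_form[OF pos1])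
  then show "A x = x" by simp
qed

text \<open>The form of a projection is 0 on its kernel and \<open>||x||^2\<close> on its range, so
  no level in \<open>[0, 1[\<close> separates anything else.\<close>

lemma orth_proj_P_eq:
  assumes A: "orth_proj A" and l: "0 \<le> l" "l < 1" shows "P l = A"
proof
  fix x
  have "A (P l x) = P l x"
  proof (rule orth_proj_absorb[of "P l" A, OF P_proj A])
    show "P l (A x) = A (P l x)" for x by (simp add: P_A)
    show "x = 0" if "P l x = x" "A x = 0" for x
    proof (rule ccontr)
      assume "x \<noteq> 0"
      then have "l * (norm x)\<^sup>2 < 0" using P_form_gt[OF that(1)] that(2) by simp
      then show False using l(1) by (simp add: mult_less_0_iff)
    qed
  qed
  moreover have "P l (A x) = A x"
  proof (rule orth_proj_absorb[of A "P l", OF A P_proj])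
    show "A (P l x) = P l (A x)" for x by (rule P_A)
    show "x = 0" if x: "A x = x" "P l x = 0" for x
    proof -
      have "(norm x)\<^sup>2 \<le> l * (norm x)\<^sup>2" using P_form_le[OF x(2)] x(1) by (simp add: cinner_self)
      then show ?thesis
        using mult_strict_right_mono[OF l(2), of "(norm x)\<^sup>2"] by (cases "x = 0") simp_all
    qed
  qed
  ultimately show "P l x = A x" by (simp add: P_A)
qed

text \<open>Condition (iv), expressed through \<open>P\<close>; every other condition is compared
  with this one.\<close>

definition full_dim :: bool where
  "full_dim \<longleftrightarrow> (\<forall>l. 0 \<le> l \<and> l < 1 \<longrightarrow> ordIso2 (hdim (range (P 0))) (hdim (range (P l))))"

lemma full_dim_orth_proj:
  assumes "orth_proj A" shows full_dim
  unfolding full_dim_def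
proof (intro allI impI, elim conjE)
  fix l :: real assume l: "0 \<le> l" "l < 1"
  have "P 0 = P l" by (rule trans[OF orth_proj_P_eq[OF assms] orth_proj_P_eq[OF assms l, symmetric]]) simp_all
  then have "hdim (range (P 0)) = hdim (range (P l))" by (rule arg_cong)
  then show "ordIso2 (hdim (range (P 0))) (hdim (range (P l)))"
    using ordIso_refl[OF hdim_Card_order[of "range (P l)"]] by (simp only:)
qed

text \<open>Nested subspaces of equal finite dimension coincide. So the range of \<open>P 0\<close>
  lies on every level below 1, which means that \<open>A\<close> is the identity on it.\<close>

lemma full_dim_finite:
  assumes full_dim and B: "is_onb (range (P 0)) B" "finite B"
  shows "A = P 0" "finite_rank A"
proof -
  have eq: "range (P l) = range (P 0)" if l: "0 \<le> l" "l < 1" for l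
  proof -
    obtain C where C: "is_onb (range (P l)) C" using onb_exists[OF P_closed] by blast
    have "ordIso2 (hdim (range (P 0))) (hdim (range (P l)))"
      using assms(1) l by (simp add: full_dim_def)
    then have "ordIso2 (card_of B) (card_of C)"
      using hdim_onb[OF B(1)] hdim_onb[OF C] ordIso_symmetric ordIso_transitive by blast
    then show ?thesis
      by (intro onb_finite_eq[OF C B(1) P_range_mono[OF l(1)] B(2)] ordIso_imp_ordLeq)
  qed
  show A0: "A = P 0"
  proof
    fix x
    have "P l (P 0 x) = P 0 x" if "l < 1" for l
    proof (cases "0 \<le> l")
      case True
      then show ?thesis using eq[OF True that] P_range by blast
    next
      case False
      then show ?thesis by (intro P_mono(1)) simp
    qed
    then have "A (P 0 x) = P 0 x" using eigenvector_one_iff by blast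
    then show "A x = P 0 x" by (simp add: A_P0)
  qed
  show "finite_rank A"
    unfolding finite_rank_def using B(2) onb_finite_cspan[OF B] arg_cong[OF A0, of range]
    by (intro exI[of _ B]) (simp only: simp_thms order_refl)
qed

section \<open>The asymptotic limit of a contraction\<close>

text \<open>For infinite \<open>C\<close>, the conditions for all powers of \<open>T\<close>
  together are no more numerous than \<open>C\<close>, and one vector meets them all. For finite
  \<open>C\<close> they are met one power at a time by unit vectors \<open>u n\<close> in the span
  of the same \<open>card C + 1\<close> basis vectors; a limit point works for all powers, because
  norms along an orbit of \<open>T\<close> decrease.\<close>

lemma asymptotic_limit_full_dim:
  assumes lim: "\<And>x. (\<lambda>n. (norm ((T ^^ n) x))\<^sup>2) \<longlonglongrightarrow> Re (cinner x (A x))" and T: "contraction T"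
  shows full_dim
proof -
  have cT: "bounded_clin T" using T by (simp add: contraction_iff)
  note cTn = bounded_clin_pow[OF cT]
  have inv: "Re (cinner ((T ^^ m) x) (A ((T ^^ m) x))) = Re (cinner x (A x))" for m x
  proof (rule LIMSEQ_unique)
    show "(\<lambda>n. (norm ((T ^^ n) ((T ^^ m) x)))\<^sup>2) \<longlonglongrightarrow> Re (cinner ((T ^^ m) x) (A ((T ^^ m) x)))" by (rule lim)
    show "(\<lambda>n. (norm ((T ^^ n) ((T ^^ m) x)))\<^sup>2) \<longlonglongrightarrow> Re (cinner x (A x))"
      using LIMSEQ_ignore_initial_segment[OF lim, of m x] by (simp add: funpow_add)
  qed
  have dec: "norm ((T ^^ n) x) \<le> norm ((T ^^ m) x)" if "m \<le> n" for m n x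
  proof -
    have "(T ^^ n) x = (T ^^ (n - m)) ((T ^^ m) x)"
      using that by (metis comp_apply funpow_add le_add_diff_inverse2)
    then show ?thesis using contraction_pow[OF T] by metis
  qed
  have orth: "P l ((T ^^ n) x) = 0"
    if C: "is_onb (range (P l)) C" and x: "\<And>c. c \<in> C \<Longrightarrow> cinner ((adj T ^^ n) c) x = 0" for l n x C
  proof (rule onb_orth_zero[OF C rangeI])
    fix c assume c: "c \<in> C"
    have "P l c = c" by (rule onb_P[OF C c])
    then have "cinner c (P l ((T ^^ n) x)) = cinner c ((T ^^ n) x)" by (metis P_swap)
    also have "\<dots> = cnj (cinner ((T ^^ n) x) c)" by (rule cinner_commute)
    also have "\<dots> = cnj (cinner x ((adj T ^^ n) c))" by (simp only: adj_pow[OF cT])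
    also have "\<dots> = 0" using x[OF c] by (metis cinner_commute)
    finally show "cinner c (P l ((T ^^ n) x)) = 0" .
  qed
  \<comment> \<open>As \<open>m\<close> grows, the right-hand side tends to \<open>l\<close> times
    the form itself, which is positive.\<close>
  have false: False
    if l: "l < 1" and x: "P 0 x = x" "x \<noteq> 0" "\<And>m. Re (cinner x (A x)) \<le> l * (norm ((T ^^ m) x))\<^sup>2" for l x
  proof -
    have "Re (cinner x (A x)) \<le> l * Re (cinner x (A x))"
      by (rule LIMSEQ_le_const[OF tendsto_mult_left[OF lim]]) (use x(3) in blast)
    moreover have "0 < Re (cinner x (A x))" using P_form_gt[OF x(1,2)] by simp
    ultimately show False using l by simp
  qed
  have "ordLeq2 (hdim (range (P 0))) (hdim (range (P l)))" if l: "0 \<le> l" "l < 1" for l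
  proof (rule ccontr)
    assume neg: "\<not> ?thesis"
    obtain B where B: "is_onb (range (P 0)) B" "hdim (range (P 0)) = card_of B"
      by (rule hdim_obtain[OF P_closed])
    obtain C where C: "is_onb (range (P l)) C" "hdim (range (P l)) = card_of C"
      by (rule hdim_obtain[OF P_closed])
    have less: "ordLess2 (card_of C) (card_of B)"
      using neg unfolding B(2) C(2) not_ordLeq_iff_ordLess[OF card_of_Well_order card_of_Well_order] .
    note oB = is_onb_orthonormal[OF B(1)]
    have BP: "P 0 x = x" if "x \<in> cspan B" for x by (rule onb_P_cspan[OF B(1) that])
    have le: "Re (cinner x (A x)) \<le> l * (norm ((T ^^ n) x))\<^sup>2" if "P l ((T ^^ n) x) = 0" for x n
      using P_form_le[OF that] by (simp add: inv)
    show False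
    proof (cases "finite C")
      case False
      let ?G = "\<Union>n. (adj T ^^ n) ` C"
      have "ordLeq2 (card_of ?G) (card_of C)"
      proof (rule card_of_UNION_ordLeq_infinite[OF False])
        show "ordLeq2 (card_of (UNIV :: nat set)) (card_of C)" using False infinite_iff_card_of_nat by blast
      qed (simp add: card_of_image)
      then have "ordLess2 (card_of ?G) (card_of B)" using less by (rule ordLeq_ordLess_trans)
      from orthogonal_vector_exists[OF oB this]
      obtain x where x: "x \<in> cspan B" "x \<noteq> 0" "\<forall>g\<in>?G. cinner g x = 0" by (elim bexE conjE)
      have "P l ((T ^^ n) x) = 0" for n by (rule orth[OF C(1)]) (use x(3) in simp)
      then show False using false[OF l(2) BP[OF x(1)] x(2)] le by simp
    next
      case True
      have "\<exists>F\<subseteq>B. finite F \<and> card F = Suc (card C)"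
      proof (cases "finite B")
        case True
        then have "card C < card B" using card_less_if_ordLess[OF less \<open>finite C\<close>] by simp
        then show ?thesis by (metis Suc_leI obtain_subset_with_card_n)
      next
        case False
        then show ?thesis using infinite_arbitrarily_large[of B] by blast
      qed
      then obtain F where F: "F \<subseteq> B" "finite F" "card F = Suc (card C)" by blast
      have oF: "orthonormal F" by (rule orthonormal_subset[OF oB F(1)])
      have FB: "cspan F \<subseteq> cspan B"
        using F(1) cspan_base by (intro cspan_subset csubspace_cspan) blast
      have "\<exists>x. x \<in> cspan F \<and> norm x = 1 \<and> P l ((T ^^ n) x) = 0" for n
      proof -
        let ?G = "(adj T ^^ n) ` C"
        have "card ?G < card F" using card_image_le[OF True, of "adj T ^^ n"] F(3) by simp
        then have "ordLess2 (card_of ?G) (card_of F)"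
        proof -
          have "\<not> ordLeq2 (card_of F) (card_of ?G)"
            using card_le_if_ordLeq[of F ?G] True \<open>card ?G < card F\<close> by force
          then show ?thesis
            unfolding not_ordLeq_iff_ordLess[OF card_of_Well_order card_of_Well_order] .
        qed
        from orthogonal_vector_exists[OF oF this]
        obtain x where x: "x \<in> cspan F" "x \<noteq> 0" "\<forall>g\<in>?G. cinner g x = 0" by (elim bexE conjE)
        let ?y = "scaleC (of_real (1 / norm x)) x"
        have "P l ((T ^^ n) x) = 0" by (rule orth[OF C(1)]) (use x(3) in simp)
        then have "P l ((T ^^ n) ?y) = 0" by (simp add: clin_scaleC[OF cTn] clin_scaleC[OF P_clin])
        moreover have "norm ?y = 1" using x(2) by (simp add: norm_scaleC norm_divide)
        moreover have "?y \<in> cspan F" by (rule csubspace_scaleC[OF csubspace_cspan x(1)])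
        ultimately show ?thesis by (intro exI[of _ ?y] conjI)
      qed
      then obtain u where u: "\<And>n. u n \<in> cspan F" "\<And>n. norm (u n) = 1" "\<And>n. P l ((T ^^ n) (u n)) = 0"
        by metis
      obtain r y where r: "strict_mono r" "y \<in> cspan F" "(\<lambda>n. u (r n)) \<longlonglongrightarrow> y"
        using cspan_finite_compact[of F u, OF F(2) oF u(1)] u(2) by auto
      have "norm y = 1"
        using LIMSEQ_unique[OF tendsto_norm[OF r(3)]] u(2) by simp
      have "Re (cinner y (A y)) \<le> l * (norm ((T ^^ m) y))\<^sup>2" for m
      proof (rule LIMSEQ_le)
        show "(\<lambda>n. Re (cinner (u (r n)) (A (u (r n))))) \<longlonglongrightarrow> Re (cinner y (A y))"
          by (intro tendsto_Re tendsto_cinner clin_tendsto[OF clin r(3)] r(3))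
        show "(\<lambda>n. l * (norm ((T ^^ m) (u (r n))))\<^sup>2) \<longlonglongrightarrow> l * (norm ((T ^^ m) y))\<^sup>2"
          by (intro tendsto_mult_left tendsto_power tendsto_norm clin_tendsto[OF cTn r(3)])
        show "\<exists>N. \<forall>n\<ge>N. Re (cinner (u (r n)) (A (u (r n)))) \<le> l * (norm ((T ^^ m) (u (r n))))\<^sup>2"
        \<comment> \<open>For \<open>n \<ge> m\<close> also \<open>r n \<ge> m\<close>, so the bound
          known at time \<open>r n\<close> passes to the earlier time \<open>m\<close>.\<close>
        proof (intro exI[of _ m] allI impI)
          fix n assume "m \<le> n"
          then have "m \<le> r n" using seq_suble[OF r(1), of n] by simp
          have "Re (cinner (u (r n)) (A (u (r n)))) \<le> l * (norm ((T ^^ r n) (u (r n))))\<^sup>2"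
            by (rule le[OF u(3)])
          also have "\<dots> \<le> l * (norm ((T ^^ m) (u (r n))))\<^sup>2"
            by (intro mult_left_mono power_mono dec \<open>m \<le> r n\<close> l(1)) simp
          finally show "Re (cinner (u (r n)) (A (u (r n)))) \<le> l * (norm ((T ^^ m) (u (r n))))\<^sup>2" .
        qed
      qed
      moreover have "P 0 y = y" using BP FB r(2) by blast
      moreover have "y \<noteq> 0" using \<open>norm y = 1\<close> by auto
      ultimately show False using false[OF l(2)] by blast
    qed
  qed
  then show ?thesis
    unfolding full_dim_def using P_hdim_mono by (auto simp: ordIso_iff_ordLeq)
qed

section \<open>The spectral radius in the quotient algebra\<close>

text \<open>An operator whose range is small is its own approximant.\<close>

lemma ideal_C_I:
  assumes S: "bounded_clin S" and R: "range S \<subseteq> range (P l)" and less: "ordLess2 (hdim (range (P l))) \<kappa>"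
  shows "S \<in> ideal_C \<kappa>"
proof -
  have "csubspace (range S)" by (rule csubspace_range[OF S])
  then have "ordLeq2 (hdim (closure (range S))) (hdim (range (P l)))"
    by (intro hdim_mono csubspace_closure closed_closure P_closed closure_minimal R)
  then have "ordLess2 (hdim (closure (range S))) \<kappa>" using less by (rule ordLeq_ordLess_trans)
  moreover have "onorm (\<lambda>x. S x - S x) < e" if "e > 0" for e
    using onorm_bound[of 0 "\<lambda>x. S x - S x"] that by simp
  ultimately show ?thesis unfolding ideal_C_def using S by blast
qed

text \<open>Cutting \<open>A\<close> off above \<open>l\<close> leaves an operator of norm at most
  \<open>l\<close>, so subtracting \<open>z\<close> gives something invertible. It differs from
  \<open>A - z\<close> by \<open>A P l\<close>, whose range is small, and its inverse
  \<open>R\<close> therefore inverts \<open>A - z\<close> modulo the ideal.\<close>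

lemma quot_spectrum_bound:
  assumes l: "0 \<le> l" and less: "ordLess2 (hdim (range (P l))) \<kappa>" and z: "l < cmod z"
  shows "z \<notin> quot_spectrum \<kappa> A"
proof -
  define A' where "A' x = A (Q l x)" for x
  define T where "T x = A' x - scaleC z x" for x
  have cA': "bounded_clin A'" unfolding A'_def[abs_def] by (rule bounded_clin_comp[OF clin Q_clin])
  have A'Q: "A' x = Q l (A (Q l x))" for x by (simp add: A'_def Q_A Q_idem)
  have saA': "selfadj A'"
    using cA' by (simp add: selfadj_def A'_def selfadj_swap[OF sa] orth_proj_swap[OF Q_proj] Q_A)
  have form: "cinner x (A' x) = cinner (Q l x) (A (Q l x))" for x
    by (simp add: A'Q orth_proj_swap[OF Q_proj])
  have posA': "positive_op A'" using saA' form_ge by (simp add: positive_op_iff form)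
  have nA': "norm (A' x) \<le> l * norm x" for x
  proof (rule positive_op_norm_le[OF posA' _ l])
    fix x
    have "Re (cinner x (A' x)) \<le> l * (norm (Q l x))\<^sup>2" using Q_form_le[OF Q_idem] by (simp add: form)
    also have "\<dots> \<le> l * (norm x)\<^sup>2" by (intro mult_left_mono power_mono orth_proj_norm[OF Q_proj] l) simp
    finally show "Re (cinner x (A' x)) \<le> l * (norm x)\<^sup>2" .
  qed
  have cT: "bounded_clin T"
    unfolding T_def[abs_def] by (intro bounded_clin_diff cA' bounded_clin_scaleC bounded_clin_id)
  have adjT: "adj T = (\<lambda>x. A' x - scaleC (cnj z) x)"
    by (rule adj_eqI) (simp add: T_def cinner_algebra selfadj_swap[OF saA'])
  have below: "(cmod w - l) * norm x \<le> norm (A' x - scaleC w x)" for w x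
    using nA'[of x] norm_triangle_ineq2[of "scaleC w x" "A' x"]
    by (simp add: norm_scaleC norm_minus_commute algebra_simps)
  have "\<exists>R. bounded_clin R \<and> (\<forall>x. T (R x) = x) \<and> (\<forall>x. R (T x) = x)"
  proof (rule inverse_of_bounded_below[OF cT, of "cmod z - l"])
    show "(cmod z - l) * norm x \<le> norm (T x)" for x unfolding T_def by (rule below)
    show "(cmod z - l) * norm x \<le> norm (adj T x)" for x
      using below[of "cnj z" x] by (simp add: adjT)
  qed (use z in simp)
  then obtain R where R: "bounded_clin R" "\<And>x. T (R x) = x" "\<And>x. R (T x) = x" by blast
  have AT: "A x - scaleC z x = T x + A (P l x)" for x
    by (simp add: T_def A'_def P_def clin_diff[OF clin])
  have TP: "T (P l x) = P l (T x)" for x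
  proof -
    have "Q l (P l x) = P l (Q l x)" for x by (simp add: P_def clin_diff[OF Q_clin])
    then show ?thesis
      by (simp add: T_def A'_def clin_diff[OF P_clin] clin_scaleC[OF P_clin] P_A)
  qed
  \<comment> \<open>Commutation keeps the error of \<open>R\<close> as a left inverse inside the
    range of \<open>P l\<close>.\<close>
  have RP: "R (P l x) = P l (R x)" for x
    using R(3)[of "P l (R x)"] TP[of "R x"] by (simp add: R(2))
  have "(\<lambda>x. (A (R x) - scaleC z (R x)) - x) = (\<lambda>x. A (P l (R x)))"
    by (auto simp: AT R(2))
  moreover have "(\<lambda>x. A (P l (R x))) \<in> ideal_C \<kappa>"
  proof (rule ideal_C_I[OF _ _ less])
    show "bounded_clin (\<lambda>x. A (P l (R x)))"
      by (rule bounded_clin_comp[OF clin bounded_clin_comp[OF P_clin R(1)]])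
    show "range (\<lambda>x. A (P l (R x))) \<subseteq> range (P l)" by (auto simp: P_A)
  qed
  moreover have "(\<lambda>x. R (A x - scaleC z x) - x) = (\<lambda>x. R (A (P l x)))"
    by (auto simp: AT clin_add[OF R(1)] R(3))
  moreover have "(\<lambda>x. R (A (P l x))) \<in> ideal_C \<kappa>"
  proof (rule ideal_C_I[OF _ _ less])
    show "bounded_clin (\<lambda>x. R (A (P l x)))"
      by (rule bounded_clin_comp[OF R(1) bounded_clin_comp[OF clin P_clin]])
    show "range (\<lambda>x. R (A (P l x))) \<subseteq> range (P l)" by (auto simp: P_A RP)
  qed
  ultimately have "\<exists>B. bounded_clin B \<and> (\<lambda>x. (A (B x) - scaleC z (B x)) - x) \<in> ideal_C \<kappa> \<and>
      (\<lambda>x. B (A x - scaleC z x) - x) \<in> ideal_C \<kappa>"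
    using R(1) by (intro exI[of _ R] conjI) simp_all
  then show ?thesis by (simp only: quot_spectrum_def mem_Collect_eq not_not)
qed

text \<open>Compressed to the spectral subspace of \<open>]a, b]\<close>, \<open>A - a\<close> is
  positive with form at most \<open>b - a\<close>, so its norm is at most
  \<open>b - a\<close>.\<close>

lemma spectral_interval_norm:
  assumes ab: "a \<le> b" and x: "P a x = x" "P b x = 0"
  shows "norm (A x - a *\<^sub>R x) \<le> (b - a) * norm x"
proof -
  define G where "G = E {a<..b}"
  have G: "orth_proj G" unfolding G_def by (rule E_proj) simp
  have GQ: "G y = Q b y - Q a y" for y by (simp add: G_def E_Ioc[OF ab])
  have Gx: "G x = x" using x by (simp add: GQ P_def)
  have GA: "G (A y) = A (G y)" for y by (simp add: GQ clin_diff[OF clin] Q_A)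
  note cG = orth_proj_clin[OF G]
  have bG: "Q b (G y) = G y" "Q a (G y) = 0" for y
    using Q_mono[OF ab] by (simp_all add: GQ clin_diff[OF Q_clin] Q_idem)
  define W where "W y = A (G y) - a *\<^sub>R G y" for y
  have cW: "bounded_clin W"
    unfolding W_def[abs_def]
    by (rule bounded_clin_diff[OF bounded_clin_comp[OF clin cG] bounded_clin_scaleR[OF cG]])
  have form: "Re (cinner y (W y)) = Re (cinner (G y) (A (G y))) - a * (norm (G y))\<^sup>2" for y
  proof -
    have "cinner y (A (G y)) = cinner (G y) (A (G y))"
      by (simp add: orth_proj_swap[OF G] GA orth_proj_idem[OF G])
    moreover have "Re (cinner y (G y)) = (norm (G y))\<^sup>2" by (simp add: orth_proj_form[OF G])
    ultimately show ?thesis by (simp add: W_def cinner_diff_right scaleR_scaleC cinner_scaleC_right)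
  qed
  have "selfadj W"
    using cW by (simp add: selfadj_def W_def cinner_algebra scaleR_scaleC orth_proj_swap[OF G]
        selfadj_swap[OF sa] GA)
  moreover have "0 \<le> Re (cinner y (W y))" for y
  proof (cases "G y = 0")
    case False
    then show ?thesis using Q_form_gt[OF bG(2)] by (force simp: form)
  qed (simp add: form clin_zero[OF clin])
  ultimately have W: "positive_op W" by (simp add: positive_op_iff)
  have "norm (W x) \<le> (b - a) * norm x"
  proof (rule positive_op_norm_le[OF W])
    fix y
    have "Re (cinner y (W y)) \<le> (b - a) * (norm (G y))\<^sup>2"
      using Q_form_le[OF bG(1), of y] by (simp add: form algebra_simps)
    also have "\<dots> \<le> (b - a) * (norm y)\<^sup>2"
      using ab by (intro mult_left_mono power_mono orth_proj_norm[OF G]) auto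
    finally show "Re (cinner y (W y)) \<le> (b - a) * (norm y)\<^sup>2" .
  qed (use ab in simp)
  then show ?thesis by (simp add: W_def Gx)
qed

text \<open>Near \<open>t\<close> there are at least \<open>\<kappa>\<close> orthonormal approximate
  eigenvectors, while an operator \<open>K\<close> approximating the error of a left inverse
  \<open>R\<close> imposes fewer than \<open>\<kappa>\<close> conditions. Some nonzero approximate
  eigenvector is thus killed by \<open>K\<close>; there \<open>R (A - t)\<close> should be close to
  the identity, yet it is small.\<close>

lemma quot_spectrum_mem:
  assumes inf: "infinite D" and \<kappa>: "\<kappa> = card_of (D :: 'a set)"
    and ge: "\<And>e. e > 0 \<Longrightarrow> ordLeq2 \<kappa> (hdim (range (P (t - e))))"
    and less: "\<And>e. e > 0 \<Longrightarrow> ordLess2 (hdim (range (P (t + e)))) \<kappa>"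
  shows "complex_of_real t \<in> quot_spectrum \<kappa> A"
proof (rule ccontr)
  assume "\<not> ?thesis"
  then obtain R where R: "bounded_clin R" "(\<lambda>x. R (A x - scaleC (of_real t) x) - x) \<in> ideal_C \<kappa>"
    unfolding quot_spectrum_def by blast
  obtain b where b: "b > 0" "\<And>x. norm (R x) \<le> b * norm x" using clin_bound[OF R(1)] by blast
  \<comment> \<open>The interval costs \<open>3 e\<close> and \<open>R\<close> the factor
    \<open>b\<close>, together 1/4; with the error 1/2 from \<open>K\<close> this stays below
    1.\<close>
  define e where "e = 1 / (12 * b)"
  have e: "e > 0" using b by (simp add: e_def)
  define D' where "D' x = R (A x - scaleC (of_real t) x) - x" for x
  have cD': "bounded_clin D'"
    using R(2) unfolding ideal_C_def D'_def[abs_def] by blast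
  obtain K where K: "bounded_clin K" "ordLess2 (hdim (closure (range K))) \<kappa>"
    "onorm (\<lambda>x. D' x - K x) < 1 / 2"
    using R(2)[unfolded ideal_C_def mem_Collect_eq, THEN conjunct2, rule_format, of "1 / 2"]
    unfolding D'_def[abs_def] by (meson half_gt_zero zero_less_one)
  have sK: "csubspace (closure (range K))" by (rule csubspace_closure[OF csubspace_range[OF K(1)]])
  obtain C where C: "is_onb (closure (range K)) C" "hdim (closure (range K)) = card_of C"
    by (rule hdim_obtain[OF sK closed_closure])
  obtain C' where C': "is_onb (range (P (t + e))) C'" "hdim (range (P (t + e))) = card_of C'"
    by (rule hdim_obtain[OF P_closed])
  obtain B where B: "is_onb (range (P (t - e))) B" "hdim (range (P (t - e))) = card_of B"
    by (rule hdim_obtain[OF P_closed])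
  \<comment> \<open>Orthogonality to the first set means \<open>K x = 0\<close>, to the second
    \<open>P (t + e) x = 0\<close>.\<close>
  let ?G = "adj K ` C \<union> C'"
  have "ordLess2 (card_of (adj K ` C)) (card_of D)"
    using K(2) unfolding C(2) \<kappa> by (rule ordLeq_ordLess_trans[OF card_of_image])
  moreover have "ordLess2 (card_of C') (card_of D)"
    using less[OF e] unfolding C'(2) \<kappa> .
  ultimately have "ordLess2 (card_of ?G) (card_of D)" by (rule card_of_Un_ordLess_infinite[OF inf])
  moreover have "ordLeq2 (card_of D) (card_of B)" using ge[OF e] unfolding B(2) \<kappa> .
  ultimately have "ordLess2 (card_of ?G) (card_of B)" by (rule ordLess_ordLeq_trans)
  from orthogonal_vector_exists[OF is_onb_orthonormal[OF B(1)] this]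
  obtain x where x: "x \<in> cspan B" "x \<noteq> 0" "\<forall>g\<in>?G. cinner g x = 0" by (elim bexE conjE)
  have Px: "P (t - e) x = x" by (rule onb_P_cspan[OF B(1) x(1)])
  have Px0: "P (t + e) x = 0"
  proof (rule onb_orth_zero[OF C'(1) rangeI])
    fix c assume c: "c \<in> C'"
    have "P (t + e) c = c" by (rule onb_P[OF C'(1) c])
    then have "cinner c (P (t + e) x) = cinner c x" by (metis P_swap)
    then show "cinner c (P (t + e) x) = 0" using x(3) c by simp
  qed
  have Kx: "K x = 0"
  proof (rule onb_orth_zero[OF C(1)])
    show "K x \<in> closure (range K)" by (rule subsetD[OF closure_subset rangeI])
    fix c assume c: "c \<in> C"
    have "cinner c (K x) = cinner (adj K c) x" by (simp add: cinner_adj'[OF K(1)])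
    then show "cinner c (K x) = 0" using x(3) c by simp
  qed
  define u where "u = A x - (t - e) *\<^sub>R x"
  have "norm u \<le> ((t + e) - (t - e)) * norm x"
    unfolding u_def using e by (intro spectral_interval_norm Px Px0) simp
  then have u: "norm u \<le> 2 * (e * norm x)" by simp
  have eq: "A x - scaleC (of_real t) x = u - e *\<^sub>R x"
    by (simp add: u_def scaleR_scaleC scaleC_diff_left)
  have "norm (e *\<^sub>R x) = e * norm x" using e by simp
  then have "norm (A x - scaleC (of_real t) x) \<le> 3 * e * norm x"
    unfolding eq using norm_triangle_ineq4[of u "e *\<^sub>R x"] u by linarith
  then have "norm (R (A x - scaleC (of_real t) x)) \<le> b * (3 * e * norm x)"
    using b(2) b(1) by (meson mult_left_mono less_imp_le order_trans)
  also have "\<dots> = norm x / 4" using b(1) by (simp add: e_def)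
  finally have 1: "norm (R (A x - scaleC (of_real t) x)) \<le> norm x / 4" .
  have "norm (D' x - K x) \<le> onorm (\<lambda>x. D' x - K x) * norm x"
    by (rule clin_norm[OF bounded_clin_diff[OF cD' K(1)]])
  also have "\<dots> \<le> 1 / 2 * norm x" using K(3) by (intro mult_right_mono) auto
  finally have 2: "norm (D' x) \<le> norm x / 2" by (simp add: Kx)
  have "R (A x - scaleC (of_real t) x) - D' x = x" by (simp add: D'_def)
  with norm_triangle_ineq4[of "R (A x - scaleC (of_real t) x)" "D' x"]
  have "norm x \<le> norm (R (A x - scaleC (of_real t) x)) + norm (D' x)" by (simp only:)
  with 1 2 have "norm x \<le> 0" by linarith
  then show False using x(2) by simp
qed

text \<open>With \<open>t\<close> the supremum of the levels \<open>s\<close> at which the dimension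
  has not yet dropped below \<open>\<kappa>\<close>, \<open>t\<close> itself is in the quotient
  spectrum and nothing of larger modulus is. So the radius is \<open>t\<close>, and
  \<open>t = 1\<close> says that no level below 1 loses dimension.\<close>

lemma r_kappa_eq_1_iff:
  assumes inf: "ordLeq2 natLeq (hdim (range (P 0)))"
  shows "r_kappa (hdim (range (P 0))) A = 1 \<longleftrightarrow> full_dim"
proof -
  let ?\<kappa> = "hdim (range (P 0))"
  obtain D where D: "is_onb (range (P 0)) D" "?\<kappa> = card_of D" by (rule hdim_obtain[OF P_closed])
  have infD: "infinite D" using inf hdim_infinite_iff[OF D(1)] by blast
  define S where "S = {s. ordLeq2 ?\<kappa> (hdim (range (P s)))}"
  have notS: "s \<notin> S \<longleftrightarrow> ordLess2 (hdim (range (P s))) ?\<kappa>" for s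
    unfolding S_def using not_ordLeq_iff_ordLess[OF hdim_Well_order hdim_Well_order] by blast
  have S0: "0 \<in> S" unfolding S_def using ordLeq_refl[OF hdim_Card_order] by blast
  have Sdown: "s \<in> S" if "s' \<in> S" "s \<le> s'" for s s'
    using that P_hdim_mono[OF that(2)] unfolding S_def by (blast intro: ordLeq_transitive)
  have S1: "s < 1" if "s \<in> S" for s
  proof (rule ccontr)
    assume "\<not> s < 1"
    then have "range (P s) = {0}" using P_one[of s] by (auto simp: image_def)
    moreover obtain C where C: "is_onb (range (P s)) C" "hdim (range (P s)) = card_of C"
      by (rule hdim_obtain[OF P_closed])
    ultimately have "C \<subseteq> {0}" by (simp add: is_onb_def)
    then have "finite C" using finite_subset by blast
    moreover have "ordLeq2 (card_of D) (card_of C)" using that unfolding S_def mem_Collect_eq C(2) D(2)[symmetric] .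
    ultimately show False using infD card_of_ordLeq_finite by blast
  qed
  have bdd: "bdd_above S" using S1 by (intro bdd_aboveI[of _ 1]) (simp add: less_imp_le)
  define t where "t = Sup S"
  have t0: "0 \<le> t" unfolding t_def by (rule cSup_upper[OF S0 bdd])
  have lt: "s \<in> S" if "s < t" for s
    using that less_cSup_iff[of S s] S0 bdd Sdown unfolding t_def by (metis empty_iff less_imp_le)
  have gt: "s \<notin> S" if "t < s" for s
    using that cSup_upper[OF _ bdd, of s] unfolding t_def by (meson not_less)
  have tmem: "complex_of_real t \<in> quot_spectrum ?\<kappa> A"
  proof (rule quot_spectrum_mem[OF infD D(2)])
    show "ordLeq2 ?\<kappa> (hdim (range (P (t - e))))" if "e > 0" for e
      using lt[of "t - e"] that unfolding S_def by simp
    show "ordLess2 (hdim (range (P (t + e)))) ?\<kappa>" if "e > 0" for e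
      using gt[of "t + e"] that notS by simp
  qed
  have "r_kappa ?\<kappa> A = t"
    unfolding r_kappa_def
  proof (rule cSup_eq_maximum)
    show "t \<in> cmod ` quot_spectrum ?\<kappa> A" using tmem t0 by (intro image_eqI[of _ _ "of_real t"]) auto
    fix y assume "y \<in> cmod ` quot_spectrum ?\<kappa> A"
    then obtain z where z: "z \<in> quot_spectrum ?\<kappa> A" "y = cmod z" by blast
    show "y \<le> t"
    proof (rule ccontr)
      assume "\<not> y \<le> t"
      \<comment> \<open>A level strictly between \<open>t\<close> and \<open>|z|\<close> has already
        lost dimension and still bounds \<open>z\<close> away.\<close>
      then have "t < (t + y) / 2" "(t + y) / 2 < y" by auto
      then have "z \<notin> quot_spectrum ?\<kappa> A"
        using t0 gt notS z(2) by (intro quot_spectrum_bound[of "(t + y) / 2"]) auto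
      then show False using z(1) by blast
    qed
  qed
  moreover have "t = 1 \<longleftrightarrow> full_dim"
  proof
    assume "t = 1"
    then have "l \<in> S" if "l < 1" for l using lt that by simp
    then show full_dim
      unfolding full_dim_def S_def using P_hdim_mono by (auto simp: ordIso_iff_ordLeq)
  next
    assume fd: full_dim
    have "l \<in> S" if "l < 1" for l
    proof (cases "0 \<le> l")
      case True
      then show ?thesis using fd that unfolding full_dim_def S_def by (simp add: ordIso_imp_ordLeq)
    next
      case False
      then show ?thesis using Sdown[OF S0] by simp
    qed
    then have "\<not> t < 1" using gt[of "(t + 1) / 2"] by force
    moreover have "t \<le> 1" unfolding t_def using S0 S1 by (intro cSup_least) (auto intro: less_imp_le)
    ultimately show "t = 1" by simp
  qed
  ultimately show ?thesis by simp
qed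

end

section \<open>Existence of the asymptotic limit\<close>

lemma powpow_form:
  fixes T :: "'a::chilbert \<Rightarrow> 'a"
  assumes "contraction T"
  shows "cinner x (powpow T n x) = complex_of_real ((norm ((T ^^ n) x))\<^sup>2)"
proof -
  have "bounded_clin T" using assms by (simp add: contraction_iff)
  from adj_pow[OF this, of n x "(T ^^ n) x"] show ?thesis
    unfolding powpow_def comp_apply cinner_self[symmetric] by (rule sym)
qed

lemma powpow_clin: "contraction (T::'a::chilbert \<Rightarrow> 'a) \<Longrightarrow> bounded_clin (powpow T n)"
  unfolding powpow_def contraction_iff
  by (elim conjE) (rule bounded_clin_o[OF bounded_clin_pow[OF adj_clin] bounded_clin_pow])

lemma contraction_adj: "contraction (T::'a::chilbert \<Rightarrow> 'a) \<Longrightarrow> contraction (adj T)"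
  unfolding contraction_iff using norm_adj_le[of T 1] adj_clin[of T] by simp

text \<open>The forms \<open>||T^n x||^2\<close> decrease, so the negated operators increase and
  converge strongly. Only with this does the \<open>lim\<close> in \<open>AT\<close> denote a
  limit.\<close>

lemma powpow_tendsto_AT:
  fixes T :: "'a::chilbert \<Rightarrow> 'a"
  assumes T: "contraction T" shows "(\<lambda>n. powpow T n x) \<longlonglongrightarrow> AT T x"
proof -
  note c = powpow_clin[OF T]
  have "convergent (\<lambda>n. - powpow T n x)"
  proof (rule monotone_operator_convergent[where c = 1])
    show "norm (- powpow T n x) \<le> 1 * norm x" for n x
      using contraction_pow[OF contraction_adj[OF T], of n "(T ^^ n) x"] contraction_pow[OF T, of n x]
      by (simp add: powpow_def)
    fix m n :: nat assume mn: "m \<le> n"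
    have "bounded_clin (\<lambda>x. powpow T m x - powpow T n x)" by (rule bounded_clin_diff[OF c c])
    moreover have "norm ((T ^^ n) x) \<le> norm ((T ^^ m) x)" for x
    proof -
      have "(T ^^ n) x = (T ^^ (n - m)) ((T ^^ m) x)"
        using mn by (metis comp_apply funpow_add le_add_diff_inverse2)
      then show ?thesis using contraction_pow[OF T] by metis
    qed
    ultimately show "positive_op (\<lambda>x. - powpow T n x - - powpow T m x)"
      by (simp add: positive_op_def cinner_diff_right cinner_minus_right powpow_form[OF T]
          power_mono del: of_real_power)
  qed
  then have "convergent (\<lambda>n. powpow T n x)" by (rule convergent_minus_iff[THEN iffD2])
  then show ?thesis unfolding AT_def convergent_LIMSEQ_iff .
qed

lemma AT_form:
  fixes T :: "'a::chilbert \<Rightarrow> 'a"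
  assumes T: "contraction T" shows "(\<lambda>n. (norm ((T ^^ n) x))\<^sup>2) \<longlonglongrightarrow> Re (cinner x (AT T x))"
proof -
  have "(\<lambda>n. Re (cinner x (powpow T n x))) \<longlonglongrightarrow> Re (cinner x (AT T x))"
    by (intro tendsto_Re tendsto_cinner tendsto_const powpow_tendsto_AT[OF T])
  then show ?thesis by (simp add: powpow_form[OF T] del: of_real_power)
qed

lemma AT_eqI:
  fixes T :: "'a::chilbert \<Rightarrow> 'a"
  assumes T: "contraction T" and A: "bounded_clin A"
    and lim: "(\<lambda>n. onorm (\<lambda>x. powpow T n x - A x)) \<longlonglongrightarrow> 0"
  shows "AT T = A"
proof
  fix x
  have "(\<lambda>n. powpow T n x - A x) \<longlonglongrightarrow> 0"
  proof (rule Lim_null_comparison)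
    show "\<forall>\<^sub>F n in sequentially. norm (powpow T n x - A x) \<le> onorm (\<lambda>x. powpow T n x - A x) * norm x"
      using clin_norm[OF bounded_clin_diff[OF powpow_clin[OF T] A]] by simp
    show "(\<lambda>n. onorm (\<lambda>x. powpow T n x - A x) * norm x) \<longlonglongrightarrow> 0"
      using tendsto_mult_left_zero[OF lim] .
  qed
  then have "(\<lambda>n. powpow T n x) \<longlonglongrightarrow> A x" by (rule LIM_zero_cancel)
  then show "AT T x = A x" using powpow_tendsto_AT[OF T] LIMSEQ_unique by blast
qed

section \<open>Shifting a filtered set\<close>

text \<open>Transfinite greedy choice along the cardinal well-order: fewer than \<open>|S|\<close> values are
  forbidden at each step, so \<open>f b\<close> can also be chosen above \<open>b\<close>.\<close>
lemma increasing_injection: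
  assumes inf: "infinite S" and L: "\<And>b. b \<in> S \<Longrightarrow> L b \<subseteq> S"
    and card: "\<And>b. b \<in> S \<Longrightarrow> ordLeq2 (card_of S) (card_of (L b))"
  shows "\<exists>f. inj_on f S \<and> (\<forall>b\<in>S. f b \<in> L b) \<and> wf {(b, f b) |b. b \<in> S}"
proof -
  define r where "r = card_of S"
  have r: "Card_order r" "Well_order r" "Field r = S"
    unfolding r_def by (rule card_of_Card_order, rule card_of_Well_order, rule Field_card_of)
  have wf: "wf (r - Id)" using r(2) by (simp add: well_order_on_def)
  have tot: "(x, y) \<in> r \<or> (y, x) \<in> r" if "x \<in> S" "y \<in> S" for x y
    using r(2) that
    unfolding well_order_on_def linear_order_on_def partial_order_on_def preorder_on_def
      total_on_def refl_on_def r(3) by (cases "x = y") auto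
  \<comment> \<open>Avoiding earlier values gives injectivity; avoiding everything up to
    \<open>b\<close> places \<open>f b\<close> above \<open>b\<close>, so the pairs
    \<open>(b, f b)\<close> inherit well-foundedness from \<open>r\<close>. Outside \<open>S\<close>
    nothing is demanded because the recursion runs over the whole type.\<close>
  define p where "p f b y \<longleftrightarrow> (b \<in> S \<longrightarrow> y \<in> L b \<and> y \<notin> f ` underS r b \<and> y \<notin> under r b)" for f :: "'a \<Rightarrow> 'a" and b y
  have "\<exists>f. \<forall>x. p f x (f x)"
  proof (rule dependent_wf_choice[OF wf])
    fix f g :: "'a \<Rightarrow> 'a" and x y
    assume "\<And>z. (z, x) \<in> r - Id \<Longrightarrow> f z = g z"
    then have "f ` underS r x = g ` underS r x" by (intro image_cong) (auto simp: underS_def)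
    then show "p f x y = p g x y" by (simp add: p_def)
  next
    fix x and f :: "'a \<Rightarrow> 'a"
    show "\<exists>y. p f x y"
    proof (cases "x \<in> S")
      case True
      have u: "ordLess2 (card_of (underS r x)) (card_of S)"
        using card_of_underS[OF r(1)] True r(3) unfolding r_def by simp
      have "under r x \<subseteq> underS r x \<union> {x}" by (auto simp: under_def underS_def)
      moreover have "ordLess2 (card_of {x}) (card_of S)" 
        by (rule finite_ordLess_infinite[OF card_of_Well_order card_of_Well_order]) (simp_all add: inf Field_card_of)
      ultimately have "ordLess2 (card_of (under r x)) (card_of S)"
        using ordLeq_ordLess_trans[OF card_of_mono1 card_of_Un_ordLess_infinite[OF inf u]] by blast
      moreover have "ordLess2 (card_of (f ` underS r x)) (card_of S)"
        by (rule ordLeq_ordLess_trans[OF card_of_image u])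
      ultimately have "ordLess2 (card_of (f ` underS r x \<union> under r x)) (card_of S)"
        by (intro card_of_Un_ordLess_infinite[OF inf])
      then have "ordLess2 (card_of (f ` underS r x \<union> under r x)) (card_of (L x))"
        using card[OF True] by (rule ordLess_ordLeq_trans)
      then have "\<not> L x \<subseteq> f ` underS r x \<union> under r x"
        using card_of_mono1 not_ordLess_ordLeq by blast
      then show ?thesis by (auto simp: p_def)
    qed (simp add: p_def)
  qed
  then obtain f where f: "\<And>b. b \<in> S \<Longrightarrow> f b \<in> L b" "\<And>b. b \<in> S \<Longrightarrow> f b \<notin> f ` underS r b"
    "\<And>b. b \<in> S \<Longrightarrow> f b \<notin> under r b"
    unfolding p_def by metis
  have "inj_on f S"
  proof (rule inj_onI, rule ccontr)
    fix x y assume xy: "x \<in> S" "y \<in> S" "f x = f y" "x \<noteq> y"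
    then have "x \<in> underS r y \<or> y \<in> underS r x" using tot[of x y] by (auto simp: underS_def)
    then show False using f(2) xy by (metis image_eqI)
  qed
  moreover have "wf {(b, f b) |b. b \<in> S}"
  proof (rule wf_subset[OF wf], rule subsetI)
    fix z assume "z \<in> {(b, f b) |b. b \<in> S}"
    then obtain b where z: "z = (b, f b)" and b: "b \<in> S" by blast
    have "(f b, b) \<notin> r" using f(3)[OF b] by (simp add: under_def)
    moreover have "f b \<in> S" using f(1)[OF b] L[OF b] by blast
    ultimately show "z \<in> r - Id" using tot[OF b, of "f b"] tot[OF b b] by (auto simp: z)
  qed
  ultimately show ?thesis using f(1) by blast
qed

text \<open>Elements of every level, collected in \<open>N\<close>, cannot be raised further. If
  \<open>N\<close> is as large as \<open>B\<close>, everything is sent into it; otherwise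
  \<open>N\<close> and its complement are mapped into themselves separately. Well-foundedness says
  that going backwards along \<open>f\<close> always stops; it would fail for a finite nonempty
  \<open>N\<close>, on which the identity is used.\<close>

lemma level_injection:
  fixes L :: "nat \<Rightarrow> 'b set"
  assumes inf: "infinite B" and LB: "\<And>m. L m \<subseteq> B" and dec': "\<forall>m n. m \<le> n \<longrightarrow> L n \<subseteq> L m"
    and card: "\<And>m. ordLeq2 (card_of B) (card_of (L m))"
  shows "\<exists>f. inj_on f B \<and> f ` B \<subseteq> B \<and> (\<forall>m. \<forall>b\<in>L m. f b \<in> L (Suc m)) \<and>
    ((\<Inter>m. L m) = {} \<or> infinite (\<Inter>m. L m) \<longrightarrow> wf {(b, f b) |b. b \<in> B})"
proof -
  have dec: "L n \<subseteq> L m" if "m \<le> n" for m n using dec' that by blast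
  define N where "N = (\<Inter>m. L m)"
  have NL: "N \<subseteq> L m" for m by (auto simp: N_def)
  have NB: "N \<subseteq> B" using NL LB by blast
  show ?thesis
  proof (cases "ordLeq2 (card_of B) (card_of N)")
    case True
    from increasing_injection[of B "\<lambda>_. N", OF inf NB True]
    obtain f where f: "inj_on f B" "\<forall>b\<in>B. f b \<in> N" "wf {(b, f b) |b. b \<in> B}" by blast
    have "f b \<in> L (Suc m)" if "b \<in> L m" for b m using f(2) LB NL that by blast
    moreover have "f ` B \<subseteq> B" using f(2) NB by blast
    ultimately show ?thesis using f(1,3) by (intro exI[of _ f] conjI allI ballI impI)
  next
    case False
    then have Nless: "ordLess2 (card_of N) (card_of B)"
      using not_ordLeq_iff_ordLess[OF card_of_Well_order card_of_Well_order] by blast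
    \<comment> \<open>A union of two sets smaller than the infinite \<open>B\<close> is again
      smaller, so removing \<open>N\<close> does not shrink a level.\<close>
    have large: "ordLeq2 (card_of B) (card_of (L m - N))" for m
    proof (rule ccontr)
      assume "\<not> ?thesis"
      then have "ordLess2 (card_of (L m - N)) (card_of B)"
        using not_ordLeq_iff_ordLess[OF card_of_Well_order card_of_Well_order] by blast
      from card_of_Un_ordLess_infinite[OF inf this Nless]
      have "ordLess2 (card_of (L m)) (card_of B)" using NL[of m] by (simp add: Un_absorb2)
      then show False using card not_ordLess_ordLeq by blast
    qed
    define S where "S = B - N"
    define K where "K b = {c \<in> S. \<forall>m. b \<in> L m \<longrightarrow> c \<in> L (Suc m)}" for b
    have SB: "ordLeq2 (card_of S) (card_of B)" unfolding S_def by (rule card_of_mono1) blast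
    have infS: "infinite S"
    proof -
      have "L 0 - N \<subseteq> S" using LB by (auto simp: S_def)
      then show ?thesis using card_of_ordLeq_infinite[OF large[of 0] inf] by (rule infinite_super)
    qed
    have "ordLeq2 (card_of S) (card_of (K b))" if "b \<in> S" for b
    proof -
      have "b \<notin> N" using that by (simp add: S_def)
      then obtain M where M: "b \<notin> L M" unfolding N_def by blast
      \<comment> \<open>\<open>b\<close> has only levels below \<open>M\<close>, so every element of
        level \<open>M\<close> is at least one level higher than each of them.\<close>
      have "L M - N \<subseteq> K b"
      proof
        fix c assume c: "c \<in> L M - N"
        have "c \<in> L (Suc m)" if "b \<in> L m" for m
        proof -
          have "m < M" using that M dec by (meson not_less subsetD)
          then show ?thesis using c dec[of "Suc m" M] by auto
        qed
        then show "c \<in> K b" using c LB by (auto simp: K_def S_def)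
      qed
      then have "ordLeq2 (card_of B) (card_of (K b))"
        using large ordLeq_transitive card_of_mono1 by blast
      then show ?thesis using SB ordLeq_transitive by blast
    qed
    from increasing_injection[of S K, OF infS _ this]
    obtain f where f: "inj_on f S" "\<forall>b\<in>S. f b \<in> K b" "wf {(b, f b) |b. b \<in> S}"
      by (auto simp: K_def)
    have "\<exists>g. inj_on g N \<and> g ` N \<subseteq> N \<and> (N = {} \<or> infinite N \<longrightarrow> wf {(b, g b) |b. b \<in> N})"
    proof (cases "finite N")
      case True
      then show ?thesis by (intro exI[of _ "\<lambda>x. x"]) auto
    next
      case False
      from increasing_injection[of N "\<lambda>_. N", OF False order_refl card_of_mono1[OF order_refl]]
      show ?thesis by blast
    qed
    then obtain g where g: "inj_on g N" "g ` N \<subseteq> N" "N = {} \<or> infinite N \<longrightarrow> wf {(b, g b) |b. b \<in> N}" by blast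
    define h where "h b = (if b \<in> N then g b else f b)" for b
    have fS: "f b \<in> S" if "b \<in> S" for b using f(2) that by (auto simp: K_def)
    have "inj_on h B"
    proof (rule inj_onI)
      fix x y assume xy: "x \<in> B" "y \<in> B" "h x = h y"
      show "x = y"
        using xy inj_onD[OF f(1), of x y] inj_onD[OF g(1), of x y] fS[of x] fS[of y] g(2)
        unfolding h_def S_def by (auto split: if_splits)
    qed
    moreover have "h ` B \<subseteq> B" using fS g(2) NB unfolding h_def S_def by auto
    moreover have "h b \<in> L (Suc m)" if "b \<in> L m" for b m
    proof (cases "b \<in> N")
      case True
      then show ?thesis using g(2) NL by (auto simp: h_def)
    next
      case False
      then have "b \<in> S" using that LB by (auto simp: S_def)
      then show ?thesis using f(2) that False by (auto simp: h_def K_def)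
    qed
    moreover have "wf {(b, h b) |b. b \<in> B}" if "N = {} \<or> infinite N"
    proof -
      have "{(b, h b) |b. b \<in> B} = {(b, f b) |b. b \<in> S} \<union> {(b, g b) |b. b \<in> N}"
        using NB by (auto simp: h_def S_def)
      \<comment> \<open>An arrow of \<open>g\<close> ends in \<open>N\<close> and an arrow of
        \<open>f\<close> starts outside it, so joining the two relations creates no new infinite
        backward path.\<close>
      moreover have "Domain {(b, f b) |b. b \<in> S} \<inter> Range {(b, g b) |b. b \<in> N} = {}"
        using g(2) by (auto simp: S_def)
      ultimately show ?thesis using wf_Un[OF f(3)] g(3) that by simp
    qed
    ultimately show ?thesis
      unfolding N_def[symmetric] by (intro exI[of _ h] conjI allI ballI impI)
  qed
qed

section \<open>A contraction with prescribed asymptotic limit\<close>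

lemma tendsto_zero_closure:
  fixes D :: "nat \<Rightarrow> 'a::complex_inner \<Rightarrow> 'a"
  assumes D: "\<And>n. bounded_clin (D n)" and b: "\<And>n x. norm (D n x) \<le> norm x"
    and M: "\<And>x. x \<in> M \<Longrightarrow> (\<lambda>n. D n x) \<longlonglongrightarrow> 0" and x: "x \<in> closure M"
  shows "(\<lambda>n. D n x) \<longlonglongrightarrow> 0"
proof (rule LIMSEQ_I)
  fix e :: real assume e: "e > 0"
  then obtain y where y: "y \<in> M" "dist y x < e / 2"
    using x unfolding closure_approachable by (meson half_gt_zero)
  obtain N where N: "\<And>n. n \<ge> N \<Longrightarrow> norm (D n y - 0) < e / 2"
    using LIMSEQ_D[OF M[OF y(1)], of "e / 2"] e by auto
  have "norm (D n x - 0) < e" if "n \<ge> N" for n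
  proof -
    have "norm (D n x) \<le> norm (D n y) + norm (D n (x - y))"
      using norm_triangle_ineq[of "D n y" "D n (x - y)"] by (simp add: clin_diff[OF D])
    also have "norm (D n (x - y)) \<le> dist y x" using b[of n "x - y"] by (simp add: dist_norm norm_minus_commute)
    finally show ?thesis using N[OF that] y(2) by simp
  qed
  then show "\<exists>N. \<forall>n\<ge>N. norm (D n x - 0) < e" by (intro exI[of _ N] allI impI)
qed

context positive_contraction
begin

section \<open>The square root of A along the flag of spectral subspaces\<close>

definition root :: "'a \<Rightarrow> 'a" where
  "root = (SOME S. positive_op S \<and> (\<forall>x. S (S x) = A x) \<and>
     (\<forall>Z. bounded_clin Z \<longrightarrow> (\<forall>x. Z (A x) = A (Z x)) \<longrightarrow> (\<forall>x. Z (S x) = S (Z x))))"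

lemma
  shows root_pos: "positive_op root" and root_root: "root (root x) = A x"
    and root_comm: "bounded_clin Z \<Longrightarrow> (\<And>x. Z (A x) = A (Z x)) \<Longrightarrow> Z (root x) = root (Z x)"
proof -
  note r = someI_ex[OF positive_op_sqrt[OF pos contr], folded root_def]
  show "positive_op root" "root (root x) = A x"
    using r[THEN conjunct1] r[THEN conjunct2, THEN conjunct1] by simp_all
  show "Z (root x) = root (Z x)" if "bounded_clin Z" "\<And>x. Z (A x) = A (Z x)"
    using r[THEN conjunct2, THEN conjunct2, rule_format, OF that] .
qed

lemma root_sa: "selfadj root" by (rule positive_op_selfadj[OF root_pos])
lemma root_clin: "bounded_clin root" by (rule selfadj_clin[OF root_sa])

lemma root_norm: "(norm (root x))\<^sup>2 = Re (cinner x (A x))"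
proof -
  have "cinner (root x) (root x) = cinner x (A x)" by (simp add: selfadj_swap[OF root_sa] root_root)
  then show ?thesis by (metis cinner_self_Re)
qed

lemma root_norm_le: "norm (root x) \<le> norm x"
proof (rule power2_le_imp_le)
  show "(norm (root x))\<^sup>2 \<le> (norm x)\<^sup>2" unfolding root_norm by (rule form_le)
qed simp

lemma root_Q: "root (Q l x) = Q l (root x)"
  by (rule root_comm[of "Q l", OF Q_clin, symmetric]) (simp add: Q_A)

lemma root_P: "root (P l x) = P l (root x)"
  by (simp add: P_def clin_diff[OF root_clin] root_Q)

lemma root_inj: assumes "P 0 x = x" "root x = 0" shows "x = 0"
proof (rule ccontr)
  assume "x \<noteq> 0"
  from P_form_gt[OF assms(1) this] show False
    unfolding root_norm[symmetric] assms(2) by simp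
qed

lemma root_P0: "root (P 0 x) = root x"
proof -
  have "norm (root (x - P 0 x)) ^ 2 = 0"
    unfolding root_norm by (simp add: clin_diff[OF clin] A_P0)
  then show ?thesis by (simp add: clin_diff[OF root_clin])
qed

lemma root_Q_upper: "(norm (root (Q l x)))\<^sup>2 \<le> l * (norm (Q l x))\<^sup>2"
  unfolding root_norm by (rule Q_form_le[OF Q_idem])

lemma root_P_lower: "l * (norm (P l x))\<^sup>2 \<le> (norm (root (P l x)))\<^sup>2"
  unfolding root_norm
  using P_form_gt[OF P_idem, of l x] by (cases "P l x = 0") (simp_all add: clin_zero[OF clin])

lemma root_interval:
  assumes "l \<le> m"
  shows "l * (norm (Q m x - Q l x))\<^sup>2 \<le> (norm (root (Q m x - Q l x)))\<^sup>2"
    "(norm (root (Q m x - Q l x)))\<^sup>2 \<le> m * (norm (Q m x - Q l x))\<^sup>2"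
proof -
  have "P l (Q m x) = Q m x - Q l x" using Q_mono(2)[OF assms] by (simp add: P_def)
  then show "l * (norm (Q m x - Q l x))\<^sup>2 \<le> (norm (root (Q m x - Q l x)))\<^sup>2"
    using root_P_lower[of l "Q m x"] by simp
  have "Q m (x - Q l x) = Q m x - Q l x" using Q_mono(1)[OF assms] by (simp add: clin_diff[OF Q_clin])
  then show "(norm (root (Q m x - Q l x)))\<^sup>2 \<le> m * (norm (Q m x - Q l x))\<^sup>2"
    using root_Q_upper[of m "x - Q l x"] by simp
qed

lemma Q_norm_split:
  assumes "l \<le> m" shows "(norm (Q m x))\<^sup>2 = (norm (Q l x))\<^sup>2 + (norm (Q m x - Q l x))\<^sup>2"
  using orth_proj_pyth[OF Q_proj, of "Q m x" l] Q_mono(2)[OF assms] by simp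

lemma QP_norm_split: "(norm x)\<^sup>2 = (norm (Q l x))\<^sup>2 + (norm (P l x))\<^sup>2"
  using orth_proj_pyth[OF Q_proj, of x l] by (simp add: P_def)

text \<open>Levels from 0 increasing to 1 without reaching it; \<open>1 / lev m - 1\<close> is
  exactly the final error bound \<open>1 / m\<close>.\<close>

definition lev :: "nat \<Rightarrow> real" where "lev m = real m / (real m + 1)"

lemma lev_0 [simp]: "lev 0 = 0" by (simp add: lev_def)
lemma lev_mono: "m \<le> n \<Longrightarrow> lev m \<le> lev n" by (simp add: lev_def field_simps)
lemma lev_less_1: "lev m < 1" by (simp add: lev_def)
lemma lev_nonneg: "0 \<le> lev m" by (simp add: lev_def)
lemma lev_pos: "m > 0 \<Longrightarrow> 0 < lev m" by (simp add: lev_def)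
lemma inverse_lev: "m > 0 \<Longrightarrow> 1 / lev m = 1 + 1 / real m" by (simp add: lev_def field_simps)

lemma eigenvector_one_lev: "A x = x \<longleftrightarrow> (\<forall>m. P (lev m) x = x)"
  unfolding eigenvector_one_iff
proof (intro iffI allI impI)
  fix l :: real assume *: "\<forall>m. P (lev m) x = x" and l: "l < 1"
  obtain m :: nat where "1 / (1 - l) < real m" using reals_Archimedean2 by blast
  then have "1 < real m * (1 - l)" using l by (simp add: field_simps)
  then have "l \<le> lev m" using l by (simp add: lev_def field_simps)
  from P_mono(1)[OF this, of x] show "P l x = x" using * by simp
qed (simp add: lev_less_1)

text \<open>\<open>root\<close> need not be bounded below, but it is above level \<open>c\<close>.
  Gluing it to the identity on the complement gives an invertible \<open>W\<close>, and preceding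
  its inverse by \<open>P c\<close> discards the artificial part.\<close>

lemma root_inverse_exists:
  assumes c: "0 < c" "c \<le> 1"
  shows "\<exists>R. bounded_clin R \<and> (\<forall>x. root (R x) = P c x) \<and> (\<forall>x. P c (R x) = R x)"
proof -
  define W where "W x = root (P c x) + (x - P c x)" for x
  have cW: "bounded_clin W"
    unfolding W_def[abs_def]
    by (rule bounded_clin_add[OF bounded_clin_comp[OF root_clin P_clin] bounded_clin_diff[OF bounded_clin_id(1) P_clin]])
  have saW: "selfadj W"
    using cW by (simp add: selfadj_def W_def cinner_algebra selfadj_swap[OF root_sa] P_swap root_P)
  have PW: "P c (W x) = root (P c x)" for x
    by (simp add: W_def clin_add[OF P_clin] clin_diff[OF P_clin] P_idem root_P)
  \<comment> \<open>The squared norm shrinks by at most the factor \<open>c\<close> above the level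
    and not at all on the complement; both exceed \<open>c^2\<close> since
    \<open>c \<le> 1\<close>.\<close>
  have below: "c * norm x \<le> norm (W x)" for x
  proof (rule power2_le_imp_le)
    have "W x - P c (W x) = x - P c x" unfolding PW by (simp add: W_def)
    then have "(norm (W x))\<^sup>2 = (norm (root (P c x)))\<^sup>2 + (norm (x - P c x))\<^sup>2"
      using orth_proj_pyth[OF P_proj, of "W x" c] by (simp add: PW)
    moreover have "c\<^sup>2 * (norm (P c x))\<^sup>2 \<le> c * (norm (P c x))\<^sup>2"
      using c by (intro mult_right_mono) (simp_all add: power2_eq_square mult_left_le)
    moreover have "c\<^sup>2 * (norm (x - P c x))\<^sup>2 \<le> 1 * (norm (x - P c x))\<^sup>2"
      using c by (intro mult_right_mono) (simp_all add: power_le_one)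
    moreover have "c\<^sup>2 * (norm x)\<^sup>2 = c\<^sup>2 * (norm (P c x))\<^sup>2 + c\<^sup>2 * (norm (x - P c x))\<^sup>2"
      unfolding orth_proj_pyth[OF P_proj, of x c] by (rule distrib_left)
    ultimately show "(c * norm x)\<^sup>2 \<le> (norm (W x))\<^sup>2"
      unfolding power_mult_distrib using root_P_lower[of c x] by linarith
  qed simp
  have "\<exists>R. bounded_clin R \<and> (\<forall>x. W (R x) = x) \<and> (\<forall>x. R (W x) = x)"
    by (rule inverse_of_bounded_below[OF cW c(1) below]) (simp only: selfadj_adj[OF saW] below)
  then obtain R where R: "bounded_clin R" "\<And>x. W (R x) = x" "\<And>x. R (W x) = x" by blast
  have WP: "W (P c x) = root (P c x)" for x by (simp add: W_def P_idem)
  have "P c (R (P c x)) = R (P c x)" for x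
  proof -
    have "W (P c (R (P c x))) = P c (W (R (P c x)))" by (simp add: WP PW)
    also have "\<dots> = P c x" by (simp add: R(2) P_idem)
    finally have "R (W (P c (R (P c x)))) = R (P c x)" by simp
    then show ?thesis by (simp only: R(3))
  qed
  moreover from this have "root (R (P c x)) = P c x" for x
    using WP[of "R (P c x)"] R(2)[of "P c x"] by simp
  moreover have "bounded_clin (\<lambda>x. R (P c x))" by (rule bounded_clin_comp[OF R(1) P_clin])
  ultimately show ?thesis by blast
qed

text \<open>If the isometric image \<open>w\<close> of \<open>u = root x\<close> lies one level higher in the flag, then
  dividing by \<open>root\<close> does not increase the norm. By summation by parts along the flag the claim
  reduces to comparing the tails of \<open>w\<close> and \<open>u\<close>.\<close>
lemma flag_norm_le:
  assumes y: "P (lev (Suc 0)) y = y" and eq: "norm (root y) \<le> norm (root x)"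
    and tail: "\<And>m. norm (Q (lev (Suc m)) (root y)) \<le> norm (Q (lev m) (root x))"
  shows "norm y \<le> norm x"
proof -
  define u where "u = root x"
  define w where "w = root y"
  define p where "p n = (norm (Q (lev n) u))\<^sup>2" for n
  define q where "q n = (norm (Q (lev n) w))\<^sup>2" for n
  \<comment> \<open>The inequality that propagates along the flag has the boundary terms of the
    summation by parts subtracted. It starts at 1 because \<open>lev 0 = 0\<close>.\<close>
  have G: "(norm (Q (lev n) y))\<^sup>2 - q n / lev n \<le> (norm (Q (lev n) x))\<^sup>2 - p n / lev n" if "n \<ge> 1" for n
    using that
  proof (induction n rule: dec_induct)
    case base
    have Q1: "Q (lev (Suc 0)) y = 0" using y by (simp add: P_def)
    have "p (Suc 0) \<le> lev (Suc 0) * (norm (Q (lev (Suc 0)) x))\<^sup>2"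
      using root_Q_upper[of "lev (Suc 0)" x] by (simp add: p_def u_def root_Q)
    then have "p (Suc 0) / lev (Suc 0) \<le> (norm (Q (lev (Suc 0)) x))\<^sup>2"
      using lev_pos[of "Suc 0"] by (simp add: divide_le_eq mult.commute)
    moreover have "q (Suc 0) = 0"
      unfolding q_def w_def root_Q[symmetric] Q1 by (simp add: clin_zero[OF root_clin])
    ultimately show ?case by (simp add: Q1)
  next
    case (step n)
    let ?l = "lev n" and ?m = "lev (Suc n)"
    have lm: "?l \<le> ?m" by (rule lev_mono) simp
    have l0: "0 < ?l" and m0: "0 < ?m" using step lev_pos by simp_all
    have qd: "(norm (root (Q ?m y - Q ?l y)))\<^sup>2 = q (Suc n) - q n"
      using Q_norm_split[OF lm, of w] by (simp add: q_def w_def root_Q clin_diff[OF root_clin])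
    have pd: "(norm (root (Q ?m x - Q ?l x)))\<^sup>2 = p (Suc n) - p n"
      using Q_norm_split[OF lm, of u] by (simp add: p_def u_def root_Q clin_diff[OF root_clin])
    have 1: "(norm (Q ?m y - Q ?l y))\<^sup>2 \<le> (q (Suc n) - q n) / ?l"
      using root_interval(1)[OF lm, of y] l0 unfolding qd by (simp add: le_divide_eq mult.commute)
    have 2: "(p (Suc n) - p n) / ?m \<le> (norm (Q ?m x - Q ?l x))\<^sup>2"
      using root_interval(2)[OF lm, of x] m0 unfolding pd by (simp add: divide_le_eq mult.commute)
    have d: "0 \<le> 1 / ?l - 1 / ?m" using lm l0 by (simp add: divide_left_mono)
    \<comment> \<open>The tails are compared one level apart; the weights multiplying them are
      nonnegative because the levels increase.\<close>
    have "q (Suc n) \<le> p n" unfolding q_def p_def u_def w_def by (intro power_mono tail) simp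
    then have 3: "q (Suc n) * (1 / ?l - 1 / ?m) \<le> p n * (1 / ?l - 1 / ?m)" by (intro mult_right_mono d)
    have "(norm (Q ?m y))\<^sup>2 - q (Suc n) / ?m
        \<le> (norm (Q ?l y))\<^sup>2 + (q (Suc n) - q n) / ?l - q (Suc n) / ?m"
      using Q_norm_split[OF lm, of y] 1 by simp
    also have "\<dots> = ((norm (Q ?l y))\<^sup>2 - q n / ?l) + q (Suc n) * (1 / ?l - 1 / ?m)"
      by (simp add: diff_divide_distrib right_diff_distrib)
    also have "\<dots> \<le> ((norm (Q ?l x))\<^sup>2 - p n / ?l) + p n * (1 / ?l - 1 / ?m)"
      using step.IH 3 by (rule add_mono)
    also have "\<dots> = (norm (Q ?l x))\<^sup>2 + (p (Suc n) - p n) / ?m - p (Suc n) / ?m"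
      by (simp add: diff_divide_distrib right_diff_distrib)
    also have "\<dots> \<le> (norm (Q ?m x))\<^sup>2 - p (Suc n) / ?m"
      using Q_norm_split[OF lm, of x] 2 by simp
    finally show ?case .
  qed
  \<comment> \<open>Above level \<open>n\<close>, squared norms before and after applying
    \<open>root\<close> differ at most by the factor \<open>lev n\<close>, which tends to 1.\<close>
  have bound: "(norm y)\<^sup>2 \<le> (norm x)\<^sup>2 * (1 + 1 / real n)" if n: "n \<ge> 1" for n
  proof -
    let ?l = "lev n"
    have l0: "0 < ?l" using n lev_pos by simp
    have Pw: "(norm (root (P ?l y)))\<^sup>2 = (norm w)\<^sup>2 - q n"
      using QP_norm_split[of w ?l] by (simp add: q_def w_def root_P)
    have Pu: "(norm (root (P ?l x)))\<^sup>2 = (norm u)\<^sup>2 - p n"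
      using QP_norm_split[of u ?l] by (simp add: p_def u_def root_P)
    have 1: "(norm (P ?l y))\<^sup>2 \<le> ((norm w)\<^sup>2 - q n) / ?l"
      using root_P_lower[of ?l y] l0 unfolding Pw by (simp add: le_divide_eq mult.commute)
    have 2: "(norm u)\<^sup>2 - p n \<le> (norm (P ?l x))\<^sup>2"
      unfolding Pu[symmetric] by (intro power_mono root_norm_le) simp
    have wu: "(norm w)\<^sup>2 / ?l \<le> (norm u)\<^sup>2 / ?l"
      using eq l0 by (intro divide_right_mono power_mono) (simp_all add: u_def w_def)
    have "(norm y)\<^sup>2 \<le> (norm (Q ?l y))\<^sup>2 + ((norm w)\<^sup>2 - q n) / ?l"
      using QP_norm_split[of y ?l] 1 by simp
    also have "\<dots> \<le> (norm (Q ?l x))\<^sup>2 + ((norm u)\<^sup>2 - p n) / ?l"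
      using G[OF n] wu by (simp add: diff_divide_distrib)
    also have "\<dots> \<le> (norm (Q ?l x))\<^sup>2 + (norm (P ?l x))\<^sup>2 / ?l"
      using divide_right_mono[OF 2, of ?l] l0 by simp
    also have "\<dots> \<le> (norm (Q ?l x))\<^sup>2 / ?l + (norm (P ?l x))\<^sup>2 / ?l"
      using mult_left_mono[of 1 "1 / ?l" "(norm (Q ?l x))\<^sup>2"] l0 lev_less_1[of n] by simp
    also have "\<dots> = (norm x)\<^sup>2 * (1 / ?l)" using QP_norm_split[of x ?l] by (simp add: add_divide_distrib)
    finally show ?thesis using inverse_lev[of n] n by simp
  qed
  have "(norm y)\<^sup>2 \<le> (norm x)\<^sup>2 * (1 + 0)"
  proof (rule LIMSEQ_le_const)
    show "(\<lambda>n. (norm x)\<^sup>2 * (1 + 1 / real n)) \<longlonglongrightarrow> (norm x)\<^sup>2 * (1 + 0)"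
      by (intro tendsto_intros lim_1_over_n)
    show "\<exists>N. \<forall>n\<ge>N. (norm y)\<^sup>2 \<le> (norm x)\<^sup>2 * (1 + 1 / real n)" using bound by blast
  qed
  then have "(norm y)\<^sup>2 \<le> (norm x)\<^sup>2" by simp
  then show ?thesis by (rule power2_le_imp_le) simp
qed

text \<open>\<open>root\<close> intertwines \<open>T\<close> with \<open>V\<close>, so
  \<open>root (T^n x) = V^n (root x)\<close> keeps the norm of \<open>root x\<close> while it climbs
  to level \<open>n\<close>. There \<open>root\<close> almost preserves norms, and hence
  \<open>||T^n x||\<close> is almost \<open>||root x||\<close>.\<close>

lemma contraction_of_flag_shift:
  assumes V: "bounded_clin V" and VP: "\<And>x. V (P 0 x) = V x" and Vn: "\<And>x. norm (V x) = norm (P 0 x)"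
    and shift': "\<forall>m x. P (lev m) x = x \<longrightarrow> P (lev (Suc m)) (V x) = V x"
  shows "\<exists>T. contraction T \<and> (\<lambda>n. onorm (\<lambda>x. powpow T n x - A x)) \<longlonglongrightarrow> 0 \<and>
    ((\<forall>x. (\<lambda>n. (adj V ^^ n) x) \<longlonglongrightarrow> 0) \<longrightarrow> class_C_dot0 T)"
proof -
  have shift: "P (lev (Suc m)) (V x) = V x" if "P (lev m) x = x" for m x using shift' that by blast
  \<comment> \<open>The range of \<open>V\<close> lies on level 1, that is above 1/2, where
    \<open>root\<close> has a bounded inverse.\<close>
  obtain R where R: "bounded_clin R" "\<And>x. root (R x) = P (lev (Suc 0)) x" "\<And>x. P (lev (Suc 0)) (R x) = R x"
    using root_inverse_exists[of "lev (Suc 0)"] lev_pos[of "Suc 0"] lev_less_1[of "Suc 0"] by (auto simp: less_imp_le)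
  define T where "T x = R (V (root x))" for x
  have cT: "bounded_clin T"
    unfolding T_def[abs_def] by (rule bounded_clin_comp[OF R(1) bounded_clin_comp[OF V root_clin]])
  have P1V: "P (lev (Suc 0)) (V x) = V x" for x
    using shift[of 0 "P 0 x"] by (simp add: VP P_idem)
  have rT: "root (T x) = V (root x)" for x by (simp add: T_def R(2) P1V)
  have P1T: "P (lev (Suc 0)) (T x) = T x" for x by (simp add: T_def R(3))
  have P01: "P 0 x = x" if "P (lev m) x = x" for m x
    using P_mono(1)[OF lev_nonneg[of m], of x] that by simp
  have "norm (T x) \<le> norm (P 0 x)" for x
  proof (rule flag_norm_le[OF P1T])
    have u: "root (P 0 x) = root x" by (rule root_P0)
    show "norm (root (T x)) \<le> norm (root (P 0 x))"
      unfolding rT u Vn by (rule orth_proj_norm[OF P_proj])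
    fix m
    let ?u = "root x"
    \<comment> \<open>The part of \<open>root x\<close> above level \<open>m\<close> is shifted
      above level \<open>m + 1\<close>, so it does not contribute to the lower tail of the
      image.\<close>
    have "V ?u = V (Q (lev m) ?u) + V (P (lev m) ?u)"
      by (simp add: clin_add[OF V, symmetric] P_def)
    moreover have "Q (lev (Suc m)) (V (P (lev m) ?u)) = 0"
      using shift[OF P_idem, of m ?u] by (simp add: P_def[of "lev (Suc m)"])
    ultimately have "Q (lev (Suc m)) (V ?u) = Q (lev (Suc m)) (V (Q (lev m) ?u))"
      by (simp add: clin_add[OF Q_clin])
    moreover have "norm (Q (lev (Suc m)) (V (Q (lev m) ?u))) \<le> norm (Q (lev m) ?u)"
      by (rule order_trans[OF orth_proj_norm[OF Q_proj]]) (simp only: Vn orth_proj_norm[OF P_proj])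
    ultimately show "norm (Q (lev (Suc m)) (root (T x))) \<le> norm (Q (lev m) (root (P 0 x)))"
      unfolding rT u by (simp only:)
  qed
  then have T: "contraction T"
    unfolding contraction_iff using cT orth_proj_norm[OF P_proj] order_trans by blast
  have rTn: "root ((T ^^ n) x) = (V ^^ n) (root x)" for n x
    by (induction n) (simp_all add: rT)
  have Vn_lev: "P (lev n) ((V ^^ n) (root x)) = (V ^^ n) (root x) \<and> norm ((V ^^ n) (root x)) = norm (root x)" for n x
  proof (induction n)
    case 0
    show ?case by (simp add: root_P[symmetric] root_P0)
  next
    case (Suc n)
    then show ?case using shift[of n "(V ^^ n) (root x)"] P01[of n "(V ^^ n) (root x)"] by (simp add: Vn)
  qed
  \<comment> \<open>For \<open>n = 0\<close> the vector may have a component in the kernel of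
    \<open>A\<close>, which \<open>root\<close> does not see; every later iterate lies on level
    1.\<close>
  have Tn_lev: "P (lev n) ((T ^^ n) x) = (T ^^ n) x" if n: "n \<ge> 1" for n x
  proof -
    let ?y = "(T ^^ n) x"
    obtain k where k: "n = Suc k" using n by (cases n) auto
    have y1: "P (lev (Suc 0)) ?y = ?y" by (simp add: k P1T)
    have "root (?y - P (lev n) ?y) = 0"
      by (simp add: clin_diff[OF root_clin] root_P rTn Vn_lev)
    moreover have "P 0 (?y - P (lev n) ?y) = ?y - P (lev n) ?y"
      using P01[OF y1] P_mono(1)[OF lev_nonneg[of n], of ?y] by (simp add: clin_diff[OF P_clin])
    ultimately have "?y - P (lev n) ?y = 0" by (rule root_inj[rotated])
    then show ?thesis by simp
  qed
  have lower: "Re (cinner x (A x)) \<le> (norm ((T ^^ n) x))\<^sup>2" for n x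
  proof -
    have "norm (root x) \<le> norm ((T ^^ n) x)"
      using root_norm_le[of "(T ^^ n) x"] by (simp add: rTn Vn_lev)
    then show ?thesis unfolding root_norm[symmetric] by (simp add: power_mono)
  qed
  have upper: "(norm ((T ^^ n) x))\<^sup>2 - Re (cinner x (A x)) \<le> 1 / real n * (norm x)\<^sup>2" if n: "n \<ge> 1" for n x
  proof -
    have "lev n * (norm ((T ^^ n) x))\<^sup>2 \<le> (norm (root ((T ^^ n) x)))\<^sup>2"
      using root_P_lower[of "lev n" "(T ^^ n) x"] unfolding Tn_lev[OF n] .
    then have "lev n * (norm ((T ^^ n) x))\<^sup>2 \<le> (norm (root x))\<^sup>2" by (simp add: rTn Vn_lev)
    then have "(norm ((T ^^ n) x))\<^sup>2 \<le> (norm (root x))\<^sup>2 * (1 / lev n)"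
      using lev_pos[of n] n by (simp add: le_divide_eq mult.commute)
    also have "\<dots> = (norm (root x))\<^sup>2 + 1 / real n * (norm (root x))\<^sup>2"
      using inverse_lev[of n] n by (simp add: algebra_simps)
    also have "\<dots> \<le> (norm (root x))\<^sup>2 + 1 / real n * (norm x)\<^sup>2"
      by (intro add_left_mono mult_left_mono power_mono root_norm_le) simp_all
    finally show ?thesis by (simp add: root_norm)
  qed
  have on: "onorm (\<lambda>x. powpow T n x - A x) \<le> 1 / real n" if n: "n \<ge> 1" for n
  proof (rule onorm_bound)
    have form: "Re (cinner x (powpow T n x - A x)) = (norm ((T ^^ n) x))\<^sup>2 - Re (cinner x (A x))" for x
      by (simp add: cinner_diff_right powpow_form[OF T] del: of_real_power)
    have im: "Im (cinner x (powpow T n x - A x)) = 0" for x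
    proof -
      have "Im (cinner x (A x)) = 0" using pos by (simp add: positive_op_def)
      then show ?thesis by (simp add: cinner_diff_right powpow_form[OF T] del: of_real_power)
    qed
    have D: "positive_op (\<lambda>x. powpow T n x - A x)"
      unfolding positive_op_def
    proof (intro conjI allI)
      show "bounded_clin (\<lambda>x. powpow T n x - A x)" by (rule bounded_clin_diff[OF powpow_clin[OF T] clin])
      show "Im (cinner x (powpow T n x - A x)) = 0" for x by (rule im)
      show "0 \<le> Re (cinner x (powpow T n x - A x))" for x using lower[of x n] by (simp add: form)
    qed
    show "norm (powpow T n x - A x) \<le> 1 / real n * norm x" for x
      by (rule positive_op_norm_le[OF D]) (simp_all only: form upper[OF n], simp)
  qed simp
  have lim: "(\<lambda>n. onorm (\<lambda>x. powpow T n x - A x)) \<longlonglongrightarrow> 0"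
  proof (rule tendsto_sandwich[OF _ _ tendsto_const lim_1_over_n])
    show "\<forall>\<^sub>F n in sequentially. 0 \<le> onorm (\<lambda>x. powpow T n x - A x)"
      by (intro always_eventually allI onorm_pos_le bounded_clin_bl bounded_clin_diff[OF powpow_clin[OF T] clin])
    show "\<forall>\<^sub>F n in sequentially. onorm (\<lambda>x. powpow T n x - A x) \<le> 1 / real n"
      using on by (intro eventually_sequentiallyI[of 1])
  qed
  have C0: "class_C_dot0 T" if V0: "\<And>x. (\<lambda>n. (adj V ^^ n) x) \<longlonglongrightarrow> 0"
    unfolding class_C_dot0_def
  proof
    fix x
    note caTn = bounded_clin_pow[OF adj_clin[OF cT]]
    \<comment> \<open>The intertwining relation read for adjoints: it carries the decay of the
      powers of \<open>adj V\<close> to the range of \<open>root\<close>.\<close>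
    have aroot: "(adj T ^^ n) (root v) = root ((adj V ^^ n) v)" for n v
    proof (rule eq_by_cinner)
      fix z
      have "cinner z ((adj T ^^ n) (root v)) = cinner ((T ^^ n) z) (root v)" by (rule adj_pow[OF cT, symmetric])
      also have "\<dots> = cinner (root ((T ^^ n) z)) v" by (rule selfadj_swap[OF root_sa, symmetric])
      also have "\<dots> = cinner ((V ^^ n) (root z)) v" by (simp only: rTn)
      also have "\<dots> = cinner (root z) ((adj V ^^ n) v)" by (rule adj_pow[OF V])
      also have "\<dots> = cinner z (root ((adj V ^^ n) v))" by (rule selfadj_swap[OF root_sa])
      finally show "cinner z ((adj T ^^ n) (root v)) = cinner z (root ((adj V ^^ n) v))" .
    qed
    \<comment> \<open>The powers of \<open>adj T\<close> are contractions, so the decay extends to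
      the closure of this range. The complement is killed by \<open>adj T\<close> at once, since
      \<open>T\<close> maps into the range of \<open>P 0\<close>.\<close>
    let ?M = "closure (range root)"
    have M: "csubspace ?M" "closed ?M"
      by (rule csubspace_closure[OF csubspace_range[OF root_clin]], rule closed_closure)
    have in_M: "(\<lambda>n. (adj T ^^ n) (proj ?M x)) \<longlonglongrightarrow> 0"
    proof (rule tendsto_zero_closure[OF caTn _ _ proj_in[OF M]])
      show "norm ((adj T ^^ n) z) \<le> norm z" for n z by (rule contraction_pow[OF contraction_adj[OF T]])
      fix z assume "z \<in> range root"
      then obtain v where v: "z = root v" by (elim imageE)
      have "(\<lambda>n. root ((adj V ^^ n) v)) \<longlonglongrightarrow> root 0" by (rule clin_tendsto[OF root_clin V0])
      then show "(\<lambda>n. (adj T ^^ n) z) \<longlonglongrightarrow> 0" by (simp add: v aroot clin_zero[OF root_clin])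
    qed
    define z where "z = x - proj ?M x"
    have "root z = 0"
    proof (rule eq_by_cinner)
      fix v
      have "cinner v (root z) = cinner (root v) z" by (rule selfadj_swap[OF root_sa, symmetric])
      also have "\<dots> = 0" unfolding z_def by (rule proj_orth[OF M subsetD[OF closure_subset rangeI]])
      finally show "cinner v (root z) = cinner v 0" by simp
    qed
    then have z0: "P 0 z = 0" by - (rule root_inj, simp_all add: P_idem root_P0)
    have az: "adj T z = 0"
    proof (rule eq_by_cinner)
      fix v
      have "cinner v (adj T z) = cinner (T v) z" by (rule cinner_adj[OF cT, symmetric])
      also have "\<dots> = cinner (P 0 (T v)) z" using P01[OF P1T] by simp
      also have "\<dots> = 0" by (simp add: P_swap z0)
      finally show "cinner v (adj T z) = cinner v 0" by simp
    qed
    have "(\<lambda>n. (adj T ^^ n) (proj ?M x) + (adj T ^^ n) z) \<longlonglongrightarrow> 0 + 0"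
    proof (intro tendsto_add in_M)
      have "(adj T ^^ Suc n) z = 0" for n
        by (simp only: funpow_Suc_right comp_apply az clin_zero[OF caTn])
      then show "(\<lambda>n. (adj T ^^ n) z) \<longlonglongrightarrow> 0"
        by - (rule LIMSEQ_imp_Suc, simp only: tendsto_const)
    qed
    then show "(\<lambda>n. (adj T ^^ n) x) \<longlonglongrightarrow> 0"
      by (simp add: z_def clin_diff[OF caTn])
  qed
  show ?thesis by (intro exI[of _ T] conjI impI T lim C0) blast
qed

text \<open>Bases of the slices between consecutive levels are joined with a basis of the eigenspace
  at 1. The latter is needed because the slices exhaust only what lies off that eigenspace.\<close>

lemma adapted_basis_exists:
  "\<exists>B. is_onb (range (P 0)) B \<and> (\<forall>b\<in>B. \<forall>m. P (lev m) b = b \<or> P (lev m) b = 0)"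
proof -
  define G where "G j = E {lev j<..lev (Suc j)}" for j
  have G: "orth_proj (G j)" for j unfolding G_def by (rule E_proj) simp
  have GP: "G j x = P (lev j) x - P (lev (Suc j)) x" for j x
    using lev_mono[of j "Suc j"] by (simp add: G_def E_Ioc P_def)
  have G_low: "P (lev m) x = x" if x: "G j x = x" and "m \<le> j" for j m x
  proof -
    have "P (lev j) (G j x) = G j x"
      using P_mono(1)[OF lev_mono, of j "Suc j" x] by (simp add: GP clin_diff[OF P_clin] P_idem)
    then show ?thesis using P_mono(1)[OF lev_mono[OF \<open>m \<le> j\<close>], of x] x by simp
  qed
  have G_high: "P (lev m) x = 0" if x: "G j x = x" and "Suc j \<le> m" for j m x
  proof -
    have "P (lev (Suc j)) (G j x) = 0"
      using P_mono(2)[OF lev_mono, of j "Suc j" x] by (simp add: GP clin_diff[OF P_clin] P_idem)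
    then show ?thesis
      using P_mono(2)[OF lev_mono[OF \<open>Suc j \<le> m\<close>], of x] x by (simp add: clin_zero[OF P_clin])
  qed
  let ?N = "{x. A x = x}"
  have "csubspace ?N" by (simp add: csubspace_def clin_zero[OF clin] clin_add[OF clin] clin_scaleC[OF clin])
  moreover have "closed ?N" by (intro closed_Collect_eq clin_cont[OF clin] continuous_on_id)
  ultimately obtain BN where BN: "is_onb ?N BN" using onb_exists by metis
  have "\<exists>B. is_onb (range (G j)) B" for j by (rule onb_exists[OF orth_proj_range_closed[OF G]])
  then obtain BG where BG: "\<And>j. is_onb (range (G j)) (BG j)" by metis
  have NP: "P (lev m) b = b" if "b \<in> BN" for m b
  proof -
    have "A b = b" using BN that by (auto simp: is_onb_def)
    then show ?thesis using eigenvector_one_lev by blast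
  qed
  have GB: "G j b = b" if "b \<in> BG j" for j b
  proof -
    have "BG j \<subseteq> range (G j)" using BG[of j] unfolding is_onb_iff by (rule conjunct1)
    then show ?thesis using that orth_proj_range[OF G] by blast
  qed
  define B where "B = BN \<union> (\<Union>j. BG j)"
  have lev_B: "P (lev m) b = b \<or> P (lev m) b = 0" if b: "b \<in> B" for b m
  proof (cases "b \<in> BN")
    case True
    then show ?thesis using NP by simp
  next
    case False
    then obtain j where "b \<in> BG j" using b by (auto simp: B_def)
    then show ?thesis using G_low[OF GB, of b j m] G_high[OF GB, of b j m] by (cases "m \<le> j") simp_all
  qed
  have orth: "cinner b c = 0" if "P (lev m) b = 0" "P (lev m) c = c" for b c m
    using P_swap[of "lev m" b c] that by simp
  have orthGN: "cinner b c = 0" if "b \<in> BG j" "c \<in> BN" for b c j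
    by (rule orth[OF G_high[OF GB[OF that(1)] order_refl] NP[OF that(2)]])
  have orthGG: "cinner b c = 0" if "b \<in> BG i" "c \<in> BG j" "i < j" for b c i j
    using that(3) by (intro orth[OF G_high[OF GB[OF that(1)] order_refl] G_low[OF GB[OF that(2)]]]) simp
  have oBN: "orthonormal BN" and oBG: "\<And>j. orthonormal (BG j)"
    using is_onb_orthonormal BN BG by blast+
  have oB: "orthonormal B"
    unfolding orthonormal_def
  proof (intro conjI ballI impI)
    fix b assume "b \<in> B"
    then show "norm b = 1" using oBN oBG by (auto simp: B_def orthonormal_def)
  next
    fix b c assume b: "b \<in> B" and c: "c \<in> B" and ne: "b \<noteq> c"
    consider "b \<in> BN" "c \<in> BN" | j where "b \<in> BG j" "c \<in> BN" | j where "b \<in> BN" "c \<in> BG j"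
      | i j where "b \<in> BG i" "c \<in> BG j"
      using b c by (auto simp: B_def)
    then show "cinner b c = 0"
    proof cases
      case 1
      then show ?thesis using orthonormal_cinner[OF oBN] ne by simp
    next
      case 2
      then show ?thesis by (rule orthGN)
    next
      case 3
      then show ?thesis using orthGN cinner_commute_zero by blast
    next
      case (4 i j)
      show ?thesis
      proof (cases i j rule: linorder_cases)
        case less
        then show ?thesis using orthGG 4 by blast
      next
        case equal
        then show ?thesis using orthonormal_cinner[OF oBG[of j]] 4 ne by simp
      next
        case greater
        then show ?thesis using orthGG 4 cinner_commute_zero by blast
      qed
    qed
  qed
  have "is_onb (range (P 0)) B"
  proof (rule is_onbI[OF P_closed _ oB])
    show "B \<subseteq> range (P 0)"
    proof
      fix b assume b: "b \<in> B"
      have "P (lev 0) b = b"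
      proof (cases "b \<in> BN")
        case True
        then show ?thesis by (rule NP)
      next
        case False
        then obtain j where "b \<in> BG j" using b by (auto simp: B_def)
        then show ?thesis using G_low[OF GB, of b j 0] by simp
      qed
      then show "b \<in> range (P 0)" by (simp add: P_range)
    qed
    fix x assume x: "x \<in> range (P 0)" "\<And>b. b \<in> B \<Longrightarrow> cinner b x = 0"
    have Gx: "G j x = 0" for j
    proof (rule onb_orth_zero[OF BG rangeI])
      fix b assume b: "b \<in> BG j"
      have "cinner b (G j x) = cinner (G j b) x" by (simp only: orth_proj_swap[OF G])
      also have "\<dots> = cinner b x" by (simp only: GB[OF b])
      also have "\<dots> = 0" using b by (intro x(2)) (auto simp: B_def)
      finally show "cinner b (G j x) = 0" .
    qed
    \<comment> \<open>With no component in any slice, \<open>x\<close> never loses anything on its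
      way up and is an eigenvector for 1.\<close>
    have "P (lev m) x = x" for m
    proof (induction m)
      case 0
      show ?case using x(1) by (simp add: P_range)
    next
      case (Suc m)
      then show ?case using Gx[of m] by (simp add: GP)
    qed
    then have "A x = x" using eigenvector_one_lev by blast
    then have "x \<in> ?N" by simp
    then show "x = 0" using x(2) by (intro onb_orth_zero[OF BN]) (auto simp: B_def)
  qed
  then show ?thesis using lev_B by blast
qed

text \<open>The adapted basis turns the subspaces of the flag into sets \<open>L m\<close> of basis
  vectors, whose intersection is a basis of ker(A - I). Equal dimensions become equal cardinalities,
  and the problem is reduced to an injection of sets.\<close>

lemma full_dim_uniform_limit:
  assumes fd: full_dim and inf: "ordLeq2 natLeq (hdim (range (P 0)))"
  shows "\<exists>T. contraction T \<and> (\<lambda>n. onorm (\<lambda>x. powpow T n x - A x)) \<longlonglongrightarrow> 0 \<and>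
    ({x. A x = x} = {0} \<or> ordLeq2 natLeq (hdim {x. A x = x}) \<longrightarrow> class_C_dot0 T)"
proof -
  obtain B where B: "is_onb (range (P 0)) B" and lvB: "\<forall>b\<in>B. \<forall>m. P (lev m) b = b \<or> P (lev m) b = 0"
    using adapted_basis_exists by (elim exE conjE)
  have infB: "infinite B" using inf hdim_infinite_iff[OF B] by simp
  have oB: "orthonormal B" by (rule is_onb_orthonormal[OF B])
  define L where "L m = {b \<in> B. P (lev m) b = b}" for m
  have L_onb: "is_onb (range (P (lev m))) (L m)" for m
  proof (rule is_onbI[OF P_closed])
    show "L m \<subseteq> range (P (lev m))" unfolding L_def P_range[symmetric] by blast
    show "orthonormal (L m)" by (rule orthonormal_subset[OF oB]) (auto simp: L_def)
    fix x assume x: "x \<in> range (P (lev m))" "\<And>b. b \<in> L m \<Longrightarrow> cinner b x = 0"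
    have Px: "P (lev m) x = x" using x(1) by (simp only: P_range)
    show "x = 0"
    proof (rule onb_orth_zero[OF B])
      show "x \<in> range (P 0)" using x(1) P_range_mono[OF lev_nonneg[of m]] by blast
      fix b assume b: "b \<in> B"
      show "cinner b x = 0"
      proof (cases "P (lev m) b = b")
        case True
        then show ?thesis using b by (intro x(2)) (simp add: L_def)
      next
        case False
        then have "P (lev m) b = 0" using lvB b by blast
        then show ?thesis using P_swap[of "lev m" b x] Px by simp
      qed
    qed
  qed
  let ?N = "{x. A x = x}"
  have NL: "(\<Inter>m. L m) = {b \<in> B. A b = b}"
    unfolding eigenvector_one_lev L_def by blast
  have N_onb: "is_onb ?N (\<Inter>m. L m)"
  proof (rule is_onbI)
    show "csubspace ?N" by (simp add: csubspace_def clin_zero[OF clin] clin_add[OF clin] clin_scaleC[OF clin])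
    show "closed ?N" by (intro closed_Collect_eq clin_cont[OF clin] continuous_on_id)
    show "(\<Inter>m. L m) \<subseteq> ?N" unfolding NL by blast
    show "orthonormal (\<Inter>m. L m)" by (rule orthonormal_subset[OF oB]) (auto simp: L_def)
    fix x assume x: "x \<in> ?N" "\<And>b. b \<in> (\<Inter>m. L m) \<Longrightarrow> cinner b x = 0"
    have Px: "P (lev m) x = x" for m using x(1) eigenvector_one_lev by blast
    show "x = 0"
    proof (rule onb_orth_zero[OF B])
      show "x \<in> range (P 0)" using Px[of 0] by (simp add: P_range)
      fix b assume b: "b \<in> B"
      show "cinner b x = 0"
      proof (cases "\<forall>m. P (lev m) b = b")
        case True
        then show ?thesis using b by (intro x(2)) (simp add: L_def)
      next
        case False
        then obtain m where "P (lev m) b = 0" using lvB b by blast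
        then show ?thesis using P_swap[of "lev m" b x] Px[of m] by simp
      qed
    qed
  qed
  have cardL: "ordLeq2 (card_of B) (card_of (L m))" for m
  proof -
    have "ordIso2 (hdim (range (P 0))) (hdim (range (P (lev m))))"
      using fd lev_nonneg lev_less_1 by (simp add: full_dim_def)
    then have "ordIso2 (card_of B) (card_of (L m))"
      using hdim_onb[OF B] hdim_onb[OF L_onb] ordIso_symmetric ordIso_transitive by blast
    then show ?thesis by (rule ordIso_imp_ordLeq)
  qed
  have decL: "\<forall>m n. m \<le> n \<longrightarrow> L n \<subseteq> L m"
  proof (intro allI impI subsetI)
    fix m n b assume mn: "m \<le> n" and "b \<in> L n"
    then show "b \<in> L m" using P_mono(1)[OF lev_mono[OF mn], of b] by (simp add: L_def)
  qed
  have LB: "L m \<subseteq> B" for m by (auto simp: L_def)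
  from level_injection[of B L, OF infB LB decL cardL]
  obtain f where f: "inj_on f B" "f ` B \<subseteq> B" "\<forall>m. \<forall>b\<in>L m. f b \<in> L (Suc m)"
    and f_wf: "(\<Inter>m. L m) = {} \<or> infinite (\<Inter>m. L m) \<longrightarrow> wf {(b, f b) |b. b \<in> B}"
    by (elim exE conjE)
  have projP: "proj (range (P 0)) x = P 0 x" for x
  proof (rule proj_eqI[OF P_closed rangeI])
    fix m assume "m \<in> range (P 0)"
    then have "P 0 m = m" by (simp only: P_range)
    then show "cinner m (x - P 0 x) = 0"
      using P_swap[of 0 m "x - P 0 x"] by (simp add: clin_diff[OF P_clin] P_idem)
  qed
  from isometry_of_injection[OF B orthonormal_subset[OF oB f(2)] f(1)]
  obtain V where V: "bounded_clin V" "\<forall>b\<in>B. V b = f b" "\<And>x. V (P 0 x) = V x" "\<And>x. norm (V x) = norm (P 0 x)"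
    unfolding projP by blast
  have shift: "\<forall>m x. P (lev m) x = x \<longrightarrow> P (lev (Suc m)) (V x) = V x"
  proof (intro allI impI)
    fix m x assume x: "P (lev m) x = x"
    have "closed {x. P (lev (Suc m)) (V x) = V x}"
      by (intro closed_Collect_eq clin_cont[OF bounded_clin_comp[OF P_clin V(1)]] clin_cont[OF V(1)])
    moreover have "cspan (L m) \<subseteq> {x. P (lev (Suc m)) (V x) = V x}"
    proof (rule cspan_subset)
      show "csubspace {x. P (lev (Suc m)) (V x) = V x}"
        by (simp add: csubspace_def clin_zero[OF V(1)] clin_zero[OF P_clin] clin_add[OF V(1)]
            clin_add[OF P_clin] clin_scaleC[OF V(1)] clin_scaleC[OF P_clin])
      show "L m \<subseteq> {x. P (lev (Suc m)) (V x) = V x}"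
      proof
        fix b assume b: "b \<in> L m"
        then have "f b \<in> L (Suc m)" "V b = f b" using f(3) V(2) by (auto simp: L_def)
        then show "b \<in> {x. P (lev (Suc m)) (V x) = V x}" by (simp add: L_def)
      qed
    qed
    ultimately have "closure (cspan (L m)) \<subseteq> {x. P (lev (Suc m)) (V x) = V x}"
      by (intro closure_minimal)
    moreover have "x \<in> closure (cspan (L m))" using L_onb[of m] x P_range[of x "lev m"] by (simp add: is_onb_def)
    ultimately show "P (lev (Suc m)) (V x) = V x" by blast
  qed
  \<comment> \<open>On the basis \<open>adj V\<close> steps back along \<open>f\<close> and kills
    the vectors outside its image. Well-foundedness makes every backward path end, so each basis
    vector is eventually mapped to 0.\<close>
  have pure: "(\<lambda>n. (adj V ^^ n) x) \<longlonglongrightarrow> 0" if wf: "wf {(b, f b) |b. b \<in> B}" for x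
  proof -
    note cV = adj_clin[OF V(1)] and cVn = bounded_clin_pow[OF adj_clin[OF V(1)]]
    \<comment> \<open>The difference has zero form, so it is a positive operator whose form vanishes
      everywhere.\<close>
    have VV: "adj V (V x) = P 0 x" for x
    proof -
      have c: "bounded_clin (\<lambda>x. adj V (V x) - P 0 x)"
        by (rule bounded_clin_diff[OF bounded_clin_comp[OF cV V(1)] P_clin])
      have z: "cinner x (adj V (V x) - P 0 x) = 0" for x
        by (simp add: cinner_diff_right cinner_adj[OF V(1), symmetric] cinner_self V(4) orth_proj_form[OF P_proj])
      have "positive_op (\<lambda>x. adj V (V x) - P 0 x)"
        unfolding positive_op_def using c z by simp
      from positive_op_zero_form[OF this, of x] z[of x] show ?thesis by simp
    qed
    have PV: "P 0 (adj V z) = adj V z" for z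
      by (rule eq_by_cinner) (simp add: P_swap[symmetric] cinner_adj[OF V(1), symmetric] V(3))
    have Suc_pow: "(adj V ^^ Suc n) z = (adj V ^^ n) (adj V z)" for n z
      by (simp only: funpow_Suc_right comp_apply)
    have on_B: "b \<in> B \<longrightarrow> (\<lambda>n. (adj V ^^ n) b) \<longlonglongrightarrow> 0" for b
      using wf
    proof (induction b rule: wf_induct_rule)
      case (less b)
      show ?case
      proof
        assume b: "b \<in> B"
        have "(\<lambda>n. (adj V ^^ Suc n) b) \<longlonglongrightarrow> 0"
        proof (cases "b \<in> f ` B")
          case True
          then obtain c where c: "c \<in> B" "b = f c" by blast
          have "P 0 c = c" by (rule onb_P[OF B c(1)])
          then have "adj V b = c" using VV[of c] V(2) c by simp
          moreover have "(\<lambda>n. (adj V ^^ n) c) \<longlonglongrightarrow> 0" using less[of c] c by blast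
          ultimately show ?thesis by (simp only: Suc_pow)
        next
          case False
          have "adj V b = 0"
          proof (rule onb_orth_zero[OF B])
            show "adj V b \<in> range (P 0)" by (simp only: P_range PV)
            fix c assume c: "c \<in> B"
            have "cinner c (adj V b) = cinner (f c) b" using V(2) c by (simp add: cinner_adj[OF V(1), symmetric])
            also have "\<dots> = 0"
            proof -
              have "f c \<in> B" "f c \<noteq> b" using f(2) c False by blast+
              then show ?thesis using orthonormal_cinner[OF oB _ b, of "f c"] by simp
            qed
            finally show "cinner c (adj V b) = 0" .
          qed
          then show ?thesis by (simp only: Suc_pow clin_zero[OF cVn] tendsto_const)
        qed
        then show "(\<lambda>n. (adj V ^^ n) b) \<longlonglongrightarrow> 0" by (rule LIMSEQ_imp_Suc)
      qed
    qed
    have cspan_B: "cspan B \<subseteq> {z. (\<lambda>n. (adj V ^^ n) z) \<longlonglongrightarrow> 0}"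
    proof (rule cspan_subset)
      show "csubspace {z. (\<lambda>n. (adj V ^^ n) z) \<longlonglongrightarrow> 0}"
        unfolding csubspace_def
      proof (intro conjI ballI allI CollectI)
        show "(\<lambda>n. (adj V ^^ n) 0) \<longlonglongrightarrow> 0" by (simp add: clin_zero[OF cVn])
      next
        fix y z
        assume "y \<in> {z. (\<lambda>n. (adj V ^^ n) z) \<longlonglongrightarrow> 0}" "z \<in> {z. (\<lambda>n. (adj V ^^ n) z) \<longlonglongrightarrow> 0}"
        then show "(\<lambda>n. (adj V ^^ n) (y + z)) \<longlonglongrightarrow> 0"
          using tendsto_add[of "\<lambda>n. (adj V ^^ n) y" 0 sequentially "\<lambda>n. (adj V ^^ n) z" 0]
          by (simp add: clin_add[OF cVn])
      next
        fix c z assume "z \<in> {z. (\<lambda>n. (adj V ^^ n) z) \<longlonglongrightarrow> 0}"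
        then have "(\<lambda>n. scaleC c ((adj V ^^ n) z)) \<longlonglongrightarrow> scaleC c 0"
          by (intro clin_tendsto[OF bounded_clin_scaleC[OF bounded_clin_id(1)]]) simp
        then show "(\<lambda>n. (adj V ^^ n) (scaleC c z)) \<longlonglongrightarrow> 0" by (simp add: clin_scaleC[OF cVn])
      qed
    qed (use on_B in blast)
    have nV: "norm (V x) \<le> 1 * norm x" for x using orth_proj_norm[OF P_proj] by (simp add: V(4))
    have "contraction V" unfolding contraction_iff using V(1) nV by simp
    note con = contraction_pow[OF contraction_adj[OF this]]
    have "(\<lambda>n. (adj V ^^ n) (P 0 x)) \<longlonglongrightarrow> 0"
    proof (rule tendsto_zero_closure[OF cVn con])
      show "P 0 x \<in> closure (cspan B)" using B by (simp add: is_onb_def)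
    qed (use cspan_B in blast)
    moreover have "(adj V ^^ Suc n) (x - P 0 x) = 0" for n
    proof -
      have "adj V (x - P 0 x) = 0"
      proof (rule eq_by_cinner)
        fix z
        have "V z = P 0 (V z)"
          using shift[rule_format, of 0 "P 0 z"] P_mono(1)[OF lev_nonneg[of "Suc 0"], of "V z"] by (simp add: P_idem V(3))
        then have "cinner z (adj V (x - P 0 x)) = cinner (P 0 (V z)) (x - P 0 x)"
          by (simp only: cinner_adj[OF V(1), symmetric])
        also have "\<dots> = 0" by (simp add: P_swap clin_diff[OF P_clin] P_idem)
        finally show "cinner z (adj V (x - P 0 x)) = cinner z 0" by simp
      qed
      then show ?thesis by (simp only: Suc_pow clin_zero[OF cVn])
    qed
    then have "(\<lambda>n. (adj V ^^ n) (x - P 0 x)) \<longlonglongrightarrow> 0"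
      by - (rule LIMSEQ_imp_Suc, simp only: tendsto_const)
    ultimately have "(\<lambda>n. (adj V ^^ n) (P 0 x) + (adj V ^^ n) (x - P 0 x)) \<longlonglongrightarrow> 0 + 0"
      by (intro tendsto_add)
    then show ?thesis by (simp add: clin_add[OF cVn, symmetric])
  qed
  from contraction_of_flag_shift[OF V(1,3,4) shift]
  obtain T where T: "contraction T" "(\<lambda>n. onorm (\<lambda>x. powpow T n x - A x)) \<longlonglongrightarrow> 0"
    "(\<forall>x. (\<lambda>n. (adj V ^^ n) x) \<longlonglongrightarrow> 0) \<longrightarrow> class_C_dot0 T" by (elim exE conjE)
  have "class_C_dot0 T" if N: "?N = {0} \<or> ordLeq2 natLeq (hdim ?N)"
  proof -
    have "(\<Inter>m. L m) = {} \<or> infinite (\<Inter>m. L m)"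
    proof (cases "?N = {0}")
      case True
      have "b \<notin> (\<Inter>m. L m)" for b
      proof
        assume b: "b \<in> (\<Inter>m. L m)"
        then have "b \<in> ?N" "b \<in> B" unfolding NL by blast+
        then show False using True orthonormal_nonzero[OF oB] by blast
      qed
      then show ?thesis by blast
    next
      case False
      then show ?thesis using N hdim_infinite_iff[OF N_onb] by blast
    qed
    then show ?thesis using f_wf pure T(3) by blast
  qed
  then show ?thesis using T(1,2) by blast
qed

end

text \<open>Each condition is shown equivalent to \<open>full_dim\<close>. If the subspace of
  \<open>]0, 1]\<close> is infinite-dimensional, the flag shift supplies \<open>T\<close>; otherwise
  \<open>A\<close> is a projection of finite rank and \<open>T = A\<close> will do.\<close>

theorem mainTheorem4:
  fixes A :: "'a::chilbert \<Rightarrow> 'a"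
  assumes dimH: "ordLess2 natLeq (hdim (UNIV :: 'a set))"
    and posA: "positive_op A" and contrA: "contraction A"
  shows
   "((\<exists>T. contraction T \<and> AT T = A) \<longleftrightarrow>
     (\<exists>T. contraction T \<and> (\<lambda>n. onorm (\<lambda>x. powpow T n x - A x)) \<longlonglongrightarrow> 0))
  \<and> ((\<exists>T. contraction T \<and> (\<lambda>n. onorm (\<lambda>x. powpow T n x - A x)) \<longlonglongrightarrow> 0) \<longleftrightarrow>
     ((orth_proj A \<and> finite_rank A) \<or>
      (ordLeq2 natLeq (hdim (spec_subspace A {0<..1})) \<and>
       r_kappa (hdim (spec_subspace A {0<..1})) A = 1)))
  \<and> (((orth_proj A \<and> finite_rank A) \<or>
      (ordLeq2 natLeq (hdim (spec_subspace A {0<..1})) \<and>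
       r_kappa (hdim (spec_subspace A {0<..1})) A = 1)) \<longleftrightarrow>
     (\<forall>\<delta>::real. 0 \<le> \<delta> \<and> \<delta> < 1 \<longrightarrow>
        ordIso2 (hdim (spec_subspace A {0<..1})) (hdim (spec_subspace A {\<delta><..1}))))
  \<and> ((\<exists>T. contraction T \<and> AT T = A) \<and>
     ({x. A x = x} = {0} \<or> ordLeq2 natLeq (hdim {x. A x = x})) \<longrightarrow>
     (\<exists>T. contraction T \<and> class_C_dot0 T \<and>
          (\<lambda>n. onorm (\<lambda>x. powpow T n x - A x)) \<longlonglongrightarrow> 0))"
proof -
  interpret positive_contraction A by unfold_locales (rule posA, rule contrA)
  let ?lim = "\<lambda>T. (\<lambda>n. onorm (\<lambda>x. powpow T n x - A x)) \<longlonglongrightarrow> 0"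
  let ?\<kappa> = "hdim (range (P 0))"
  have spec0: "spec_subspace A {0<..1} = range (P 0)" by (rule spec_subspace_eq) simp
  have iv: "(\<forall>\<delta>::real. 0 \<le> \<delta> \<and> \<delta> < 1 \<longrightarrow>
      ordIso2 ?\<kappa> (hdim (spec_subspace A {\<delta><..1}))) \<longleftrightarrow> full_dim"
    unfolding full_dim_def by (simp add: spec_subspace_eq)
  have i_iv: full_dim if T: "contraction T" "AT T = A" for T
    by (rule asymptotic_limit_full_dim[OF _ T(1)]) (use AT_form[OF T(1)] T(2) in simp)
  have ii_i: "AT T = A" if "contraction T" "?lim T" for T
    by (rule AT_eqI[OF that(1) clin that(2)])
  have finite_case: "orth_proj A \<and> finite_rank A" if fd: full_dim and fin: "\<not> ordLeq2 natLeq ?\<kappa>"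
  proof -
    obtain B where B: "is_onb (range (P 0)) B" using onb_exists[OF P_closed] by blast
    then have "finite B" using fin hdim_infinite_iff by blast
    from full_dim_finite[OF fd B this] show ?thesis using P_proj[of 0] by metis
  qed
  have iii_iv: "(orth_proj A \<and> finite_rank A) \<or> (ordLeq2 natLeq ?\<kappa> \<and> r_kappa ?\<kappa> A = 1) \<longleftrightarrow> full_dim"
    using full_dim_orth_proj r_kappa_eq_1_iff finite_case by blast
  \<comment> \<open>The powers of a projection are constant from exponent 1 on, so the sequence is
    constant after its first term.\<close>
  have proj_lim: "?lim A" if "orth_proj A"
  proof -
    have An: "(A ^^ Suc n) x = A x" for n x
      by (induction n) (simp_all add: orth_proj_idem[OF that])
    have "powpow A (Suc n) x = A x" for n x
      unfolding powpow_def comp_apply selfadj_adj[OF sa] by (simp only: An orth_proj_idem[OF that])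
    then have "onorm (\<lambda>x. powpow A (Suc n) x - A x) = 0" for n by (simp add: onorm_zero)
    then show ?thesis by - (rule LIMSEQ_imp_Suc, simp only: tendsto_const)
  qed
  have iv_ii: "\<exists>T. contraction T \<and> ?lim T" if fd: full_dim
  proof (cases "ordLeq2 natLeq ?\<kappa>")
    case True
    from full_dim_uniform_limit[OF fd this] obtain T where "contraction T" "?lim T" by (elim exE conjE)
    then show ?thesis by (intro exI[of _ T] conjI)
  next
    case False
    then show ?thesis using finite_case[OF fd] proj_lim contrA by (intro exI[of _ A] conjI) simp_all
  qed
  have C0: "\<exists>T. contraction T \<and> class_C_dot0 T \<and> ?lim T"
    if fd: full_dim and N: "{x. A x = x} = {0} \<or> ordLeq2 natLeq (hdim {x. A x = x})"
  proof (cases "ordLeq2 natLeq ?\<kappa>")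
    case True
    from full_dim_uniform_limit[OF fd this] obtain T where T: "contraction T" "?lim T"
      "{x. A x = x} = {0} \<or> ordLeq2 natLeq (hdim {x. A x = x}) \<longrightarrow> class_C_dot0 T" by (elim exE conjE)
    show ?thesis using T(1,2) mp[OF T(3) N] by (intro exI[of _ T] conjI)
  next
    \<comment> \<open>Here ker(A - I) is the range of \<open>A\<close> and finite-dimensional, so
      the hypothesis on it leaves only \<open>A = 0\<close>.\<close>
    case False
    then have A: "orth_proj A" "finite_rank A" using finite_case[OF fd] by blast+
    have N_range: "{x. A x = x} = range A" using orth_proj_range[OF A(1)] by blast
    have "P 0 = A" by (rule orth_proj_P_eq[OF A(1)]) simp_all
    then have "range (P 0) = range A" by (rule arg_cong)
    then have "\<not> ordLeq2 natLeq (hdim {x. A x = x})" using False N_range by (simp only: simp_thms)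
    then have A0: "A x = 0" for x using N N_range by blast
    have "adj A = A" by (rule selfadj_adj[OF sa])
    have "(adj A ^^ Suc n) x = 0" for n x
      by (simp only: \<open>adj A = A\<close> funpow.simps comp_apply A0)
    then have "(\<lambda>n. (adj A ^^ n) x) \<longlonglongrightarrow> 0" for x by - (rule LIMSEQ_imp_Suc, simp only: tendsto_const)
    then have "class_C_dot0 A" by (simp add: class_C_dot0_def)
    then show ?thesis using proj_lim[OF A(1)] contrA by (intro exI[of _ A] conjI)
  qed
  have ii: "(\<exists>T. contraction T \<and> ?lim T) \<longleftrightarrow> full_dim"
  proof (rule iffI)
    assume "\<exists>T. contraction T \<and> ?lim T"
    then obtain T where T: "contraction T" "?lim T" by (elim exE conjE)
    show full_dim by (rule i_iv[OF T(1) ii_i[OF T]])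
  qed (rule iv_ii)
  have i: "(\<exists>T. contraction T \<and> AT T = A) \<longleftrightarrow> full_dim"
  proof
    assume full_dim
    from iv_ii[OF this] obtain T where T: "contraction T" "?lim T" by (elim exE conjE)
    then show "\<exists>T. contraction T \<and> AT T = A" using ii_i[OF T] by (intro exI[of _ T] conjI)
  next
    assume "\<exists>T. contraction T \<and> AT T = A"
    then show full_dim by (elim exE conjE) (rule i_iv)
  qed
  show ?thesis
    unfolding spec0 iv iii_iv i ii by (intro conjI refl impI, elim conjE) (rule C0)
qed

end
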